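(* Let $R$ be a commutative ring, let $A$ be an Azumaya algebra free over $R$ of dimension $n$, and let $\mathcal F$ be a $\mathcal D$-functor (on the category of Azumaya algebras free over $R$). Then $\mathcal F(A)$ is $n^2$-torsion.
   Context: Let $R$ be a fixed commutative ring. An $R$-algebra $A$ is an Azumaya algebra over $R$ if (1) $A$ is finitely generated, projective and faithful as an $R$-module, and (2) the natural map $A \otimes_R A^{\mathrm{op}} \to \mathrm{End}_R(A)$, $a \otimes b \mapsto (x \mapsto axb)$, is an isomorphism. Let $\mathrm{Az}(R)$ be the category of Azumaya algebras over $R$ that are free as $R$-modules, with $R$-algebra homomorphisms, and let $\mathcal Ab$ be the category of abelian groups (written multiplicatively). A group $G$ is $m$-torsion if $x^m = e$ for all $x\in G$. A functor $\mathcal F : \mathrm{Az}(R) \to \mathcal Ab$ is called a $\mathcal D$-functor if: (1) $\mathcal F(R)$ is the trivial group; (2) for any Azumaya algebra $A$ free over $R$ and any $k \in \mathbb N$, there is a homomorphism $\rho : \mathcal F(M_k(A)) \to \mathcal F(A)$ such that the composition $\mathcal F(A) \to \mathcal F(M_k(A)) \xrightarrow{\rho} \mathcal F(A)$ is $\eta_k$, where $\eta_k(x) = x^k$ and the first map is induced by the $R$-algebra homomorphism $A \to M_k(A)$, $a \mapsto aI_k$; (3) with $\rho$ as in (2), $\ker(\rho)$ is $k$-torsion. *)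

theory Defs
  imports "HOL.Hull" "HOL-Algebra.Module" "HOL-Algebra.AbelCoset" "HOL-Algebra.Elementary_Groups"
begin

section \<open>Modules\<close>

text \<open>
  Module homomorphisms are taken extensional (\<open>undefined\<close> off the carrier), so that equality of
  HOL functions is equality of morphisms; composition is \<^const>\<open>compose\<close>.  Modules without a
  product leave the ring fields \<open>mult\<close> and \<open>one\<close> of the record unspecified.
\<close>

definition mod_hom ::
    "'r ring \<Rightarrow> ('r, 'a, 'm) module_scheme \<Rightarrow> ('r, 'b, 'n) module_scheme \<Rightarrow> ('a \<Rightarrow> 'b) set" where
  "mod_hom R M N = {f \<in> carrier M \<rightarrow>\<^sub>E carrier N.
     (\<forall>x\<in>carrier M. \<forall>y\<in>carrier M. f (x \<oplus>\<^bsub>M\<^esub> y) = f x \<oplus>\<^bsub>N\<^esub> f y) \<and>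
     (\<forall>r\<in>carrier R. \<forall>x\<in>carrier M. f (r \<odot>\<^bsub>M\<^esub> x) = r \<odot>\<^bsub>N\<^esub> f x)}"

definition mod_iso ::
    "'r ring \<Rightarrow> ('r, 'a, 'm) module_scheme \<Rightarrow> ('r, 'b, 'n) module_scheme \<Rightarrow> ('a \<Rightarrow> 'b) set" where
  "mod_iso R M N = {f \<in> mod_hom R M N. bij_betw f (carrier M) (carrier N)}"

definition End_mod :: "'r ring \<Rightarrow> ('r, 'a, 'm) module_scheme \<Rightarrow> ('r, 'a \<Rightarrow> 'a) module" where
  "End_mod R M = \<lparr>carrier = mod_hom R M M,
     mult = compose (carrier M),
     one = (\<lambda>x\<in>carrier M. x),
     zero = (\<lambda>x\<in>carrier M. \<zero>\<^bsub>M\<^esub>),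
     add = (\<lambda>f g. \<lambda>x\<in>carrier M. f x \<oplus>\<^bsub>M\<^esub> g x),
     smult = (\<lambda>r f. \<lambda>x\<in>carrier M. r \<odot>\<^bsub>M\<^esub> f x)\<rparr>"

text \<open>The free module \<open>R\<^sup>(\<^sup>I\<^sup>)\<close>: finitely supported families indexed by \<open>I\<close>.\<close>

definition free_module :: "'r ring \<Rightarrow> 'i set \<Rightarrow> ('r, 'i \<Rightarrow> 'r) module" where
  "free_module R I = \<lparr>carrier = {f \<in> I \<rightarrow>\<^sub>E carrier R. finite {i \<in> I. f i \<noteq> \<zero>\<^bsub>R\<^esub>}},
     mult = undefined,
     one = undefined,
     zero = (\<lambda>i\<in>I. \<zero>\<^bsub>R\<^esub>),
     add = (\<lambda>f g. \<lambda>i\<in>I. f i \<oplus>\<^bsub>R\<^esub> g i),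
     smult = (\<lambda>r f. \<lambda>i\<in>I. r \<otimes>\<^bsub>R\<^esub> f i)\<rparr>"

definition unit_vector :: "'r ring \<Rightarrow> 'i set \<Rightarrow> 'i \<Rightarrow> 'i \<Rightarrow> 'r" where
  "unit_vector R I i = (\<lambda>j\<in>I. if j = i then \<one>\<^bsub>R\<^esub> else \<zero>\<^bsub>R\<^esub>)"

definition generated_submodule ::
    "'r ring \<Rightarrow> ('r, 'a, 'm) module_scheme \<Rightarrow> 'a set \<Rightarrow> 'a set" where
  "generated_submodule R M S = (\<lambda>K. submodule K R M) hull S"

definition finitely_generated :: "'r ring \<Rightarrow> ('r, 'a, 'm) module_scheme \<Rightarrow> bool" where
  "finitely_generated R M \<longleftrightarrow>
     (\<exists>S. finite S \<and> S \<subseteq> carrier M \<and> generated_submodule R M S = carrier M)"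

definition faithful :: "'r ring \<Rightarrow> ('r, 'a, 'm) module_scheme \<Rightarrow> bool" where
  "faithful R M \<longleftrightarrow>
     (\<forall>r\<in>carrier R. (\<forall>x\<in>carrier M. r \<odot>\<^bsub>M\<^esub> x = \<zero>\<^bsub>M\<^esub>) \<longrightarrow> r = \<zero>\<^bsub>R\<^esub>)"

text \<open>
  Index sets from the carrier type are enough in the next two definitions.  A basis can be taken
  inside the module itself (and over the zero ring every module is free on the empty set).  A
  direct summand of any free module splits off from the free module on its own elements.
\<close>

definition free :: "'r ring \<Rightarrow> ('r, 'a, 'm) module_scheme \<Rightarrow> bool" where
  "free R M \<longleftrightarrow> (\<exists>I :: 'a set. mod_iso R (free_module R I) M \<noteq> {})"

text \<open>Projective: isomorphic to a direct summand of a free module.\<close>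

definition projective :: "'r ring \<Rightarrow> ('r, 'a, 'm) module_scheme \<Rightarrow> bool" where
  "projective R M \<longleftrightarrow>
     (\<exists>(I :: 'a set). \<exists>i \<in> mod_hom R M (free_module R I). \<exists>p \<in> mod_hom R (free_module R I) M.
        \<forall>x\<in>carrier M. p (i x) = x)"

definition free_of_rank :: "'r ring \<Rightarrow> ('r, 'a, 'm) module_scheme \<Rightarrow> nat \<Rightarrow> bool" where
  "free_of_rank R M n \<longleftrightarrow> mod_iso R (free_module R {..<n}) M \<noteq> {}"

definition quotient_module ::
    "'r ring \<Rightarrow> ('r, 'a, 'm) module_scheme \<Rightarrow> 'a set \<Rightarrow> ('r, 'a set) module" where
  "quotient_module R M K = \<lparr>carrier = a_rcosets\<^bsub>M\<^esub> K,
     mult = undefined,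
     one = undefined,
     zero = K,
     add = set_add M,
     smult = (\<lambda>r X. \<Union>x\<in>X. K +>\<^bsub>M\<^esub> (r \<odot>\<^bsub>M\<^esub> x))\<rparr>"

text \<open>
  The tensor product is the free module on pairs modulo the submodule generated by the bilinearity
  relations.
\<close>

definition tensor_relations ::
    "'r ring \<Rightarrow> ('r, 'a, 'm) module_scheme \<Rightarrow> ('r, 'b, 'n) module_scheme \<Rightarrow> ('a \<times> 'b \<Rightarrow> 'r) set" where
  "tensor_relations R M N =
    (let F = free_module R (carrier M \<times> carrier N);
         e = (\<lambda>x y. unit_vector R (carrier M \<times> carrier N) (x, y))
     in {e (x \<oplus>\<^bsub>M\<^esub> x') y \<ominus>\<^bsub>F\<^esub> (e x y \<oplus>\<^bsub>F\<^esub> e x' y) | x x' y.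
           x \<in> carrier M \<and> x' \<in> carrier M \<and> y \<in> carrier N} \<union>
        {e x (y \<oplus>\<^bsub>N\<^esub> y') \<ominus>\<^bsub>F\<^esub> (e x y \<oplus>\<^bsub>F\<^esub> e x y') | x y y'.
           x \<in> carrier M \<and> y \<in> carrier N \<and> y' \<in> carrier N} \<union>
        {e (r \<odot>\<^bsub>M\<^esub> x) y \<ominus>\<^bsub>F\<^esub> (r \<odot>\<^bsub>F\<^esub> e x y) | r x y.
           r \<in> carrier R \<and> x \<in> carrier M \<and> y \<in> carrier N} \<union>
        {e x (r \<odot>\<^bsub>N\<^esub> y) \<ominus>\<^bsub>F\<^esub> (r \<odot>\<^bsub>F\<^esub> e x y) | r x y.
           r \<in> carrier R \<and> x \<in> carrier M \<and> y \<in> carrier N})"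

definition tensor_kernel ::
    "'r ring \<Rightarrow> ('r, 'a, 'm) module_scheme \<Rightarrow> ('r, 'b, 'n) module_scheme \<Rightarrow> ('a \<times> 'b \<Rightarrow> 'r) set" where
  "tensor_kernel R M N =
     generated_submodule R (free_module R (carrier M \<times> carrier N)) (tensor_relations R M N)"

definition tensor ::
    "'r ring \<Rightarrow> ('r, 'a, 'm) module_scheme \<Rightarrow> ('r, 'b, 'n) module_scheme
      \<Rightarrow> ('r, ('a \<times> 'b \<Rightarrow> 'r) set) module" where
  "tensor R M N =
     quotient_module R (free_module R (carrier M \<times> carrier N)) (tensor_kernel R M N)"

definition pure_tensor ::
    "'r ring \<Rightarrow> ('r, 'a, 'm) module_scheme \<Rightarrow> ('r, 'b, 'n) module_scheme
      \<Rightarrow> 'a \<Rightarrow> 'b \<Rightarrow> ('a \<times> 'b \<Rightarrow> 'r) set" where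
  "pure_tensor R M N x y =
     tensor_kernel R M N +>\<^bsub>free_module R (carrier M \<times> carrier N)\<^esub>
       unit_vector R (carrier M \<times> carrier N) (x, y)"


section \<open>Azumaya algebras\<close>

text \<open>
  The library locale \<^locale>\<open>algebra\<close> requires a commutative product, hence the following
  locale of associative unital algebras.
\<close>

locale assoc_algebra = module R A + ring A for R :: "'r ring" and A (structure) +
  assumes smult_mult_left: "\<lbrakk>r \<in> carrier R; x \<in> carrier A; y \<in> carrier A\<rbrakk>
      \<Longrightarrow> (r \<odot> x) \<otimes> y = r \<odot> (x \<otimes> y)"
    and smult_mult_right: "\<lbrakk>r \<in> carrier R; x \<in> carrier A; y \<in> carrier A\<rbrakk>
      \<Longrightarrow> x \<otimes> (r \<odot> y) = r \<odot> (x \<otimes> y)"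

definition alg_hom :: "'r ring \<Rightarrow> ('r, 'a) module \<Rightarrow> ('r, 'b) module \<Rightarrow> ('a \<Rightarrow> 'b) set" where
  "alg_hom R A B = ring_hom A B \<inter> mod_hom R A B"

definition opposite :: "('r, 'a) module \<Rightarrow> ('r, 'a) module" where
  "opposite A = A\<lparr>mult := (\<lambda>x y. y \<otimes>\<^bsub>A\<^esub> x)\<rparr>"

text \<open>
  Pure tensors generate the tensor product, so there is only one linear map sending each
  \<open>a \<otimes> b\<close> to \<open>x \<mapsto> a x b\<close>.  It respects products automatically, so that it is an isomorphism
  means that it is bijective.
\<close>

definition natural_map_iso :: "'r ring \<Rightarrow> ('r, 'a) module \<Rightarrow> bool" where
  "natural_map_iso R A \<longleftrightarrow>
     (\<exists>\<phi> \<in> mod_iso R (tensor R A (opposite A)) (End_mod R A).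
        \<forall>a\<in>carrier A. \<forall>b\<in>carrier (opposite A).
          \<phi> (pure_tensor R A (opposite A) a b) = (\<lambda>x\<in>carrier A. a \<otimes>\<^bsub>A\<^esub> x \<otimes>\<^bsub>A\<^esub> b))"

definition azumaya :: "'r ring \<Rightarrow> ('r, 'a) module \<Rightarrow> bool" where
  "azumaya R A \<longleftrightarrow> assoc_algebra R A \<and>
     finitely_generated R A \<and> projective R A \<and> faithful R A \<and> natural_map_iso R A"

text \<open>Rows and columns of a \<open>k \<times> k\<close> matrix are numbered from 0.\<close>

definition matrix_algebra :: "nat \<Rightarrow> ('r, 'a) module \<Rightarrow> ('r, nat \<times> nat \<Rightarrow> 'a) module" where
  "matrix_algebra k A = \<lparr>carrier = {..<k} \<times> {..<k} \<rightarrow>\<^sub>E carrier A,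
     mult = (\<lambda>X Y. \<lambda>(i, j)\<in>{..<k} \<times> {..<k}. \<Oplus>\<^bsub>A\<^esub>l\<in>{..<k}. X (i, l) \<otimes>\<^bsub>A\<^esub> Y (l, j)),
     one = (\<lambda>(i, j)\<in>{..<k} \<times> {..<k}. if i = j then \<one>\<^bsub>A\<^esub> else \<zero>\<^bsub>A\<^esub>),
     zero = (\<lambda>p\<in>{..<k} \<times> {..<k}. \<zero>\<^bsub>A\<^esub>),
     add = (\<lambda>X Y. \<lambda>p\<in>{..<k} \<times> {..<k}. X p \<oplus>\<^bsub>A\<^esub> Y p),
     smult = (\<lambda>r X. \<lambda>p\<in>{..<k} \<times> {..<k}. r \<odot>\<^bsub>A\<^esub> X p)\<rparr>"

definition scalar_matrix :: "nat \<Rightarrow> ('r, 'a) module \<Rightarrow> 'a \<Rightarrow> nat \<times> nat \<Rightarrow> 'a" where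
  "scalar_matrix k A a = (\<lambda>(i, j)\<in>{..<k} \<times> {..<k}. if i = j then a else \<zero>\<^bsub>A\<^esub>)"


section \<open>The category of free Azumaya algebras and D-functors\<close>

text \<open>
  All objects of a category have to live in one HOL type.  The following type contains the scalars,
  arbitrary further elements, and matrices over itself.  Hence for \<^emph>\<open>any\<close> types \<open>'r\<close> and \<open>'b\<close>,
  the base ring over \<open>'r\<close>, a copy (along \<open>Elem\<close>) of each algebra over \<open>'b\<close>, and all iterated
  matrix algebras over these are objects.
\<close>

datatype ('r, 'b) univ = Scalar 'r | Elem 'b | Matrix "nat \<times> nat \<Rightarrow> ('r, 'b) univ"

type_synonym ('r, 'b) obj = "('r, ('r, 'b) univ) module"

text \<open>The copy of an algebra along a map that is injective on its carrier.\<close>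

definition transport :: "('a \<Rightarrow> 'c) \<Rightarrow> ('r, 'a) module \<Rightarrow> ('r, 'c) module" where
  "transport h A = (let g = inv_into (carrier A) h in
     \<lparr>carrier = h ` carrier A,
      mult = (\<lambda>x y. h (g x \<otimes>\<^bsub>A\<^esub> g y)),
      one = h \<one>\<^bsub>A\<^esub>,
      zero = h \<zero>\<^bsub>A\<^esub>,
      add = (\<lambda>x y. h (g x \<oplus>\<^bsub>A\<^esub> g y)),
      smult = (\<lambda>r x. h (r \<odot>\<^bsub>A\<^esub> g x))\<rparr>)"

definition self_algebra :: "'r ring \<Rightarrow> ('r, 'r) module" where
  "self_algebra R = \<lparr>carrier = carrier R, mult = mult R, one = one R,
     zero = zero R, add = add R, smult = mult R\<rparr>"

definition base_obj :: "'r ring \<Rightarrow> ('r, 'b) obj" where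
  "base_obj R = transport Scalar (self_algebra R)"

definition mat_obj :: "nat \<Rightarrow> ('r, 'b) obj \<Rightarrow> ('r, 'b) obj" where
  "mat_obj k A = transport Matrix (matrix_algebra k A)"

definition diag :: "nat \<Rightarrow> ('r, 'b) obj \<Rightarrow> ('r, 'b) univ \<Rightarrow> ('r, 'b) univ" where
  "diag k A = (\<lambda>a\<in>carrier A. Matrix (scalar_matrix k A a))"

definition Az :: "'r ring \<Rightarrow> ('r, 'b) obj set" where
  "Az R = {A. azumaya R A \<and> free R A}"

text \<open>
  A functor from \<open>Az R\<close> to the category of abelian groups: \<open>Fo\<close> acts on objects, \<open>Fm A B\<close> on the morphisms
  from \<open>A\<close> to \<open>B\<close>.
\<close>

locale az_functor =
  fixes R :: "'r ring"
    and Fo :: "('r, 'b) obj \<Rightarrow> 'g monoid"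
    and Fm :: "('r, 'b) obj \<Rightarrow> ('r, 'b) obj \<Rightarrow> (('r, 'b) univ \<Rightarrow> ('r, 'b) univ) \<Rightarrow> 'g \<Rightarrow> 'g"
  assumes Fo_group: "A \<in> Az R \<Longrightarrow> comm_group (Fo A)"
    and Fm_hom: "\<lbrakk>A \<in> Az R; B \<in> Az R; f \<in> alg_hom R A B\<rbrakk> \<Longrightarrow> Fm A B f \<in> hom (Fo A) (Fo B)"
    and Fm_id: "\<lbrakk>A \<in> Az R; x \<in> carrier (Fo A)\<rbrakk> \<Longrightarrow> Fm A A (\<lambda>a\<in>carrier A. a) x = x"
    and Fm_comp: "\<lbrakk>A \<in> Az R; B \<in> Az R; C \<in> Az R; f \<in> alg_hom R A B; g \<in> alg_hom R B C;
        x \<in> carrier (Fo A)\<rbrakk>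
      \<Longrightarrow> Fm A C (compose (carrier A) g f) x = Fm B C g (Fm A B f x)"

definition torsion :: "nat \<Rightarrow> 'g monoid \<Rightarrow> bool" where
  "torsion m G \<longleftrightarrow> (\<forall>x\<in>carrier G. x [^]\<^bsub>G\<^esub> m = \<one>\<^bsub>G\<^esub>)"

text \<open>
  Matrix sizes are positive: \<open>M\<^sub>0(A)\<close> is the zero ring, which is not faithful unless \<open>R\<close> is zero.
\<close>

locale D_functor = az_functor +
  assumes base_trivial: "trivial_group (Fo (base_obj R))"
    and matrix_norm: "\<lbrakk>A \<in> Az R; k \<ge> 1\<rbrakk> \<Longrightarrow>
      \<exists>\<rho> \<in> hom (Fo (mat_obj k A)) (Fo A).
        (\<forall>x\<in>carrier (Fo A). \<rho> (Fm A (mat_obj k A) (diag k A) x) = x [^]\<^bsub>Fo A\<^esub> k) \<and>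
        torsion k ((Fo (mat_obj k A))\<lparr>carrier := kernel (Fo (mat_obj k A)) (Fo A) \<rho>\<rparr>)"

end

theory Submission
  imports Defs
begin

text \<open>
  The embedding \<open>A \<rightarrow> M\<^sub>n(A)\<close> factors through \<open>M\<^sub>n(R)\<close>: the left regular representation sends \<open>A\<close> to
  \<open>End(A) = M\<^sub>n(R)\<close>, and since \<open>A\<close> is Azumaya, \<open>End(A) = A \<otimes> A\<^sup>o\<^sup>p\<close>, which maps to
  \<open>A \<otimes> End(A) = M\<^sub>n(A)\<close> by the right regular representation of \<open>A\<^sup>o\<^sup>p\<close>.  As \<open>F(R)\<close> is trivial,
  \<open>F(M\<^sub>n(R))\<close> equals the kernel of its norm and is \<open>n\<close>-torsion.  Applying the norm of \<open>M\<^sub>n(A)\<close> to the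
  factorisation therefore gives \<open>(x\<^sup>n)\<^sup>n = 1\<close>.  For this \<open>M\<^sub>n(A)\<close> and \<open>M\<^sub>n(R)\<close> must be objects of the
  category.  Their natural maps are onto because every endomorphism is a sum of endomorphisms
  supported on single pairs of matrix entries, and injective because coordinate functionals on
  \<open>A \<otimes> A\<^sup>o\<^sup>p\<close> factor through \<open>End(A)\<close>.
\<close>

section \<open>Linear maps and submodules\<close>

text \<open>The tensor product here is only a module: it carries no multiplication. All
  multiplicative arguments therefore take place in End(A), where the image of a pure tensor is the
  map \<open>sandwich A a b\<close>. The natural map is used through two consequences: the
  sandwiches span End(A), and every bilinear map on pairs from A factors through End(A). Conversely,
  to establish the natural map for a new algebra it is enough to span its endomorphisms by
  sandwiches and to find a functional on them for each pair of basis elements; neither task touches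
  cosets of the tensor product. Both matrix algebras, and their copies inside the object type, are
  handled by one abstract description, \<open>matrix_system\<close>, which is stable under renaming
  of elements. Renaming cannot be avoided, since all objects of the category share one type, and
  since the functor acts on HOL functions the factorisation must be a literal equality with
  \<open>diag\<close>, not an equality up to isomorphism.\<close>

lemma mod_homI:
  assumes "\<And>x. x \<in> carrier M \<Longrightarrow> f x \<in> carrier N"
    and "\<And>x. x \<notin> carrier M \<Longrightarrow> f x = undefined"
    and "\<And>x y. \<lbrakk>x \<in> carrier M; y \<in> carrier M\<rbrakk> \<Longrightarrow> f (x \<oplus>\<^bsub>M\<^esub> y) = f x \<oplus>\<^bsub>N\<^esub> f y"
    and "\<And>r x. \<lbrakk>r \<in> carrier R; x \<in> carrier M\<rbrakk> \<Longrightarrow> f (r \<odot>\<^bsub>M\<^esub> x) = r \<odot>\<^bsub>N\<^esub> f x"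
  shows "f \<in> mod_hom R M N"
  using assms by (auto simp: mod_hom_def)

lemma mod_hom_restrictI:
  assumes "module R M"
    and "\<And>x. x \<in> carrier M \<Longrightarrow> f x \<in> carrier N"
    and "\<And>x y. \<lbrakk>x \<in> carrier M; y \<in> carrier M\<rbrakk> \<Longrightarrow> f (x \<oplus>\<^bsub>M\<^esub> y) = f x \<oplus>\<^bsub>N\<^esub> f y"
    and "\<And>r x. \<lbrakk>r \<in> carrier R; x \<in> carrier M\<rbrakk> \<Longrightarrow> f (r \<odot>\<^bsub>M\<^esub> x) = r \<odot>\<^bsub>N\<^esub> f x"
  shows "restrict f (carrier M) \<in> mod_hom R M N"
proof -
  interpret module R M by fact
  show ?thesis using assms by (intro mod_homI) auto
qed

lemma mod_hom_closed: "f \<in> mod_hom R M N \<Longrightarrow> x \<in> carrier M \<Longrightarrow> f x \<in> carrier N"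
  by (auto simp: mod_hom_def)

lemma mod_hom_add:
  "f \<in> mod_hom R M N \<Longrightarrow> x \<in> carrier M \<Longrightarrow> y \<in> carrier M \<Longrightarrow> f (x \<oplus>\<^bsub>M\<^esub> y) = f x \<oplus>\<^bsub>N\<^esub> f y"
  by (auto simp: mod_hom_def)

lemma mod_hom_smult:
  "f \<in> mod_hom R M N \<Longrightarrow> r \<in> carrier R \<Longrightarrow> x \<in> carrier M \<Longrightarrow> f (r \<odot>\<^bsub>M\<^esub> x) = r \<odot>\<^bsub>N\<^esub> f x"
  by (auto simp: mod_hom_def)

lemma mod_hom_undefined: "f \<in> mod_hom R M N \<Longrightarrow> x \<notin> carrier M \<Longrightarrow> f x = undefined"
  by (auto simp: mod_hom_def)

lemma mod_hom_eqI:
  assumes "f \<in> mod_hom R M N" "g \<in> mod_hom R M P"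
    and "\<And>x. x \<in> carrier M \<Longrightarrow> f x = g x"
  shows "f = g"
  using assms by (auto simp: fun_eq_iff) (metis mod_hom_undefined)

lemma mod_hom_zero:
  assumes "module R M" "module R N" "f \<in> mod_hom R M N"
  shows "f \<zero>\<^bsub>M\<^esub> = \<zero>\<^bsub>N\<^esub>"
proof -
  interpret M: module R M by fact
  interpret N: module R N by fact
  have "f (\<zero>\<^bsub>R\<^esub> \<odot>\<^bsub>M\<^esub> \<zero>\<^bsub>M\<^esub>) = \<zero>\<^bsub>R\<^esub> \<odot>\<^bsub>N\<^esub> f \<zero>\<^bsub>M\<^esub>"
    using assms(3) by (intro mod_hom_smult) auto
  then show ?thesis using mod_hom_closed[OF assms(3)] by simp
qed

lemma mod_hom_minus:
  assumes "module R M" "module R N" "f \<in> mod_hom R M N" "x \<in> carrier M" "y \<in> carrier M"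
  shows "f (x \<ominus>\<^bsub>M\<^esub> y) = f x \<ominus>\<^bsub>N\<^esub> f y"
proof -
  interpret M: module R M by fact
  interpret N: module R N by fact
  have "\<ominus>\<^bsub>M\<^esub> y = (\<ominus>\<^bsub>R\<^esub> \<one>\<^bsub>R\<^esub>) \<odot>\<^bsub>M\<^esub> y" using assms by (simp add: M.smult_l_minus)
  then have "f (\<ominus>\<^bsub>M\<^esub> y) = (\<ominus>\<^bsub>R\<^esub> \<one>\<^bsub>R\<^esub>) \<odot>\<^bsub>N\<^esub> f y" using assms by (simp add: mod_hom_smult[of f])
  also have "\<dots> = \<ominus>\<^bsub>N\<^esub> f y" using assms by (simp add: N.smult_l_minus mod_hom_closed)
  finally show ?thesis using assms by (simp add: a_minus_def mod_hom_add[of f])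
qed

lemma mod_hom_finsum:
  assumes "module R M" "module R N" "f \<in> mod_hom R M N" "finite S" "g \<in> S \<rightarrow> carrier M"
  shows "f (\<Oplus>\<^bsub>M\<^esub>i\<in>S. g i) = (\<Oplus>\<^bsub>N\<^esub>i\<in>S. f (g i))"
  using assms(4,5)
proof (induction S)
  case empty
  interpret M: module R M by fact
  interpret N: module R N by fact
  show ?case using assms by (simp add: mod_hom_zero[of R])
next
  case (insert x S)
  interpret M: module R M by fact
  interpret N: module R N by fact
  have "(\<lambda>i. f (g i)) \<in> S \<rightarrow> carrier N" "f (g x) \<in> carrier N"
    using insert assms(3) by (auto simp: Pi_iff intro: mod_hom_closed)
  then show ?case using insert assms(3) by (simp add: mod_hom_add[of f])
qed

lemma mod_hom_compose:
  assumes "f \<in> mod_hom R M N" "g \<in> mod_hom R N P" "module R M"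
  shows "compose (carrier M) g f \<in> mod_hom R M P"
proof -
  interpret module R M by fact
  show ?thesis using assms
    by (intro mod_homI) (auto simp: compose_def mod_hom_closed mod_hom_add[of f] mod_hom_add[of g]
        mod_hom_smult[of f] mod_hom_smult[of g])
qed

lemma mod_iso_inv:
  assumes f: "f \<in> mod_iso R M N" and "module R M" "module R N"
  defines "g \<equiv> restrict (inv_into (carrier M) f) (carrier N)"
  shows "g \<in> mod_iso R N M" "\<And>x. x \<in> carrier M \<Longrightarrow> g (f x) = x"
    "\<And>y. y \<in> carrier N \<Longrightarrow> f (g y) = y"
proof -
  interpret M: module R M by fact
  interpret N: module R N by fact
  have bij: "bij_betw f (carrier M) (carrier N)" and hom: "f \<in> mod_hom R M N"
    using f by (auto simp: mod_iso_def)
  show gf: "g (f x) = x" if "x \<in> carrier M" for x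
    using that bij unfolding g_def
    by (simp add: bij_betw_inv_into_left mod_hom_closed[OF hom])
  show fg: "f (g y) = y" if "y \<in> carrier N" for y
    using that bij unfolding g_def by (simp add: bij_betw_inv_into_right)
  have g: "g y \<in> carrier M" if "y \<in> carrier N" for y
    using that bij unfolding g_def by (simp add: bij_betw_def inv_into_into)
  have "g \<in> mod_hom R N M"
  proof (rule mod_homI)
    fix x y assume "x \<in> carrier N" "y \<in> carrier N"
    then have "x \<oplus>\<^bsub>N\<^esub> y = f (g x \<oplus>\<^bsub>M\<^esub> g y)" by (simp add: fg g mod_hom_add[OF hom])
    then show "g (x \<oplus>\<^bsub>N\<^esub> y) = g x \<oplus>\<^bsub>M\<^esub> g y" using \<open>x \<in> _\<close> \<open>y \<in> _\<close> by (simp add: gf g)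
  next
    fix r y assume "r \<in> carrier R" "y \<in> carrier N"
    then have "r \<odot>\<^bsub>N\<^esub> y = f (r \<odot>\<^bsub>M\<^esub> g y)" by (simp add: fg g mod_hom_smult[OF hom])
    then show "g (r \<odot>\<^bsub>N\<^esub> y) = r \<odot>\<^bsub>M\<^esub> g y" using \<open>r \<in> _\<close> \<open>y \<in> _\<close> by (simp add: gf g)
  qed (auto simp: g, simp add: g_def)
  moreover have "bij_betw g (carrier N) (carrier M)"
    by (rule bij_betw_byWitness[of _ f]) (auto simp: gf fg g mod_hom_closed[OF hom])
  ultimately show "g \<in> mod_iso R N M" by (simp add: mod_iso_def)
qed

section \<open>Submodules: preimages, equalizers, generation\<close>

lemma (in module) submoduleI':
  assumes "H \<subseteq> carrier M" "\<zero>\<^bsub>M\<^esub> \<in> H"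
    and "\<And>x y. \<lbrakk>x \<in> H; y \<in> H\<rbrakk> \<Longrightarrow> x \<oplus>\<^bsub>M\<^esub> y \<in> H"
    and "\<And>r x. \<lbrakk>r \<in> carrier R; x \<in> H\<rbrakk> \<Longrightarrow> r \<odot>\<^bsub>M\<^esub> x \<in> H"
  shows "submodule H R M"
proof (rule submoduleI)
  fix a assume "a \<in> H"
  then have "a \<in> carrier M" using assms(1) by auto
  then have "(\<ominus>\<^bsub>R\<^esub> \<one>\<^bsub>R\<^esub>) \<odot>\<^bsub>M\<^esub> a = \<ominus>\<^bsub>M\<^esub> a" by (simp add: smult_l_minus)
  then show "\<ominus>\<^bsub>M\<^esub> a \<in> H" using assms(4)[of "\<ominus>\<^bsub>R\<^esub> \<one>\<^bsub>R\<^esub>" a] \<open>a \<in> H\<close> by simp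
qed (use assms in auto)

lemma (in module) submodule_zero: "submodule H R M \<Longrightarrow> \<zero>\<^bsub>M\<^esub> \<in> H"
  using submodule.axioms(1) subgroup.one_closed by fastforce

lemma (in module) submodule_finsum:
  assumes "submodule H R M" "finite S" "f \<in> S \<rightarrow> H"
  shows "(\<Oplus>\<^bsub>M\<^esub>i\<in>S. f i) \<in> H"
  using assms(2,3)
proof (induction S)
  case empty
  then show ?case using submodule_zero[OF assms(1)] by simp
next
  case (insert x S)
  moreover have "f \<in> S \<rightarrow> carrier M" "f x \<in> carrier M"
    using insert submoduleE(1)[OF assms(1)] by auto
  ultimately show ?case using submoduleE(5)[OF assms(1)] by simp
qed

lemma submodule_preimage:
  assumes "module R M" "module R N" "f \<in> mod_hom R M N" "submodule H R N"
  shows "submodule {x \<in> carrier M. f x \<in> H} R M"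
proof -
  interpret M: module R M by fact
  interpret N: module R N by fact
  show ?thesis
    using assms(3) N.submodule_zero[OF assms(4)] N.submoduleE[OF assms(4)] mod_hom_zero[OF assms(1-3)]
    by (intro M.submoduleI') (auto simp: mod_hom_add[of f] mod_hom_smult[of f])
qed

text \<open>This is how uniqueness of linear maps is used throughout: if two linear maps agree on
  generators, the equalizer is a submodule containing the generators and hence everything.\<close>

lemma submodule_equalizer:
  assumes "module R M" "module R N" "f \<in> mod_hom R M N" "g \<in> mod_hom R M N"
  shows "submodule {x \<in> carrier M. f x = g x} R M"
proof -
  interpret M: module R M by fact
  interpret N: module R N by fact
  show ?thesis
    using assms(3,4) mod_hom_zero[OF assms(1-3)] mod_hom_zero[OF assms(1,2,4)]
    by (intro M.submoduleI') (auto simp: mod_hom_add[of f] mod_hom_smult[of f]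
       mod_hom_add[of g] mod_hom_smult[of g])
qed

lemma submodule_image:
  assumes "module R M" "module R N" "f \<in> mod_hom R M N"
  shows "submodule (f ` carrier M) R N"
proof -
  interpret M: module R M by fact
  interpret N: module R N by fact
  show ?thesis
  proof (rule N.submoduleI')
    show "\<zero>\<^bsub>N\<^esub> \<in> f ` carrier M" using mod_hom_zero[OF assms] M.zero_closed by (metis imageI)
  next
    fix x y assume "x \<in> f ` carrier M" "y \<in> f ` carrier M"
    then obtain a b where "a \<in> carrier M" "b \<in> carrier M" "x = f a" "y = f b" by auto
    then have "x \<oplus>\<^bsub>N\<^esub> y = f (a \<oplus>\<^bsub>M\<^esub> b)" using assms by (simp add: mod_hom_add[of f])
    then show "x \<oplus>\<^bsub>N\<^esub> y \<in> f ` carrier M" using \<open>a \<in> _\<close> \<open>b \<in> _\<close> by auto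
  next
    fix r x assume "r \<in> carrier R" "x \<in> f ` carrier M"
    then obtain a where "a \<in> carrier M" "x = f a" by auto
    then have "r \<odot>\<^bsub>N\<^esub> x = f (r \<odot>\<^bsub>M\<^esub> a)" using assms \<open>r \<in> _\<close> by (simp add: mod_hom_smult[of f])
    then show "r \<odot>\<^bsub>N\<^esub> x \<in> f ` carrier M" using \<open>a \<in> _\<close> \<open>r \<in> _\<close> by auto
  qed (use assms in \<open>auto intro: mod_hom_closed\<close>)
qed

text \<open>The hull is an intersection of submodules. Having \<open>S\<close> inside the carrier
  makes the carrier one of them; over an empty family the intersection would be
  \<open>UNIV\<close>.\<close>

lemma generated_submodule_is_submodule:
  assumes "module R M" "S \<subseteq> carrier M"
  shows "submodule (generated_submodule R M S) R M"
proof -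
  interpret module R M by fact
  have "generated_submodule R M S \<subseteq> carrier M"
    unfolding generated_submodule_def by (rule hull_minimal) (use assms carrier_is_submodule in auto)
  then show ?thesis
    by (rule submoduleI') (auto simp: generated_submodule_def hull_def submodule_zero submoduleE)
qed

lemma generated_submodule_subset: "S \<subseteq> generated_submodule R M S"
  by (auto simp: generated_submodule_def hull_subset hull_inc)

lemma generated_submodule_minimal:
  "S \<subseteq> T \<Longrightarrow> submodule T R M \<Longrightarrow> generated_submodule R M S \<subseteq> T"
  unfolding generated_submodule_def by (rule hull_minimal)

section \<open>Endomorphism algebras and free modules\<close>

lemma self_algebra_simps [simp]:
  "carrier (self_algebra R) = carrier R" "mult (self_algebra R) = mult R"
  "one (self_algebra R) = one R" "zero (self_algebra R) = zero R"
  "add (self_algebra R) = add R" "smult (self_algebra R) = mult R"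
  by (simp_all add: self_algebra_def)

lemma assoc_algebraI:
  fixes R :: "'r ring" and A :: "('r, 'a) module" (structure)
  assumes "module R A" "monoid A"
    and "\<And>x y z. \<lbrakk>x \<in> carrier A; y \<in> carrier A; z \<in> carrier A\<rbrakk> \<Longrightarrow> (x \<oplus> y) \<otimes> z = x \<otimes> z \<oplus> y \<otimes> z"
    and "\<And>x y z. \<lbrakk>x \<in> carrier A; y \<in> carrier A; z \<in> carrier A\<rbrakk> \<Longrightarrow> z \<otimes> (x \<oplus> y) = z \<otimes> x \<oplus> z \<otimes> y"
    and "\<And>r x y. \<lbrakk>r \<in> carrier R; x \<in> carrier A; y \<in> carrier A\<rbrakk> \<Longrightarrow> (r \<odot> x) \<otimes> y = r \<odot> (x \<otimes> y)"
    and "\<And>r x y. \<lbrakk>r \<in> carrier R; x \<in> carrier A; y \<in> carrier A\<rbrakk> \<Longrightarrow> x \<otimes> (r \<odot> y) = r \<odot> (x \<otimes> y)"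
  shows "assoc_algebra R A"
proof -
  interpret module R A by fact
  have "ring A" using assms by (intro ringI) (auto intro: M.abelian_group_axioms)
  then show ?thesis using assms
    by (intro assoc_algebra.intro assoc_algebra_axioms.intro) auto
qed

lemma self_algebra: "cring R \<Longrightarrow> assoc_algebra R (self_algebra R)"
proof -
  assume "cring R"
  then interpret cring R .
  have "abelian_group (self_algebra R)"
    by (rule abelian_groupI) (auto simp: a_ac intro: bexI[of _ "\<ominus>\<^bsub>R\<^esub> x" for x] l_neg)
  then have "module R (self_algebra R)"
    using \<open>cring R\<close> by (intro moduleI) (auto simp: l_distr r_distr m_assoc)
  moreover have "monoid (self_algebra R)"
    by (rule monoidI) (auto simp: m_assoc)
  ultimately show ?thesis
    by (intro assoc_algebraI) (auto simp: l_distr r_distr m_ac)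
qed

lemma End_mod_simps [simp]:
  "carrier (End_mod R M) = mod_hom R M M" "mult (End_mod R M) = compose (carrier M)"
  "one (End_mod R M) = (\<lambda>x\<in>carrier M. x)" "zero (End_mod R M) = (\<lambda>x\<in>carrier M. \<zero>\<^bsub>M\<^esub>)"
  "add (End_mod R M) = (\<lambda>f g. \<lambda>x\<in>carrier M. f x \<oplus>\<^bsub>M\<^esub> g x)"
  "smult (End_mod R M) = (\<lambda>r f. \<lambda>x\<in>carrier M. r \<odot>\<^bsub>M\<^esub> f x)"
  by (simp_all add: End_mod_def)

lemma End_mod:
  assumes "module R M"
  shows "assoc_algebra R (End_mod R M)"
proof -
  interpret M: module R M by fact
  note hom = mod_hom_closed[of _ R M M] mod_hom_add[of _ R M M] mod_hom_smult[of _ R M M]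
  have add: "(\<lambda>x\<in>carrier M. f x \<oplus>\<^bsub>M\<^esub> g x) \<in> mod_hom R M M"
    if "f \<in> mod_hom R M M" "g \<in> mod_hom R M M" for f g
    using that by (intro mod_hom_restrictI assms) (auto simp: hom M.smult_r_distr M.a_ac)
  have smult: "(\<lambda>x\<in>carrier M. r \<odot>\<^bsub>M\<^esub> f x) \<in> mod_hom R M M"
    if "f \<in> mod_hom R M M" "r \<in> carrier R" for f r
    using that by (intro mod_hom_restrictI assms)
      (auto simp: hom M.smult_r_distr M.R.m_comm simp flip: M.smult_assoc1)
  have zero: "(\<lambda>x\<in>carrier M. \<zero>\<^bsub>M\<^esub>) \<in> mod_hom R M M"
    by (intro mod_hom_restrictI assms) auto
  have one: "(\<lambda>x\<in>carrier M. x) \<in> mod_hom R M M"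
    by (intro mod_hom_restrictI assms) auto
  have neg: "\<exists>g\<in>mod_hom R M M. (\<lambda>x\<in>carrier M. g x \<oplus>\<^bsub>M\<^esub> f x) = (\<lambda>x\<in>carrier M. \<zero>\<^bsub>M\<^esub>)"
    if f: "f \<in> mod_hom R M M" for f
  proof (rule bexI)
    show "(\<lambda>x\<in>carrier M. (\<ominus>\<^bsub>R\<^esub> \<one>\<^bsub>R\<^esub>) \<odot>\<^bsub>M\<^esub> f x) \<in> mod_hom R M M"
      using f by (intro smult) auto
    show "(\<lambda>x\<in>carrier M. (\<lambda>x\<in>carrier M. (\<ominus>\<^bsub>R\<^esub> \<one>\<^bsub>R\<^esub>) \<odot>\<^bsub>M\<^esub> f x) x \<oplus>\<^bsub>M\<^esub> f x) = (\<lambda>x\<in>carrier M. \<zero>\<^bsub>M\<^esub>)"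
      using f by (intro restrict_ext) (simp add: hom M.smult_l_minus M.l_neg)
  qed
  have ext: "f = g" if "f \<in> mod_hom R M M" "g \<in> mod_hom R M M" "\<And>x. x \<in> carrier M \<Longrightarrow> f x = g x"
    for f g using mod_hom_eqI that by metis
  have grp: "abelian_group (End_mod R M)"
    by (rule abelian_groupI; (simp add: add zero neg del: restrict_apply)?)
      (rule ext; (intro add zero; assumption)?; simp add: hom M.a_ac)+
  have mod: "module R (End_mod R M)"
    using M.is_cring grp
    by (intro moduleI; (simp add: smult del: restrict_apply)?)
      (rule ext; (intro add smult; assumption?)?;
        simp add: hom M.a_ac M.smult_l_distr M.smult_r_distr M.smult_assoc1)+
  have comp: "compose (carrier M) f g \<in> mod_hom R M M"
    if "f \<in> mod_hom R M M" "g \<in> mod_hom R M M" for f g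
    using mod_hom_compose[OF that(2,1) assms] .
  have "monoid (End_mod R M)"
    by (rule monoidI; (simp add: comp one del: restrict_apply)?)
      (rule ext; (intro comp one; assumption)?; simp add: hom compose_def)+
  then show ?thesis using mod
    by (intro assoc_algebraI; simp del: restrict_apply)
      (rule ext; (intro add smult comp; assumption)?; simp add: hom compose_def)+
qed

section \<open>Free modules and linear extension\<close>

lemma free_module_simps [simp]:
  "carrier (free_module R I) = {f \<in> I \<rightarrow>\<^sub>E carrier R. finite {i \<in> I. f i \<noteq> \<zero>\<^bsub>R\<^esub>}}"
  "zero (free_module R I) = (\<lambda>i\<in>I. \<zero>\<^bsub>R\<^esub>)"
  "add (free_module R I) = (\<lambda>f g. \<lambda>i\<in>I. f i \<oplus>\<^bsub>R\<^esub> g i)"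
  "smult (free_module R I) = (\<lambda>r f. \<lambda>i\<in>I. r \<otimes>\<^bsub>R\<^esub> f i)"
  by (simp_all add: free_module_def)

text \<open>The index set may be infinite, since the tensor product takes all pairs of elements as
  indices. Closure under the operations thus includes that supports stay finite.\<close>

lemma free_module:
  assumes "cring R"
  shows "module R (free_module R I)"
proof -
  interpret R: cring R by fact
  let ?F = "free_module R I"
  have add: "(\<lambda>i\<in>I. f i \<oplus>\<^bsub>R\<^esub> g i) \<in> carrier ?F" if "f \<in> carrier ?F" "g \<in> carrier ?F" for f g
  proof -
    have "{i \<in> I. f i \<oplus>\<^bsub>R\<^esub> g i \<noteq> \<zero>\<^bsub>R\<^esub>} \<subseteq> {i \<in> I. f i \<noteq> \<zero>\<^bsub>R\<^esub>} \<union> {i \<in> I. g i \<noteq> \<zero>\<^bsub>R\<^esub>}"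
      using that by auto
    then have "finite {i \<in> I. f i \<oplus>\<^bsub>R\<^esub> g i \<noteq> \<zero>\<^bsub>R\<^esub>}"
      using that by (auto intro: finite_subset)
    moreover have "{i \<in> I. (\<lambda>i\<in>I. f i \<oplus>\<^bsub>R\<^esub> g i) i \<noteq> \<zero>\<^bsub>R\<^esub>} = {i \<in> I. f i \<oplus>\<^bsub>R\<^esub> g i \<noteq> \<zero>\<^bsub>R\<^esub>}"
      by auto
    ultimately show ?thesis using that by (auto simp: PiE_iff)
  qed
  have smult: "(\<lambda>i\<in>I. r \<otimes>\<^bsub>R\<^esub> f i) \<in> carrier ?F" if "f \<in> carrier ?F" "r \<in> carrier R" for f r
  proof -
    have "{i \<in> I. r \<otimes>\<^bsub>R\<^esub> f i \<noteq> \<zero>\<^bsub>R\<^esub>} \<subseteq> {i \<in> I. f i \<noteq> \<zero>\<^bsub>R\<^esub>}"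
      using that by auto
    then have "finite {i \<in> I. r \<otimes>\<^bsub>R\<^esub> f i \<noteq> \<zero>\<^bsub>R\<^esub>}"
      using that by (auto intro: finite_subset)
    moreover have "{i \<in> I. (\<lambda>i\<in>I. r \<otimes>\<^bsub>R\<^esub> f i) i \<noteq> \<zero>\<^bsub>R\<^esub>} = {i \<in> I. r \<otimes>\<^bsub>R\<^esub> f i \<noteq> \<zero>\<^bsub>R\<^esub>}"
      by auto
    ultimately show ?thesis using that by (auto simp: PiE_iff)
  qed
  have ext: "f = g" if "f \<in> carrier ?F" "g \<in> carrier ?F" "\<And>i. i \<in> I \<Longrightarrow> f i = g i" for f g
    using that by (auto intro: PiE_ext)
  have val: "f i \<in> carrier R" if "f \<in> carrier ?F" "i \<in> I" for f i using that by auto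
  have neg: "\<exists>g\<in>carrier ?F. g \<oplus>\<^bsub>?F\<^esub> f = \<zero>\<^bsub>?F\<^esub>" if f: "f \<in> carrier ?F" for f
  proof
    show "(\<lambda>i\<in>I. (\<ominus>\<^bsub>R\<^esub> \<one>\<^bsub>R\<^esub>) \<otimes>\<^bsub>R\<^esub> f i) \<in> carrier ?F" using f by (intro smult) auto
    show "(\<lambda>i\<in>I. (\<ominus>\<^bsub>R\<^esub> \<one>\<^bsub>R\<^esub>) \<otimes>\<^bsub>R\<^esub> f i) \<oplus>\<^bsub>?F\<^esub> f = \<zero>\<^bsub>?F\<^esub>"
      unfolding free_module_simps(2,3)
      by (rule restrict_ext) (simp add: val[OF f] R.l_minus R.l_neg)
  qed
  have zero: "\<zero>\<^bsub>?F\<^esub> \<in> carrier ?F" by auto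
  note [simp del] = free_module_simps(1)
  have grp: "abelian_group ?F"
  proof (rule abelian_groupI, goal_cases)
    case (3 x y z)
    then show ?case unfolding free_module_simps(3)
      by (intro ext add) (simp_all add: val R.a_assoc)
  next
    case (4 x y)
    then show ?case unfolding free_module_simps(3)
      by (intro ext add) (simp_all add: val R.a_comm)
  next
    case (5 x)
    then show ?case using zero unfolding free_module_simps(2,3)
      by (intro ext add) (simp_all add: val del: restrict_apply, simp add: val)
  qed (use add zero neg in \<open>simp_all del: restrict_apply\<close>)
  show ?thesis using R.is_cring grp
    by (intro moduleI; (simp add: smult del: restrict_apply)?)
      (rule ext; (intro add smult; (assumption | simp))?; simp add: val R.l_distr R.r_distr R.m_assoc)+
qed

lemma unit_vector_closed:
  assumes "cring R"
  shows "unit_vector R I i \<in> carrier (free_module R I)"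
proof -
  interpret R: cring R by fact
  have "{j \<in> I. unit_vector R I i j \<noteq> \<zero>\<^bsub>R\<^esub>} \<subseteq> {i}" by (auto simp: unit_vector_def)
  then show ?thesis by (auto simp: unit_vector_def intro: finite_subset)
qed

text \<open>Induction on a finite set containing the support: clearing the coefficient at one index
  leaves a family with smaller support, and the difference is a multiple of a unit vector. The
  finite set is not confined to \<open>I\<close>, so an index outside \<open>I\<close> is dropped
  without changing the family.\<close>

lemma free_module_span:
  assumes "cring R" and N: "submodule N R (free_module R I)"
    and unit: "\<And>i. i \<in> I \<Longrightarrow> unit_vector R I i \<in> N"
  shows "carrier (free_module R I) \<subseteq> N"
proof -
  interpret R: cring R by fact
  let ?F = "free_module R I"
  interpret F: module R ?F by (rule free_module[OF assms(1)])
  have "f \<in> N" if "finite S" "f \<in> carrier ?F" "{i \<in> I. f i \<noteq> \<zero>\<^bsub>R\<^esub>} \<subseteq> S" for S f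
    using that
  proof (induction S arbitrary: f)
    case empty
    then have "f = \<zero>\<^bsub>?F\<^esub>" by (auto intro!: PiE_ext[where s = "\<lambda>_. carrier R" and k = I])
    with F.submodule_zero[OF N] show ?case by (simp only:)
  next
    case (insert i S)
    show ?case
    proof (cases "i \<in> I")
      case False
      then show ?thesis using insert by (intro insert.IH) auto
    next
      case True
      define g where "g = f(i := \<zero>\<^bsub>R\<^esub>)"
      have "{j \<in> I. g j \<noteq> \<zero>\<^bsub>R\<^esub>} \<subseteq> S" using insert.prems by (auto simp: g_def split: if_splits)
      moreover have "g \<in> carrier ?F"
        using insert.prems True calculation \<open>finite S\<close>
        by (auto simp: g_def PiE_iff extensional_def intro: finite_subset)
      ultimately have "g \<in> N" by (intro insert.IH)
      moreover have "f i \<odot>\<^bsub>?F\<^esub> unit_vector R I i \<in> N"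
        using insert.prems True unit F.submoduleE(4)[OF N, of "f i"] by auto
      ultimately have "g \<oplus>\<^bsub>?F\<^esub> (f i \<odot>\<^bsub>?F\<^esub> unit_vector R I i) \<in> N"
        by (rule F.submoduleE(5)[OF N])
      also have "g \<oplus>\<^bsub>?F\<^esub> (f i \<odot>\<^bsub>?F\<^esub> unit_vector R I i) = f"
        using insert.prems True
        by (intro PiE_ext[where s = "\<lambda>_. carrier R" and k = I])
          (auto simp: g_def unit_vector_def PiE_iff)
      finally show ?thesis .
    qed
  qed
  then show ?thesis by auto
qed

text \<open>The sum in the linear extension runs over the support, which is finite also when the index set
  is infinite; \<^const>\<open>finsum\<close> over an infinite set is junk.\<close>

definition free_lift ::
    "'r ring \<Rightarrow> 'i set \<Rightarrow> ('r, 'a, 'm) module_scheme \<Rightarrow> ('i \<Rightarrow> 'a) \<Rightarrow> ('i \<Rightarrow> 'r) \<Rightarrow> 'a" where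
  "free_lift R I M b = (\<lambda>f\<in>carrier (free_module R I). \<Oplus>\<^bsub>M\<^esub>i\<in>{i \<in> I. f i \<noteq> \<zero>\<^bsub>R\<^esub>}. f i \<odot>\<^bsub>M\<^esub> b i)"

text \<open>The defining sum runs over the support, which depends on the family. Enlarging it by
  zero terms lets sums for different families be compared over one finite set.\<close>

lemma free_lift_eq:
  assumes "module R M" "b \<in> I \<rightarrow> carrier M" "f \<in> carrier (free_module R I)"
    and "finite S" "S \<subseteq> I" "{i \<in> I. f i \<noteq> \<zero>\<^bsub>R\<^esub>} \<subseteq> S"
  shows "free_lift R I M b f = (\<Oplus>\<^bsub>M\<^esub>i\<in>S. f i \<odot>\<^bsub>M\<^esub> b i)"
proof -
  interpret module R M by fact
  have "f i \<odot>\<^bsub>M\<^esub> b i \<in> carrier M" if "i \<in> S" for i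
    using assms that by (intro smult_closed) auto
  moreover have "f i \<odot>\<^bsub>M\<^esub> b i = \<zero>\<^bsub>M\<^esub>" if "i \<in> S - {i \<in> I. f i \<noteq> \<zero>\<^bsub>R\<^esub>}" for i
  proof -
    have "b i \<in> carrier M" "f i = \<zero>\<^bsub>R\<^esub>" using assms that by auto
    then show ?thesis by simp
  qed
  ultimately have "(\<Oplus>\<^bsub>M\<^esub>i\<in>{i \<in> I. f i \<noteq> \<zero>\<^bsub>R\<^esub>}. f i \<odot>\<^bsub>M\<^esub> b i) = (\<Oplus>\<^bsub>M\<^esub>i\<in>S. f i \<odot>\<^bsub>M\<^esub> b i)"
    using assms by (intro M.add.finprod_mono_neutral_cong_left) auto
  then show ?thesis using assms(3) by (simp add: free_lift_def)
qed

lemma free_lift_hom: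
  assumes "module R M" and b: "b \<in> I \<rightarrow> carrier M"
  shows "free_lift R I M b \<in> mod_hom R (free_module R I) M"
proof (rule mod_homI)
  interpret M: module R M by fact
  let ?F = "free_module R I" and ?supp = "\<lambda>f. {i \<in> I. f i \<noteq> \<zero>\<^bsub>R\<^esub>}"
  interpret F: module R ?F by (rule free_module[OF M.is_cring])
  have val: "f i \<odot>\<^bsub>M\<^esub> b i \<in> carrier M" "f i \<in> carrier R" "b i \<in> carrier M"
    if "f \<in> carrier ?F" "i \<in> I" for f i
    using that b by auto
  show "free_lift R I M b f \<in> carrier M" if f: "f \<in> carrier ?F" for f
    using f val[OF f] by (simp add: free_lift_def M.finsum_closed)
  show "free_lift R I M b f = undefined" if "f \<notin> carrier ?F" for f
    using that unfolding free_lift_def restrict_def by (rule if_not_P)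
  show "free_lift R I M b (f \<oplus>\<^bsub>?F\<^esub> g) = free_lift R I M b f \<oplus>\<^bsub>M\<^esub> free_lift R I M b g"
    if f: "f \<in> carrier ?F" and g: "g \<in> carrier ?F" for f g
  proof -
    \<comment> \<open>The support of the sum can be smaller than this union because of cancellation;
      all three sums are taken over \<open>S\<close> instead.\<close>
    define S where "S = ?supp f \<union> ?supp g"
    have S: "finite S" "S \<subseteq> I" "?supp f \<subseteq> S" "?supp g \<subseteq> S" "?supp (f \<oplus>\<^bsub>?F\<^esub> g) \<subseteq> S"
      using f g by (auto simp: S_def)
    have "free_lift R I M b (f \<oplus>\<^bsub>?F\<^esub> g) = (\<Oplus>\<^bsub>M\<^esub>i\<in>S. (f \<oplus>\<^bsub>?F\<^esub> g) i \<odot>\<^bsub>M\<^esub> b i)"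
      by (intro free_lift_eq assms F.add.m_closed f g S)
    also have "\<dots> = (\<Oplus>\<^bsub>M\<^esub>i\<in>S. (f i \<odot>\<^bsub>M\<^esub> b i) \<oplus>\<^bsub>M\<^esub> (g i \<odot>\<^bsub>M\<^esub> b i))"
      using S(2) val[OF f] val[OF g] by (intro M.finsum_cong') (auto simp: M.smult_l_distr)
    also have "\<dots> = (\<Oplus>\<^bsub>M\<^esub>i\<in>S. f i \<odot>\<^bsub>M\<^esub> b i) \<oplus>\<^bsub>M\<^esub> (\<Oplus>\<^bsub>M\<^esub>i\<in>S. g i \<odot>\<^bsub>M\<^esub> b i)"
      using S(2) val[OF f] val[OF g] by (intro M.finsum_addf) auto
    finally show ?thesis using f g S by (simp add: free_lift_eq[OF assms, of _ S])
  qed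
  show "free_lift R I M b (r \<odot>\<^bsub>?F\<^esub> f) = r \<odot>\<^bsub>M\<^esub> free_lift R I M b f"
    if r: "r \<in> carrier R" and f: "f \<in> carrier ?F" for r f
  proof -
    define S where "S = ?supp f"
    have S: "finite S" "S \<subseteq> I" "?supp f \<subseteq> S" "?supp (r \<odot>\<^bsub>?F\<^esub> f) \<subseteq> S"
      using f r by (auto simp: S_def)
    have "free_lift R I M b (r \<odot>\<^bsub>?F\<^esub> f) = (\<Oplus>\<^bsub>M\<^esub>i\<in>S. (r \<odot>\<^bsub>?F\<^esub> f) i \<odot>\<^bsub>M\<^esub> b i)"
      by (intro free_lift_eq assms F.smult_closed f r S)
    also have "\<dots> = (\<Oplus>\<^bsub>M\<^esub>i\<in>S. r \<odot>\<^bsub>M\<^esub> (f i \<odot>\<^bsub>M\<^esub> b i))"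
      using S(2) val[OF f] r by (intro M.finsum_cong') (auto simp: M.smult_assoc1)
    also have "\<dots> = r \<odot>\<^bsub>M\<^esub> (\<Oplus>\<^bsub>M\<^esub>i\<in>S. f i \<odot>\<^bsub>M\<^esub> b i)"
      using S(1,2) val[OF f] r by (intro M.finsum_smult_ldistr[symmetric]) auto
    finally show ?thesis using f S by (simp add: free_lift_eq[OF assms, of _ S])
  qed
qed

lemma free_lift_unit_vector:
  assumes "module R M" "b \<in> I \<rightarrow> carrier M" "i \<in> I"
  shows "free_lift R I M b (unit_vector R I i) = b i"
proof -
  interpret M: module R M by fact
  have "b i \<in> carrier M" using assms by auto
  moreover have "free_lift R I M b (unit_vector R I i) = (\<Oplus>\<^bsub>M\<^esub>j\<in>{i}. unit_vector R I i j \<odot>\<^bsub>M\<^esub> b j)"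
    using assms by (intro free_lift_eq unit_vector_closed M.is_cring) (auto simp: unit_vector_def)
  ultimately show ?thesis using assms by (simp add: unit_vector_def)
qed

section \<open>Tensor products\<close>

lemma quotient_module_simps [simp]:
  "carrier (quotient_module R M K) = a_rcosets\<^bsub>M\<^esub> K" "zero (quotient_module R M K) = K"
  "add (quotient_module R M K) = set_add M"
  "smult (quotient_module R M K) = (\<lambda>r X. \<Union>x\<in>X. K +>\<^bsub>M\<^esub> (r \<odot>\<^bsub>M\<^esub> x))"
  by (simp_all add: quotient_module_def)

text \<open>The last conclusion turns equality of cosets into membership of a difference; it yields
  both the relations between pure tensors and the independence of representatives in
  \<open>tensor_lift\<close>.\<close>

lemma quotient_module:
  assumes "module R M" "submodule K R M"
  shows "module R (quotient_module R M K)"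
    and "(\<lambda>x\<in>carrier M. K +>\<^bsub>M\<^esub> x) \<in> mod_hom R M (quotient_module R M K)"
    and "carrier (quotient_module R M K) = (\<lambda>x. K +>\<^bsub>M\<^esub> x) ` carrier M"
    and "\<And>x y. \<lbrakk>x \<in> carrier M; y \<in> carrier M\<rbrakk> \<Longrightarrow> K +>\<^bsub>M\<^esub> x = K +>\<^bsub>M\<^esub> y \<longleftrightarrow> x \<ominus>\<^bsub>M\<^esub> y \<in> K"
proof -
  interpret M: module R M by fact
  interpret K: abelian_subgroup K M
    using assms(2) by (intro abelian_subgroupI3 additive_subgroup.intro M.abelian_group_axioms)
      (rule submodule.axioms(1))
  let ?Q = "quotient_module R M K"
  show car: "carrier ?Q = (\<lambda>x. K +>\<^bsub>M\<^esub> x) ` carrier M"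
    by (auto simp: A_RCOSETS_def RCOSETS_def a_r_coset_def)
  show eq: "K +>\<^bsub>M\<^esub> x = K +>\<^bsub>M\<^esub> y \<longleftrightarrow> x \<ominus>\<^bsub>M\<^esub> y \<in> K"
    if "x \<in> carrier M" "y \<in> carrier M" for x y
    using that K.a_rcos_module[OF that(2,1)] K.a_rcos_self[OF that(1)] K.a_repr_independence'[of x y]
    by (auto simp: a_minus_def)
  have add: "(K +>\<^bsub>M\<^esub> x) \<oplus>\<^bsub>?Q\<^esub> (K +>\<^bsub>M\<^esub> y) = K +>\<^bsub>M\<^esub> (x \<oplus>\<^bsub>M\<^esub> y)"
    if "x \<in> carrier M" "y \<in> carrier M" for x y
    using that by (simp add: K.a_rcos_sum)
  have smult: "r \<odot>\<^bsub>?Q\<^esub> (K +>\<^bsub>M\<^esub> x) = K +>\<^bsub>M\<^esub> (r \<odot>\<^bsub>M\<^esub> x)"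
    if "x \<in> carrier M" "r \<in> carrier R" for r x
  proof -
    \<comment> \<open>A scalar multiple of a coset is defined as a union over all representatives.
      Every set in this union is the same coset, and the union is over a nonempty set, so it equals
      that coset.\<close>
    have "K +>\<^bsub>M\<^esub> (r \<odot>\<^bsub>M\<^esub> y) = K +>\<^bsub>M\<^esub> (r \<odot>\<^bsub>M\<^esub> x)" if y: "y \<in> K +>\<^bsub>M\<^esub> x" for y
    proof -
      have yc: "y \<in> carrier M" using y \<open>x \<in> _\<close> K.a_elemrcos_carrier by blast
      have "y \<ominus>\<^bsub>M\<^esub> x \<in> K" using y \<open>x \<in> _\<close> yc K.a_rcos_module[of x y] by (simp add: a_minus_def)
      then have "r \<odot>\<^bsub>M\<^esub> (y \<ominus>\<^bsub>M\<^esub> x) \<in> K" using \<open>r \<in> _\<close> M.submoduleE(4)[OF assms(2)] by auto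
      also have "r \<odot>\<^bsub>M\<^esub> (y \<ominus>\<^bsub>M\<^esub> x) = r \<odot>\<^bsub>M\<^esub> y \<ominus>\<^bsub>M\<^esub> r \<odot>\<^bsub>M\<^esub> x"
        using \<open>r \<in> _\<close> \<open>x \<in> _\<close> yc by (simp add: a_minus_def M.smult_r_distr M.smult_r_minus)
      finally show ?thesis using \<open>r \<in> _\<close> \<open>x \<in> _\<close> yc by (simp add: eq)
    qed
    then have "(\<Union>y\<in>K +>\<^bsub>M\<^esub> x. K +>\<^bsub>M\<^esub> (r \<odot>\<^bsub>M\<^esub> y)) = (\<Union>y\<in>K +>\<^bsub>M\<^esub> x. K +>\<^bsub>M\<^esub> (r \<odot>\<^bsub>M\<^esub> x))"
      by (rule SUP_cong[OF refl])
    moreover have "K +>\<^bsub>M\<^esub> x \<noteq> {}" using K.a_rcos_self[OF \<open>x \<in> _\<close>] by blast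
    ultimately show ?thesis by (simp only: quotient_module_simps UN_constant if_False)
  qed
  have zero: "\<zero>\<^bsub>?Q\<^esub> = K +>\<^bsub>M\<^esub> \<zero>\<^bsub>M\<^esub>"
    by (simp add: K.a_subset)
  note [simp del] = quotient_module_simps and [simp] = car add smult zero
  have "abelian_group ?Q"
  proof (rule abelian_groupI)
    show "\<exists>Y\<in>carrier ?Q. Y \<oplus>\<^bsub>?Q\<^esub> X = \<zero>\<^bsub>?Q\<^esub>" if "X \<in> carrier ?Q" for X
    proof -
      obtain x where x: "x \<in> carrier M" "X = K +>\<^bsub>M\<^esub> x" using \<open>X \<in> _\<close> by auto
      then show ?thesis by (intro bexI[of _ "K +>\<^bsub>M\<^esub> (\<ominus>\<^bsub>M\<^esub> x)"]) (auto simp: M.l_neg)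
    qed
  qed (auto simp: M.a_ac)
  then show "module R ?Q"
    using M.is_cring
    by (intro moduleI) (auto simp: M.smult_l_distr M.smult_r_distr M.smult_assoc1)
  show "(\<lambda>x\<in>carrier M. K +>\<^bsub>M\<^esub> x) \<in> mod_hom R M ?Q"
    by (rule mod_hom_restrictI[OF assms(1)]) auto
qed

section \<open>Bilinear maps and the universal property of the tensor product\<close>

definition bilinear_map ::
    "'r ring \<Rightarrow> ('r, 'a, 'm) module_scheme \<Rightarrow> ('r, 'b, 'n) module_scheme \<Rightarrow> ('r, 'c, 'p) module_scheme
      \<Rightarrow> ('a \<Rightarrow> 'b \<Rightarrow> 'c) \<Rightarrow> bool" where
  "bilinear_map R M N P b \<longleftrightarrow>
     (\<forall>x\<in>carrier M. (\<lambda>y\<in>carrier N. b x y) \<in> mod_hom R N P) \<and>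
     (\<forall>y\<in>carrier N. (\<lambda>x\<in>carrier M. b x y) \<in> mod_hom R M P)"

lemma bilinear_mapI:
  assumes "module R M" "module R N"
    and "\<And>x y. \<lbrakk>x \<in> carrier M; y \<in> carrier N\<rbrakk> \<Longrightarrow> b x y \<in> carrier P"
    and "\<And>x x' y. \<lbrakk>x \<in> carrier M; x' \<in> carrier M; y \<in> carrier N\<rbrakk>
      \<Longrightarrow> b (x \<oplus>\<^bsub>M\<^esub> x') y = b x y \<oplus>\<^bsub>P\<^esub> b x' y"
    and "\<And>x y y'. \<lbrakk>x \<in> carrier M; y \<in> carrier N; y' \<in> carrier N\<rbrakk>
      \<Longrightarrow> b x (y \<oplus>\<^bsub>N\<^esub> y') = b x y \<oplus>\<^bsub>P\<^esub> b x y'"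
    and "\<And>r x y. \<lbrakk>r \<in> carrier R; x \<in> carrier M; y \<in> carrier N\<rbrakk> \<Longrightarrow> b (r \<odot>\<^bsub>M\<^esub> x) y = r \<odot>\<^bsub>P\<^esub> b x y"
    and "\<And>r x y. \<lbrakk>r \<in> carrier R; x \<in> carrier M; y \<in> carrier N\<rbrakk> \<Longrightarrow> b x (r \<odot>\<^bsub>N\<^esub> y) = r \<odot>\<^bsub>P\<^esub> b x y"
  shows "bilinear_map R M N P b"
  unfolding bilinear_map_def using assms by (auto intro!: mod_hom_restrictI)

lemma bilinear_mapD:
  assumes "bilinear_map R M N P b" "module R M" "module R N"
  shows "\<And>x y. \<lbrakk>x \<in> carrier M; y \<in> carrier N\<rbrakk> \<Longrightarrow> b x y \<in> carrier P"
    and "\<And>x x' y. \<lbrakk>x \<in> carrier M; x' \<in> carrier M; y \<in> carrier N\<rbrakk>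
      \<Longrightarrow> b (x \<oplus>\<^bsub>M\<^esub> x') y = b x y \<oplus>\<^bsub>P\<^esub> b x' y"
    and "\<And>x y y'. \<lbrakk>x \<in> carrier M; y \<in> carrier N; y' \<in> carrier N\<rbrakk>
      \<Longrightarrow> b x (y \<oplus>\<^bsub>N\<^esub> y') = b x y \<oplus>\<^bsub>P\<^esub> b x y'"
    and "\<And>r x y. \<lbrakk>r \<in> carrier R; x \<in> carrier M; y \<in> carrier N\<rbrakk> \<Longrightarrow> b (r \<odot>\<^bsub>M\<^esub> x) y = r \<odot>\<^bsub>P\<^esub> b x y"
    and "\<And>r x y. \<lbrakk>r \<in> carrier R; x \<in> carrier M; y \<in> carrier N\<rbrakk> \<Longrightarrow> b x (r \<odot>\<^bsub>N\<^esub> y) = r \<odot>\<^bsub>P\<^esub> b x y"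
proof -
  interpret M: module R M by fact
  interpret N: module R N by fact
  have l: "(\<lambda>y\<in>carrier N. b x y) \<in> mod_hom R N P" if "x \<in> carrier M" for x
    using assms(1) that by (simp add: bilinear_map_def)
  have r: "(\<lambda>x\<in>carrier M. b x y) \<in> mod_hom R M P" if "y \<in> carrier N" for y
    using assms(1) that by (simp add: bilinear_map_def)
  show "b x y \<in> carrier P" if "x \<in> carrier M" "y \<in> carrier N" for x y
    using mod_hom_closed[OF l[OF that(1)] that(2)] that by simp
  show "b (x \<oplus>\<^bsub>M\<^esub> x') y = b x y \<oplus>\<^bsub>P\<^esub> b x' y"
    if "x \<in> carrier M" "x' \<in> carrier M" "y \<in> carrier N" for x x' y
    using mod_hom_add[OF r[OF that(3)] that(1,2)] that by simp
  show "b x (y \<oplus>\<^bsub>N\<^esub> y') = b x y \<oplus>\<^bsub>P\<^esub> b x y'"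
    if "x \<in> carrier M" "y \<in> carrier N" "y' \<in> carrier N" for x y y'
    using mod_hom_add[OF l[OF that(1)] that(2,3)] that by simp
  show "b (r \<odot>\<^bsub>M\<^esub> x) y = r \<odot>\<^bsub>P\<^esub> b x y"
    if "r \<in> carrier R" "x \<in> carrier M" "y \<in> carrier N" for r x y
    using mod_hom_smult[OF r[OF that(3)] that(1,2)] that by simp
  show "b x (r \<odot>\<^bsub>N\<^esub> y) = r \<odot>\<^bsub>P\<^esub> b x y"
    if "r \<in> carrier R" "x \<in> carrier M" "y \<in> carrier N" for r x y
    using mod_hom_smult[OF l[OF that(2)] that(1,3)] that by simp
qed

lemma tensor_relations_closed:
  assumes "module R M" "module R N"
  shows "tensor_relations R M N \<subseteq> carrier (free_module R (carrier M \<times> carrier N))"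
proof -
  interpret M: module R M by fact
  let ?I = "carrier M \<times> carrier N"
  interpret F: module R "free_module R ?I" by (rule free_module[OF M.is_cring])
  note [simp del] = free_module_simps
  have "unit_vector R ?I p \<in> carrier (free_module R ?I)" for p
    by (rule unit_vector_closed[OF M.is_cring])
  then show ?thesis unfolding tensor_relations_def Let_def
    by (auto intro!: F.minus_closed F.add.m_closed F.smult_closed)
qed

lemma tensor_kernel_submodule:
  assumes "module R M" "module R N"
  shows "submodule (tensor_kernel R M N) R (free_module R (carrier M \<times> carrier N))"
proof -
  interpret M: module R M by fact
  show ?thesis unfolding tensor_kernel_def
    by (intro generated_submodule_is_submodule free_module M.is_cring tensor_relations_closed assms)
qed

lemma tensor_module:
  assumes "module R M" "module R N"
  shows "module R (tensor R M N)"
proof -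
  interpret M: module R M by fact
  show ?thesis unfolding tensor_def
    by (intro quotient_module(1) free_module M.is_cring tensor_kernel_submodule assms)
qed

lemma pure_tensor_bilinear:
  assumes "module R M" "module R N"
  shows "bilinear_map R M N (tensor R M N) (pure_tensor R M N)"
proof -
  interpret M: module R M by fact
  interpret N: module R N by fact
  let ?I = "carrier M \<times> carrier N" and ?K = "tensor_kernel R M N"
  let ?F = "free_module R ?I" and ?e = "\<lambda>x y. unit_vector R ?I (x, y)"
  interpret F: module R ?F by (rule free_module[OF M.is_cring])
  have K: "submodule ?K R ?F" by (rule tensor_kernel_submodule[OF assms])
  note Q = quotient_module[OF F.module_axioms K]
  note [simp del] = free_module_simps
  have e: "?e x y \<in> carrier ?F" for x y by (rule unit_vector_closed[OF M.is_cring])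
  have rel: "tensor_relations R M N \<subseteq> ?K"
    unfolding tensor_kernel_def by (rule generated_submodule_subset)
  \<comment> \<open>Each bilinearity law is one of the families of generating relations, so the two
    sides have representatives whose difference lies in the kernel.\<close>
  have eq: "pure_tensor R M N x y = ?K +>\<^bsub>?F\<^esub> f"
    if "f \<in> carrier ?F" "?e x y \<ominus>\<^bsub>?F\<^esub> f \<in> tensor_relations R M N" for x y f
    using that rel Q(4)[OF e[of x y]] by (auto simp: pure_tensor_def)
  have add: "?K +>\<^bsub>?F\<^esub> (f \<oplus>\<^bsub>?F\<^esub> g) = (?K +>\<^bsub>?F\<^esub> f) \<oplus>\<^bsub>tensor R M N\<^esub> (?K +>\<^bsub>?F\<^esub> g)"
    if "f \<in> carrier ?F" "g \<in> carrier ?F" for f g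
    using mod_hom_add[OF Q(2) that] that by (simp add: tensor_def)
  have smult: "?K +>\<^bsub>?F\<^esub> (r \<odot>\<^bsub>?F\<^esub> f) = r \<odot>\<^bsub>tensor R M N\<^esub> (?K +>\<^bsub>?F\<^esub> f)"
    if "r \<in> carrier R" "f \<in> carrier ?F" for f r
    using mod_hom_smult[OF Q(2) that] that by (simp add: tensor_def)
  show ?thesis
  proof (rule bilinear_mapI[OF assms])
    fix x y
    show "pure_tensor R M N x y \<in> carrier (tensor R M N)"
      using e[of x y] unfolding tensor_def Q(3) pure_tensor_def by blast
  next
    fix x x' y assume "x \<in> carrier M" "x' \<in> carrier M" "y \<in> carrier N"
    then have "pure_tensor R M N (x \<oplus>\<^bsub>M\<^esub> x') y = ?K +>\<^bsub>?F\<^esub> (?e x y \<oplus>\<^bsub>?F\<^esub> ?e x' y)"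
      by (intro eq F.add.m_closed e) (auto simp: tensor_relations_def Let_def)
    then show "pure_tensor R M N (x \<oplus>\<^bsub>M\<^esub> x') y
        = pure_tensor R M N x y \<oplus>\<^bsub>tensor R M N\<^esub> pure_tensor R M N x' y"
      by (simp add: add e pure_tensor_def)
  next
    fix x y y' assume "x \<in> carrier M" "y \<in> carrier N" "y' \<in> carrier N"
    then have "pure_tensor R M N x (y \<oplus>\<^bsub>N\<^esub> y') = ?K +>\<^bsub>?F\<^esub> (?e x y \<oplus>\<^bsub>?F\<^esub> ?e x y')"
      by (intro eq F.add.m_closed e) (auto simp: tensor_relations_def Let_def)
    then show "pure_tensor R M N x (y \<oplus>\<^bsub>N\<^esub> y')
        = pure_tensor R M N x y \<oplus>\<^bsub>tensor R M N\<^esub> pure_tensor R M N x y'"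
      by (simp add: add e pure_tensor_def)
  next
    fix r x y assume *: "r \<in> carrier R" "x \<in> carrier M" "y \<in> carrier N"
    then have "pure_tensor R M N (r \<odot>\<^bsub>M\<^esub> x) y = ?K +>\<^bsub>?F\<^esub> (r \<odot>\<^bsub>?F\<^esub> ?e x y)"
      by (intro eq F.smult_closed e) (auto simp: tensor_relations_def Let_def)
    then show "pure_tensor R M N (r \<odot>\<^bsub>M\<^esub> x) y = r \<odot>\<^bsub>tensor R M N\<^esub> pure_tensor R M N x y"
      by (simp add: smult e * pure_tensor_def)
    have "pure_tensor R M N x (r \<odot>\<^bsub>N\<^esub> y) = ?K +>\<^bsub>?F\<^esub> (r \<odot>\<^bsub>?F\<^esub> ?e x y)"
      using * by (intro eq F.smult_closed e) (auto simp: tensor_relations_def Let_def)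
    then show "pure_tensor R M N x (r \<odot>\<^bsub>N\<^esub> y) = r \<odot>\<^bsub>tensor R M N\<^esub> pure_tensor R M N x y"
      by (simp add: smult e * pure_tensor_def)
  qed
qed

text \<open>Induction principle for tensors: the preimage of \<open>H\<close> in the free module
  contains all unit vectors, hence is the whole free module, and the quotient map is onto.\<close>

lemma tensor_span:
  assumes "module R M" "module R N" and H: "submodule H R (tensor R M N)"
    and pure: "\<And>x y. \<lbrakk>x \<in> carrier M; y \<in> carrier N\<rbrakk> \<Longrightarrow> pure_tensor R M N x y \<in> H"
  shows "carrier (tensor R M N) \<subseteq> H"
proof -
  interpret M: module R M by fact
  let ?I = "carrier M \<times> carrier N" and ?K = "tensor_kernel R M N"
  let ?F = "free_module R ?I"
  interpret F: module R ?F by (rule free_module[OF M.is_cring])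
  have K: "submodule ?K R ?F" by (rule tensor_kernel_submodule[OF assms(1,2)])
  note Q = quotient_module[OF F.module_axioms K]
  note [simp del] = free_module_simps
  have "submodule {f \<in> carrier ?F. (\<lambda>f\<in>carrier ?F. ?K +>\<^bsub>?F\<^esub> f) f \<in> H} R ?F"
    using Q(1,2) H unfolding tensor_def by (rule submodule_preimage[OF F.module_axioms])
  then have "carrier ?F \<subseteq> {f \<in> carrier ?F. (\<lambda>f\<in>carrier ?F. ?K +>\<^bsub>?F\<^esub> f) f \<in> H}"
    using pure unit_vector_closed[OF M.is_cring, of ?I]
    by (intro free_module_span[OF M.is_cring]) (auto simp: pure_tensor_def)
  then show ?thesis unfolding tensor_def Q(3) by auto
qed

text \<open>The linear extension \<open>L\<close> of \<open>b\<close> to the free module kills the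
  relations, hence the submodule that they generate, and so is constant on cosets. Uniqueness of the
  lift, where it matters, comes from \<open>tensor_span\<close> and
  \<open>submodule_equalizer\<close>.\<close>

lemma tensor_lift:
  assumes "module R M" "module R N" "module R P" and b: "bilinear_map R M N P b"
  obtains g where "g \<in> mod_hom R (tensor R M N) P"
    and "\<And>x y. \<lbrakk>x \<in> carrier M; y \<in> carrier N\<rbrakk> \<Longrightarrow> g (pure_tensor R M N x y) = b x y"
proof -
  interpret M: module R M by fact
  interpret N: module R N by fact
  interpret P: module R P by fact
  let ?I = "carrier M \<times> carrier N" and ?K = "tensor_kernel R M N"
  let ?F = "free_module R ?I" and ?e = "\<lambda>x y. unit_vector R ?I (x, y)" and ?T = "tensor R M N"
  interpret F: module R ?F by (rule free_module[OF M.is_cring])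
  have K: "submodule ?K R ?F" by (rule tensor_kernel_submodule[OF assms(1,2)])
  note Q = quotient_module[OF F.module_axioms K, folded tensor_def]
  note [simp del] = free_module_simps
  note bD = bilinear_mapD[OF b assms(1,2)]
  define L where "L = free_lift R ?I P (\<lambda>(x, y). b x y)"
  have bc: "(\<lambda>(x, y). b x y) \<in> ?I \<rightarrow> carrier P" using bD(1) by auto
  have L: "L \<in> mod_hom R ?F P"
    unfolding L_def by (rule free_lift_hom[OF assms(3) bc])
  have Le: "L (?e x y) = b x y" if "x \<in> carrier M" "y \<in> carrier N" for x y
    unfolding L_def using free_lift_unit_vector[OF assms(3) bc, of "(x, y)"] that by simp
  have e: "?e x y \<in> carrier ?F" for x y by (rule unit_vector_closed[OF M.is_cring])
  have rel: "L (f \<ominus>\<^bsub>?F\<^esub> g) = \<zero>\<^bsub>P\<^esub>" if "f \<in> carrier ?F" "g \<in> carrier ?F" "L f = L g" for f g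
    using that mod_hom_closed[OF L] mod_hom_minus[OF F.module_axioms assms(3) L]
    by (simp add: P.r_neg a_minus_def)
  have "tensor_relations R M N \<subseteq> {f \<in> carrier ?F. L f = \<zero>\<^bsub>P\<^esub>}"
    using tensor_relations_closed[OF assms(1,2)]
    unfolding tensor_relations_def Let_def
    by (auto intro!: rel e simp: mod_hom_add[OF L] mod_hom_smult[OF L] e Le bD)
  moreover have zero: "(\<lambda>f\<in>carrier ?F. \<zero>\<^bsub>P\<^esub>) \<in> mod_hom R ?F P"
    by (rule mod_hom_restrictI[OF F.module_axioms]) auto
  have "submodule {f \<in> carrier ?F. L f = (\<lambda>f\<in>carrier ?F. \<zero>\<^bsub>P\<^esub>) f} R ?F"
    by (rule submodule_equalizer[OF F.module_axioms assms(3) L zero])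
  moreover have "{f \<in> carrier ?F. L f = (\<lambda>f\<in>carrier ?F. \<zero>\<^bsub>P\<^esub>) f} = {f \<in> carrier ?F. L f = \<zero>\<^bsub>P\<^esub>}"
    by auto
  ultimately have KL: "?K \<subseteq> {f \<in> carrier ?F. L f = \<zero>\<^bsub>P\<^esub>}"
    unfolding tensor_kernel_def by (intro generated_submodule_minimal) auto
  have wd: "L f = L g" if "f \<in> carrier ?F" "g \<in> carrier ?F" "?K +>\<^bsub>?F\<^esub> f = ?K +>\<^bsub>?F\<^esub> g" for f g
  proof -
    have "L f \<ominus>\<^bsub>P\<^esub> L g = \<zero>\<^bsub>P\<^esub>"
      using that Q(4)[of f g] KL mod_hom_minus[OF F.module_axioms assms(3) L, of f g] by auto
    moreover have "L f = (L f \<ominus>\<^bsub>P\<^esub> L g) \<oplus>\<^bsub>P\<^esub> L g"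
      using that mod_hom_closed[OF L] by (simp add: a_minus_def P.a_assoc P.l_neg)
    ultimately show ?thesis using that mod_hom_closed[OF L] by simp
  qed
  \<comment> \<open>The representative is chosen arbitrarily; \<open>wd\<close> shows that the value
    does not depend on the choice.\<close>
  define g where "g = (\<lambda>X\<in>carrier ?T. L (SOME f. f \<in> carrier ?F \<and> X = ?K +>\<^bsub>?F\<^esub> f))"
  have g: "g (?K +>\<^bsub>?F\<^esub> f) = L f" if f: "f \<in> carrier ?F" for f
  proof -
    let ?P = "\<lambda>f'. f' \<in> carrier ?F \<and> ?K +>\<^bsub>?F\<^esub> f = ?K +>\<^bsub>?F\<^esub> f'"
    have "?P (SOME f'. ?P f')" by (rule someI[of ?P f]) (use f in simp)
    then have "L (SOME f'. ?P f') = L f" using wd[of f "SOME f'. ?P f'"] f by simp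
    then show ?thesis using f unfolding g_def Q(3) by simp
  qed
  have "g \<in> mod_hom R ?T P"
  proof (rule mod_homI)
    fix X Y assume "X \<in> carrier ?T" "Y \<in> carrier ?T"
    then obtain f h where fh: "f \<in> carrier ?F" "h \<in> carrier ?F" "X = ?K +>\<^bsub>?F\<^esub> f" "Y = ?K +>\<^bsub>?F\<^esub> h"
      unfolding Q(3) by auto
    then have "X \<oplus>\<^bsub>?T\<^esub> Y = ?K +>\<^bsub>?F\<^esub> (f \<oplus>\<^bsub>?F\<^esub> h)" using mod_hom_add[OF Q(2) fh(1,2)] by simp
    then show "g (X \<oplus>\<^bsub>?T\<^esub> Y) = g X \<oplus>\<^bsub>P\<^esub> g Y" using fh by (simp add: g mod_hom_add[OF L])
  next
    fix r X assume "X \<in> carrier ?T" and r: "r \<in> carrier R"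
    then obtain f where f: "f \<in> carrier ?F" "X = ?K +>\<^bsub>?F\<^esub> f"
      unfolding Q(3) by auto
    then have "r \<odot>\<^bsub>?T\<^esub> X = ?K +>\<^bsub>?F\<^esub> (r \<odot>\<^bsub>?F\<^esub> f)" using mod_hom_smult[OF Q(2) r f(1)] r by simp
    then show "g (r \<odot>\<^bsub>?T\<^esub> X) = r \<odot>\<^bsub>P\<^esub> g X" using f r by (simp add: g mod_hom_smult[OF L])
  next
    fix X assume "X \<in> carrier ?T"
    then show "g X \<in> carrier P" unfolding Q(3) using mod_hom_closed[OF L] by (auto simp: g)
  qed (simp add: g_def)
  moreover have "g (pure_tensor R M N x y) = b x y" if "x \<in> carrier M" "y \<in> carrier N" for x y
    using that by (simp add: pure_tensor_def g e Le)
  ultimately show ?thesis by (rule that)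
qed

section \<open>The natural map\<close>

text \<open>A finite basis \<open>e\<close> with its coordinate functionals. The Kronecker condition
  \<open>cf_e\<close> makes the module free, which is stronger than the dual bases that characterise
  finitely generated projective modules. The family \<open>e\<close> need not be injective: over the
  zero ring all its members are zero.\<close>

locale dual_basis = module R M for R :: "'r ring" and M :: "('r, 'a, 'm) module_scheme" (structure) +
  fixes I :: "'i set" and e :: "'i \<Rightarrow> 'a" and cf :: "'i \<Rightarrow> 'a \<Rightarrow> 'r"
  assumes finite_I: "finite I"
    and e_closed [simp]: "i \<in> I \<Longrightarrow> e i \<in> carrier M"
    and cf_hom: "i \<in> I \<Longrightarrow> cf i \<in> mod_hom R M (self_algebra R)"
    and cf_e: "i \<in> I \<Longrightarrow> j \<in> I \<Longrightarrow> cf i (e j) = (if i = j then \<one>\<^bsub>R\<^esub> else \<zero>\<^bsub>R\<^esub>)"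
    and expand: "x \<in> carrier M \<Longrightarrow> (\<Oplus>i\<in>I. cf i x \<odot> e i) = x"
begin

lemma cf_closed [simp]: "i \<in> I \<Longrightarrow> x \<in> carrier M \<Longrightarrow> cf i x \<in> carrier R"
  using mod_hom_closed[OF cf_hom] by auto

lemma cf_add: "i \<in> I \<Longrightarrow> x \<in> carrier M \<Longrightarrow> y \<in> carrier M \<Longrightarrow> cf i (x \<oplus> y) = cf i x \<oplus>\<^bsub>R\<^esub> cf i y"
  using mod_hom_add[OF cf_hom] by auto

lemma cf_smult: "i \<in> I \<Longrightarrow> r \<in> carrier R \<Longrightarrow> x \<in> carrier M \<Longrightarrow> cf i (r \<odot> x) = r \<otimes>\<^bsub>R\<^esub> cf i x"
  using mod_hom_smult[OF cf_hom] by auto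

lemma hom_expand:
  assumes "module R N" "f \<in> mod_hom R M N" "x \<in> carrier M"
  shows "f x = (\<Oplus>\<^bsub>N\<^esub>i\<in>I. cf i x \<odot>\<^bsub>N\<^esub> f (e i))"
proof -
  interpret N: module R N by fact
  have "f x = f (\<Oplus>i\<in>I. cf i x \<odot> e i)" using assms by (simp add: expand)
  also have "\<dots> = (\<Oplus>\<^bsub>N\<^esub>i\<in>I. f (cf i x \<odot> e i))"
    using assms by (intro mod_hom_finsum[OF module_axioms] finite_I) auto
  also have "\<dots> = (\<Oplus>\<^bsub>N\<^esub>i\<in>I. cf i x \<odot>\<^bsub>N\<^esub> f (e i))"
    using assms by (intro N.M.finsum_cong') (auto simp: mod_hom_smult[OF assms(2)] mod_hom_closed[OF assms(2)])
  finally show ?thesis .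
qed

end

section \<open>Two-sided multiplications and the natural map\<close>

lemma opposite_simps [simp]:
  "carrier (opposite A) = carrier A" "mult (opposite A) = (\<lambda>x y. y \<otimes>\<^bsub>A\<^esub> x)"
  "one (opposite A) = one A" "zero (opposite A) = zero A"
  "add (opposite A) = add A" "smult (opposite A) = smult A"
  by (simp_all add: opposite_def)

lemma mod_hom_opposite [simp]: "mod_hom R (opposite A) P = mod_hom R A P"
  by (simp add: mod_hom_def)

lemma bilinear_map_opposite: "bilinear_map R M (opposite A) P b = bilinear_map R M A P b"
  by (simp add: bilinear_map_def)

lemma opposite_module:
  assumes "module R A"
  shows "module R (opposite A)"
proof -
  interpret module R A by fact
  have "abelian_group (opposite A)"
  proof (rule abelian_groupI)
    show "\<exists>y\<in>carrier (opposite A). y \<oplus>\<^bsub>opposite A\<^esub> x = \<zero>\<^bsub>opposite A\<^esub>"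
      if "x \<in> carrier (opposite A)" for x
      using that by (intro bexI[of _ "\<ominus>\<^bsub>A\<^esub> x"]) (auto simp: M.l_neg)
  qed (auto simp: M.a_ac)
  then show ?thesis using is_cring
    by (intro moduleI) (auto simp: smult_l_distr smult_r_distr smult_assoc1)
qed

text \<open>The image of the pure tensor of a and b under the natural map.\<close>

definition sandwich :: "('r, 'a) module \<Rightarrow> 'a \<Rightarrow> 'a \<Rightarrow> 'a \<Rightarrow> 'a" where
  "sandwich A a b = (\<lambda>x\<in>carrier A. a \<otimes>\<^bsub>A\<^esub> x \<otimes>\<^bsub>A\<^esub> b)"

text \<open>Surjectivity of the natural map, without mention of the tensor product. Quantifying over
  submodules puts it in the form of an induction principle for endomorphisms.\<close>

definition sandwich_spanned :: "'r ring \<Rightarrow> ('r, 'a) module \<Rightarrow> bool" where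
  "sandwich_spanned R A \<longleftrightarrow> (\<forall>N. submodule N R (End_mod R A) \<longrightarrow>
     (\<forall>a\<in>carrier A. \<forall>b\<in>carrier A. sandwich A a b \<in> N) \<longrightarrow> mod_hom R A A \<subseteq> N)"

lemma sandwich_bilinear:
  assumes "assoc_algebra R A"
  shows "bilinear_map R A A (End_mod R A) (sandwich A)"
proof -
  interpret A: assoc_algebra R A by fact
  note simps = A.smult_mult_left A.smult_mult_right A.l_distr A.r_distr
  show ?thesis
  proof (rule bilinear_mapI[OF A.module_axioms A.module_axioms])
    show "sandwich A x y \<in> carrier (End_mod R A)" if "x \<in> carrier A" "y \<in> carrier A" for x y
      using that unfolding sandwich_def End_mod_simps
      by (intro mod_hom_restrictI[OF A.module_axioms]) (auto simp: simps)
  qed (auto simp: sandwich_def simps intro!: restrict_ext)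
qed

lemma sandwich_hom:
  assumes "assoc_algebra R A" "a \<in> carrier A" "b \<in> carrier A"
  shows "sandwich A a b \<in> mod_hom R A A"
proof -
  interpret A: assoc_algebra R A by fact
  show ?thesis
    using bilinear_mapD(1)[OF sandwich_bilinear[OF assms(1)] A.module_axioms A.module_axioms assms(2,3)]
    by simp
qed

lemma sandwich_compose:
  assumes "assoc_algebra R A" "a \<in> carrier A" "b \<in> carrier A" "a' \<in> carrier A" "b' \<in> carrier A"
  shows "compose (carrier A) (sandwich A a b) (sandwich A a' b')
      = sandwich A (a \<otimes>\<^bsub>A\<^esub> a') (b' \<otimes>\<^bsub>A\<^esub> b)"
proof -
  interpret A: assoc_algebra R A by fact
  show ?thesis using assms unfolding sandwich_def compose_def
    by (intro restrict_ext) (simp add: A.m_assoc)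
qed

lemma natural_map_iso_spanned:
  assumes A: "assoc_algebra R A" and iso: "natural_map_iso R A"
  shows "sandwich_spanned R A"
  unfolding sandwich_spanned_def
proof (intro allI impI)
  interpret A: assoc_algebra R A by fact
  interpret E: assoc_algebra R "End_mod R A" by (rule End_mod) (rule A.module_axioms)
  let ?T = "tensor R A (opposite A)"
  note op = opposite_module[OF A.module_axioms]
  note T = tensor_module[OF A.module_axioms op]
  fix N assume N: "submodule N R (End_mod R A)"
    and sw: "\<forall>a\<in>carrier A. \<forall>b\<in>carrier A. sandwich A a b \<in> N"
  obtain \<phi> where \<phi>: "\<phi> \<in> mod_iso R ?T (End_mod R A)"
    and pure: "\<And>a b. a \<in> carrier A \<Longrightarrow> b \<in> carrier A \<Longrightarrow>
      \<phi> (pure_tensor R A (opposite A) a b) = sandwich A a b"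
    using iso unfolding natural_map_iso_def sandwich_def by auto
  then have hom: "\<phi> \<in> mod_hom R ?T (End_mod R A)" and bij: "bij_betw \<phi> (carrier ?T) (mod_hom R A A)"
    by (auto simp: mod_iso_def)
  have "carrier ?T \<subseteq> {t \<in> carrier ?T. \<phi> t \<in> N}"
    using sw pure bilinear_mapD(1)[OF pure_tensor_bilinear[OF A.module_axioms op] A.module_axioms op]
    by (intro tensor_span[OF A.module_axioms op] submodule_preimage[OF T E.module_axioms hom N]) auto
  then have "\<phi> ` carrier ?T \<subseteq> N" by auto
  then show "mod_hom R A A \<subseteq> N" by (simp only: bij_betw_imp_surj_on[OF bij])
qed

text \<open>Here End(A) takes over the universal property of the tensor product of A and its
  opposite: the lift from the tensor product is composed with the inverse of the natural
  map.\<close>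

lemma natural_map_iso_lift:
  assumes A: "assoc_algebra R A" and iso: "natural_map_iso R A"
    and P: "module R P" and b: "bilinear_map R A A P b"
  obtains g where "g \<in> mod_hom R (End_mod R A) P"
    and "\<And>x y. \<lbrakk>x \<in> carrier A; y \<in> carrier A\<rbrakk> \<Longrightarrow> g (sandwich A x y) = b x y"
proof -
  interpret A: assoc_algebra R A by fact
  interpret E: assoc_algebra R "End_mod R A" by (rule End_mod) (rule A.module_axioms)
  let ?T = "tensor R A (opposite A)"
  note op = opposite_module[OF A.module_axioms]
  note T = tensor_module[OF A.module_axioms op]
  obtain \<phi> where \<phi>: "\<phi> \<in> mod_iso R ?T (End_mod R A)"
    and pure: "\<And>a b. a \<in> carrier A \<Longrightarrow> b \<in> carrier A \<Longrightarrow>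
      \<phi> (pure_tensor R A (opposite A) a b) = sandwich A a b"
    using iso unfolding natural_map_iso_def sandwich_def by auto
  obtain \<psi> where \<psi>: "\<psi> \<in> mod_iso R (End_mod R A) ?T" "\<And>t. t \<in> carrier ?T \<Longrightarrow> \<psi> (\<phi> t) = t"
    using mod_iso_inv[OF \<phi> T E.module_axioms] by blast
  obtain l where l: "l \<in> mod_hom R ?T P"
    and lp: "\<And>x y. x \<in> carrier A \<Longrightarrow> y \<in> carrier A \<Longrightarrow> l (pure_tensor R A (opposite A) x y) = b x y"
    using tensor_lift[OF A.module_axioms op P, of b] b unfolding bilinear_map_opposite by auto
  show ?thesis
  proof (rule that)
    show "compose (carrier (End_mod R A)) l \<psi> \<in> mod_hom R (End_mod R A) P"
      using \<psi>(1) l by (intro mod_hom_compose E.module_axioms) (auto simp: mod_iso_def)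
    fix x y assume xy: "x \<in> carrier A" "y \<in> carrier A"
    then have "pure_tensor R A (opposite A) x y \<in> carrier ?T"
      using bilinear_mapD(1)[OF pure_tensor_bilinear[OF A.module_axioms op] A.module_axioms op] by auto
    then have "\<psi> (sandwich A x y) = pure_tensor R A (opposite A) x y"
      using \<psi>(2) pure xy by metis
    then show "compose (carrier (End_mod R A)) l \<psi> (sandwich A x y) = b x y"
      using xy sandwich_hom[OF A] lp by (simp add: compose_def)
  qed
qed

text \<open>The tensor product of two functionals, read as a functional on End(A). Applied to
  coordinate functionals it supplies what \<open>natural_map_isoI\<close> asks for.\<close>

lemma natural_map_iso_functional:
  assumes "assoc_algebra R A" "natural_map_iso R A"
    and f: "f \<in> mod_hom R A (self_algebra R)" and g: "g \<in> mod_hom R A (self_algebra R)"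
  shows "\<exists>G\<in>mod_hom R (End_mod R A) (self_algebra R).
      \<forall>a\<in>carrier A. \<forall>b\<in>carrier A. G (sandwich A a b) = f a \<otimes>\<^bsub>R\<^esub> g b"
proof -
  interpret A: assoc_algebra R A by fact
  interpret S: assoc_algebra R "self_algebra R" by (rule self_algebra) (rule A.R.is_cring)
  note f' = mod_hom_closed[OF f, simplified] mod_hom_add[OF f, simplified] mod_hom_smult[OF f, simplified]
  note g' = mod_hom_closed[OF g, simplified] mod_hom_add[OF g, simplified] mod_hom_smult[OF g, simplified]
  have "bilinear_map R A A (self_algebra R) (\<lambda>a b. f a \<otimes>\<^bsub>R\<^esub> g b)"
  proof (rule bilinear_mapI[OF A.module_axioms A.module_axioms], goal_cases)
    case (1 x y) then show ?case by (simp add: f' g')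
  next
    case (2 x x' y) then show ?case by (simp add: f' g' A.R.l_distr)
  next
    case (3 x y y') then show ?case by (simp add: f' g' A.R.r_distr)
  next
    case (4 r x y) then show ?case by (simp add: f' g' A.R.m_assoc)
  next
    case (5 r x y) then show ?case by (simp add: f' g' A.R.m_lcomm)
  qed
  then obtain G where "G \<in> mod_hom R (End_mod R A) (self_algebra R)"
    "\<And>a b. \<lbrakk>a \<in> carrier A; b \<in> carrier A\<rbrakk> \<Longrightarrow> G (sandwich A a b) = f a \<otimes>\<^bsub>R\<^esub> g b"
    by (rule natural_map_iso_lift[OF assms(1,2) S.module_axioms]) (rule that)
  then show ?thesis by (intro bexI[of _ G] ballI)
qed

text \<open>The functionals separate the tensors \<open>e\<^sub>k \<otimes> e\<^sub>l\<close> after applying the natural map, which makes the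
  natural map injective.\<close>

lemma natural_map_isoI:
  assumes "dual_basis R A I e cf" "assoc_algebra R A" and span: "sandwich_spanned R A"
    and functional: "\<And>k l. k \<in> I \<Longrightarrow> l \<in> I \<Longrightarrow>
      \<exists>G\<in>mod_hom R (End_mod R A) (self_algebra R).
        \<forall>a\<in>carrier A. \<forall>b\<in>carrier A. G (sandwich A a b) = cf k a \<otimes>\<^bsub>R\<^esub> cf l b"
  shows "natural_map_iso R A"
proof -
  interpret B: dual_basis R A I e cf by fact
  interpret A: assoc_algebra R A by fact
  interpret E: assoc_algebra R "End_mod R A" by (rule End_mod) (rule B.module_axioms)
  let ?T = "tensor R A (opposite A)" and ?p = "pure_tensor R A (opposite A)"
  note op = opposite_module[OF B.module_axioms]
  interpret T: module R ?T by (rule tensor_module[OF B.module_axioms op])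
  note p_bil = pure_tensor_bilinear[OF B.module_axioms op]
  note p = bilinear_mapD[OF p_bil B.module_axioms op, simplified]
  obtain \<phi> where \<phi>: "\<phi> \<in> mod_hom R ?T (End_mod R A)"
    and \<phi>p: "\<And>a b. a \<in> carrier A \<Longrightarrow> b \<in> carrier A \<Longrightarrow> \<phi> (?p a b) = sandwich A a b"
    using tensor_lift[OF B.module_axioms op E.module_axioms, of "sandwich A"]
      sandwich_bilinear[OF assms(2)] unfolding bilinear_map_opposite by auto
  have surj: "\<phi> ` carrier ?T = mod_hom R A A"
  proof
    show "\<phi> ` carrier ?T \<subseteq> mod_hom R A A" using mod_hom_closed[OF \<phi>] by auto
    have "sandwich A a b \<in> \<phi> ` carrier ?T" if "a \<in> carrier A" "b \<in> carrier A" for a b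
      using \<phi>p that p(1) by (metis imageI)
    moreover have "submodule (\<phi> ` carrier ?T) R (End_mod R A)"
      by (rule submodule_image[OF T.module_axioms E.module_axioms \<phi>])
    ultimately show "mod_hom R A A \<subseteq> \<phi> ` carrier ?T"
      using span unfolding sandwich_spanned_def by blast
  qed
  obtain G where G: "\<And>k l. k \<in> I \<Longrightarrow> l \<in> I \<Longrightarrow> G k l \<in> mod_hom R (End_mod R A) (self_algebra R)"
    and Gs: "\<And>k l a b. \<lbrakk>k \<in> I; l \<in> I; a \<in> carrier A; b \<in> carrier A\<rbrakk>
        \<Longrightarrow> G k l (sandwich A a b) = cf k a \<otimes>\<^bsub>R\<^esub> cf l b"
    using functional by metis
  have Gc: "G k l f \<in> carrier R" if "k \<in> I" "l \<in> I" "f \<in> mod_hom R A A" for k l f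
    using mod_hom_closed[OF G] that by auto
  \<comment> \<open>This map reads off the coordinates of a tensor from its image in End(A) and
    rebuilds the tensor. It fixes pure tensors by bilinear expansion in the basis, hence is the
    identity, so it is a left inverse of \<open>\<phi>\<close> followed by nothing that sees
    \<open>t\<close> itself.\<close>
  define \<rho> where "\<rho> = (\<lambda>t\<in>carrier ?T. \<Oplus>\<^bsub>?T\<^esub>k\<in>I. \<Oplus>\<^bsub>?T\<^esub>l\<in>I. G k l (\<phi> t) \<odot>\<^bsub>?T\<^esub> ?p (e k) (e l))"
  have ec: "e k \<in> carrier A" if "k \<in> I" for k using that by (rule B.e_closed)
  have \<phi>c: "\<phi> t \<in> mod_hom R A A" if "t \<in> carrier ?T" for t using mod_hom_closed[OF \<phi> that] by simp
  have \<rho>: "\<rho> \<in> mod_hom R ?T ?T" unfolding \<rho>_def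
  proof (rule mod_hom_restrictI[OF T.module_axioms], goal_cases)
    case (1 t)
    then show ?case by (auto intro!: T.M.finsum_closed T.smult_closed Gc p ec \<phi>c)
  next
    case (2 t u)
    have "(\<Oplus>\<^bsub>?T\<^esub>k\<in>I. \<Oplus>\<^bsub>?T\<^esub>l\<in>I. G k l (\<phi> (t \<oplus>\<^bsub>?T\<^esub> u)) \<odot>\<^bsub>?T\<^esub> ?p (e k) (e l))
       = (\<Oplus>\<^bsub>?T\<^esub>k\<in>I. \<Oplus>\<^bsub>?T\<^esub>l\<in>I. G k l (\<phi> t) \<odot>\<^bsub>?T\<^esub> ?p (e k) (e l) \<oplus>\<^bsub>?T\<^esub> G k l (\<phi> u) \<odot>\<^bsub>?T\<^esub> ?p (e k) (e l))"
      using 2 by (intro T.M.finsum_cong' refl)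
        (auto simp: mod_hom_add[OF \<phi>] mod_hom_add[OF G] \<phi>c Gc p ec T.smult_l_distr simp del: End_mod_simps(5)
          intro!: T.M.finsum_closed)
    also have "\<dots> = (\<Oplus>\<^bsub>?T\<^esub>k\<in>I. (\<Oplus>\<^bsub>?T\<^esub>l\<in>I. G k l (\<phi> t) \<odot>\<^bsub>?T\<^esub> ?p (e k) (e l))
        \<oplus>\<^bsub>?T\<^esub> (\<Oplus>\<^bsub>?T\<^esub>l\<in>I. G k l (\<phi> u) \<odot>\<^bsub>?T\<^esub> ?p (e k) (e l)))"
      using 2 by (intro T.M.finsum_cong' refl T.M.finsum_addf)
        (auto intro!: T.M.finsum_closed T.smult_closed Gc p ec \<phi>c)
    also have "\<dots> = (\<Oplus>\<^bsub>?T\<^esub>k\<in>I. \<Oplus>\<^bsub>?T\<^esub>l\<in>I. G k l (\<phi> t) \<odot>\<^bsub>?T\<^esub> ?p (e k) (e l))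
        \<oplus>\<^bsub>?T\<^esub> (\<Oplus>\<^bsub>?T\<^esub>k\<in>I. \<Oplus>\<^bsub>?T\<^esub>l\<in>I. G k l (\<phi> u) \<odot>\<^bsub>?T\<^esub> ?p (e k) (e l))"
      using 2 by (intro T.M.finsum_addf) (auto intro!: T.M.finsum_closed T.smult_closed Gc p ec \<phi>c)
    finally show ?case .
  next
    case (3 r t)
    have "(\<Oplus>\<^bsub>?T\<^esub>k\<in>I. \<Oplus>\<^bsub>?T\<^esub>l\<in>I. G k l (\<phi> (r \<odot>\<^bsub>?T\<^esub> t)) \<odot>\<^bsub>?T\<^esub> ?p (e k) (e l))
       = (\<Oplus>\<^bsub>?T\<^esub>k\<in>I. \<Oplus>\<^bsub>?T\<^esub>l\<in>I. r \<odot>\<^bsub>?T\<^esub> (G k l (\<phi> t) \<odot>\<^bsub>?T\<^esub> ?p (e k) (e l)))"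
      using 3 by (intro T.M.finsum_cong' refl)
        (auto simp: mod_hom_smult[OF \<phi>] mod_hom_smult[OF G] \<phi>c Gc p ec T.smult_assoc1 simp del: End_mod_simps(6)
          intro!: T.M.finsum_closed)
    also have "\<dots> = (\<Oplus>\<^bsub>?T\<^esub>k\<in>I. r \<odot>\<^bsub>?T\<^esub> (\<Oplus>\<^bsub>?T\<^esub>l\<in>I. G k l (\<phi> t) \<odot>\<^bsub>?T\<^esub> ?p (e k) (e l)))"
      using 3 by (intro T.M.finsum_cong' refl T.finsum_smult_ldistr[symmetric] B.finite_I)
        (auto intro!: T.M.finsum_closed T.smult_closed Gc p ec \<phi>c)
    also have "\<dots> = r \<odot>\<^bsub>?T\<^esub> (\<Oplus>\<^bsub>?T\<^esub>k\<in>I. \<Oplus>\<^bsub>?T\<^esub>l\<in>I. G k l (\<phi> t) \<odot>\<^bsub>?T\<^esub> ?p (e k) (e l))"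
      using 3 by (intro T.finsum_smult_ldistr[symmetric] B.finite_I)
        (auto intro!: T.M.finsum_closed T.smult_closed Gc p ec \<phi>c)
    finally show ?case .
  qed
  have \<rho>p: "\<rho> (?p a b) = ?p a b" if ab: "a \<in> carrier A" "b \<in> carrier A" for a b
  proof -
    have l: "(\<lambda>x\<in>carrier A. ?p x b) \<in> mod_hom R A ?T"
      using p_bil ab by (simp add: bilinear_map_def)
    have r: "(\<lambda>y\<in>carrier A. ?p x y) \<in> mod_hom R A ?T" if "x \<in> carrier A" for x
      using p_bil that by (simp add: bilinear_map_def)
    have "?p a b = (\<lambda>x\<in>carrier A. ?p x b) a" using ab by simp
    also have "\<dots> = (\<Oplus>\<^bsub>?T\<^esub>k\<in>I. cf k a \<odot>\<^bsub>?T\<^esub> (\<lambda>x\<in>carrier A. ?p x b) (e k))"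
      by (rule B.hom_expand[OF T.module_axioms l ab(1)])
    also have "\<dots> = (\<Oplus>\<^bsub>?T\<^esub>k\<in>I. cf k a \<odot>\<^bsub>?T\<^esub> ?p (e k) b)"
      using ab by (intro T.M.finsum_cong' refl) (auto intro!: T.smult_closed p)
    also have "\<dots> = (\<Oplus>\<^bsub>?T\<^esub>k\<in>I. cf k a \<odot>\<^bsub>?T\<^esub> (\<Oplus>\<^bsub>?T\<^esub>l\<in>I. cf l b \<odot>\<^bsub>?T\<^esub> ?p (e k) (e l)))"
    proof (intro T.M.finsum_cong' refl)
      fix k assume k: "k \<in> I"
      have "?p (e k) b = (\<lambda>y\<in>carrier A. ?p (e k) y) b" using ab by simp
      also have "\<dots> = (\<Oplus>\<^bsub>?T\<^esub>l\<in>I. cf l b \<odot>\<^bsub>?T\<^esub> (\<lambda>y\<in>carrier A. ?p (e k) y) (e l))"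
        by (rule B.hom_expand[OF T.module_axioms r[OF ec[OF k]] ab(2)])
      also have "\<dots> = (\<Oplus>\<^bsub>?T\<^esub>l\<in>I. cf l b \<odot>\<^bsub>?T\<^esub> ?p (e k) (e l))"
        using ab k by (intro T.M.finsum_cong' refl) (auto intro!: T.smult_closed p)
      finally have "?p (e k) b = (\<Oplus>\<^bsub>?T\<^esub>l\<in>I. cf l b \<odot>\<^bsub>?T\<^esub> ?p (e k) (e l))" .
      then show "cf k a \<odot>\<^bsub>?T\<^esub> ?p (e k) b = cf k a \<odot>\<^bsub>?T\<^esub> (\<Oplus>\<^bsub>?T\<^esub>l\<in>I. cf l b \<odot>\<^bsub>?T\<^esub> ?p (e k) (e l))"
        by simp
    qed (use ab in \<open>auto intro!: T.M.finsum_closed T.smult_closed p\<close>)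
    also have "\<dots> = (\<Oplus>\<^bsub>?T\<^esub>k\<in>I. \<Oplus>\<^bsub>?T\<^esub>l\<in>I. cf k a \<odot>\<^bsub>?T\<^esub> (cf l b \<odot>\<^bsub>?T\<^esub> ?p (e k) (e l)))"
      using ab by (intro T.M.finsum_cong' refl T.finsum_smult_ldistr B.finite_I)
        (auto intro!: T.M.finsum_closed T.smult_closed p)
    also have "\<dots> = (\<Oplus>\<^bsub>?T\<^esub>k\<in>I. \<Oplus>\<^bsub>?T\<^esub>l\<in>I. G k l (\<phi> (?p a b)) \<odot>\<^bsub>?T\<^esub> ?p (e k) (e l))"
      using ab by (intro T.M.finsum_cong' refl)
        (auto simp: \<phi>p Gs T.smult_assoc1 p intro!: T.M.finsum_closed T.smult_closed)
    finally show ?thesis using ab by (simp add: \<rho>_def p)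
  qed
  have id: "(\<lambda>t\<in>carrier ?T. t) \<in> mod_hom R ?T ?T"
    by (rule mod_hom_restrictI[OF T.module_axioms]) auto
  have "carrier ?T \<subseteq> {t \<in> carrier ?T. \<rho> t = (\<lambda>t\<in>carrier ?T. t) t}"
    by (intro tensor_span[OF B.module_axioms op] submodule_equalizer[OF T.module_axioms T.module_axioms \<rho> id])
      (auto simp: \<rho>p p)
  then have \<rho>_id: "\<rho> t = t" if "t \<in> carrier ?T" for t using that by auto
  have "inj_on \<phi> (carrier ?T)"
  proof (rule inj_onI)
    fix t u assume "t \<in> carrier ?T" "u \<in> carrier ?T" "\<phi> t = \<phi> u"
    \<comment> \<open>On the carrier, \<open>\<rho>\<close> depends on its argument only through the
      value of \<open>\<phi>\<close>.\<close>
    then have "\<rho> t = \<rho> u" by (simp add: \<rho>_def)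
    then show "t = u" using \<rho>_id \<open>t \<in> _\<close> \<open>u \<in> _\<close> by simp
  qed
  then have "\<phi> \<in> mod_iso R ?T (End_mod R A)" using surj \<phi> by (simp add: mod_iso_def bij_betw_def)
  then show ?thesis unfolding natural_map_iso_def using \<phi>p by (intro bexI[of _ \<phi>]) (auto simp: sandwich_def)
qed

section \<open>Iterated finite sums, and linear maps out of endomorphism modules\<close>

lemma (in abelian_monoid) finsum_swap:
  assumes "finite S" "finite T" "\<And>i j. i \<in> S \<Longrightarrow> j \<in> T \<Longrightarrow> f i j \<in> carrier G"
  shows "(\<Oplus>i\<in>S. \<Oplus>j\<in>T. f i j) = (\<Oplus>j\<in>T. \<Oplus>i\<in>S. f i j)"
  using assms(1,3)
proof (induction S)
  case empty
  then show ?case by simp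
next
  case (insert x S)
  then have "(\<Oplus>i\<in>insert x S. \<Oplus>j\<in>T. f i j) = (\<Oplus>j\<in>T. f x j) \<oplus> (\<Oplus>j\<in>T. \<Oplus>i\<in>S. f i j)"
    by (subst finsum_insert) (auto intro!: finsum_closed)
  also have "\<dots> = (\<Oplus>j\<in>T. f x j \<oplus> (\<Oplus>i\<in>S. f i j))"
    using insert by (intro finsum_addf[symmetric]) (auto intro!: finsum_closed)
  also have "\<dots> = (\<Oplus>j\<in>T. \<Oplus>i\<in>insert x S. f i j)"
    using insert by (intro finsum_cong' refl) (auto simp: Pi_def intro!: finsum_closed)
  finally show ?case .
qed

lemma (in abelian_monoid) finsum_Sigma:
  assumes "finite S" "finite T" "\<And>i j. i \<in> S \<Longrightarrow> j \<in> T \<Longrightarrow> f (i, j) \<in> carrier G"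
  shows "(\<Oplus>p\<in>S \<times> T. f p) = (\<Oplus>i\<in>S. \<Oplus>j\<in>T. f (i, j))"
  using assms(1,3)
proof (induction S)
  case empty
  then show ?case by simp
next
  case (insert x S)
  have "(\<Oplus>p\<in>insert x S \<times> T. f p) = (\<Oplus>p\<in>Pair x ` T \<union> S \<times> T. f p)"
    by (rule arg_cong[where f = "finsum G f"]) auto
  also have "\<dots> = (\<Oplus>p\<in>Pair x ` T. f p) \<oplus> (\<Oplus>p\<in>S \<times> T. f p)"
    using insert assms(2) by (intro finsum_Un_disjoint) auto
  also have "(\<Oplus>p\<in>Pair x ` T. f p) = (\<Oplus>j\<in>T. f (x, j))"
    using insert by (intro finsum_reindex) (auto simp: inj_on_def)
  also have "(\<Oplus>p\<in>S \<times> T. f p) = (\<Oplus>i\<in>S. \<Oplus>j\<in>T. f (i, j))"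
    using insert by auto
  also have "(\<Oplus>j\<in>T. f (x, j)) \<oplus> (\<Oplus>i\<in>S. \<Oplus>j\<in>T. f (i, j)) = (\<Oplus>i\<in>insert x S. \<Oplus>j\<in>T. f (i, j))"
    using insert by (subst finsum_insert) (auto intro!: finsum_closed)
  finally show ?case .
qed

lemma (in abelian_monoid) finsum_single:
  assumes "finite S" "i \<in> S" "f i \<in> carrier G" "\<And>j. j \<in> S \<Longrightarrow> j \<noteq> i \<Longrightarrow> f j = \<zero>"
  shows "(\<Oplus>j\<in>S. f j) = f i"
proof -
  have "(\<Oplus>j\<in>{i}. f j) = (\<Oplus>j\<in>S. f j)"
    by (rule add.finprod_mono_neutral_cong_left) (use assms in \<open>auto simp: Pi_def\<close>, metis assms(3,4) zero_closed)
  then show ?thesis using assms(3) by simp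
qed

text \<open>The passage between the endomorphisms of an algebra and those of its matrix algebra.
  With the inclusion of an entry for \<open>u\<close> and the projection to an entry for
  \<open>v\<close> it carries spanning sets up to the matrices; with the roles exchanged it
  compresses endomorphisms of matrices, so that functionals can be pulled back.\<close>

lemma End_mod_conj_hom:
  assumes "module R M" "module R N" "u \<in> mod_hom R M N" "v \<in> mod_hom R N M"
  shows "(\<lambda>S\<in>mod_hom R M M. compose (carrier N) u (compose (carrier N) S v))
    \<in> mod_hom R (End_mod R M) (End_mod R N)"
proof -
  interpret M: module R M by fact
  interpret N: module R N by fact
  interpret EM: assoc_algebra R "End_mod R M" by (rule End_mod) fact
  note simps = mod_hom_closed[OF assms(3)] mod_hom_closed[OF assms(4)] mod_hom_add[OF assms(3)]
    mod_hom_smult[OF assms(3)] mod_hom_closed[of _ R M M]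
  have "(\<lambda>S\<in>carrier (End_mod R M). compose (carrier N) u (compose (carrier N) S v))
    \<in> mod_hom R (End_mod R M) (End_mod R N)"
  proof (rule mod_hom_restrictI[OF EM.module_axioms], goal_cases)
    case (1 S)
    then show ?case using assms by (auto intro!: mod_hom_compose)
  next
    case (2 S T)
    then show ?case unfolding End_mod_simps compose_def by (intro restrict_ext) (simp add: simps)
  next
    case (3 r S)
    then show ?case unfolding End_mod_simps compose_def by (intro restrict_ext) (simp add: simps)
  qed
  then show ?thesis by simp
qed

text \<open>As a linear map, evaluation at a point commutes with finite sums of
  endomorphisms.\<close>

lemma End_mod_eval_hom:
  assumes "module R M" "x \<in> carrier M"
  shows "(\<lambda>S\<in>mod_hom R M M. S x) \<in> mod_hom R (End_mod R M) M"
proof -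
  interpret EM: assoc_algebra R "End_mod R M" by (rule End_mod) fact
  have "(\<lambda>S\<in>carrier (End_mod R M). S x) \<in> mod_hom R (End_mod R M) M"
    by (rule mod_hom_restrictI[OF EM.module_axioms]) (auto simp: mod_hom_closed assms)
  then show ?thesis by simp
qed

section \<open>Matrix algebras\<close>

text \<open>\<open>\<iota> p q a\<close> is the matrix with the single entry \<open>a\<close> at \<open>(p, q)\<close>, and \<open>\<pi> p q\<close> takes that entry.
  These maps determine \<open>B\<close> as a matrix algebra over \<open>A\<close> up to isomorphism.\<close>

locale matrix_system =
  fixes R :: "'r ring" and J :: "'j set" and A :: "('r, 'a) module" and B :: "('r, 'c) module"
    and \<iota> :: "'j \<Rightarrow> 'j \<Rightarrow> 'a \<Rightarrow> 'c" and \<pi> :: "'j \<Rightarrow> 'j \<Rightarrow> 'c \<Rightarrow> 'a"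
  assumes A_alg: "assoc_algebra R A" and B_alg: "assoc_algebra R B"
    and J: "finite J" "J \<noteq> {}"
    and iota: "\<lbrakk>p \<in> J; q \<in> J\<rbrakk> \<Longrightarrow> \<iota> p q \<in> mod_hom R A B"
    and pi: "\<lbrakk>p \<in> J; q \<in> J\<rbrakk> \<Longrightarrow> \<pi> p q \<in> mod_hom R B A"
    and pi_iota: "\<lbrakk>p \<in> J; q \<in> J; r \<in> J; s \<in> J; a \<in> carrier A\<rbrakk>
      \<Longrightarrow> \<pi> p q (\<iota> r s a) = (if p = r \<and> q = s then a else \<zero>\<^bsub>A\<^esub>)"
    and sum_iota_pi: "X \<in> carrier B \<Longrightarrow> (\<Oplus>\<^bsub>B\<^esub>j\<in>J \<times> J. case j of (p, q) \<Rightarrow> \<iota> p q (\<pi> p q X)) = X"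
    and iota_mult: "\<lbrakk>p \<in> J; q \<in> J; r \<in> J; s \<in> J; a \<in> carrier A; b \<in> carrier A; X \<in> carrier B\<rbrakk>
      \<Longrightarrow> \<iota> p q a \<otimes>\<^bsub>B\<^esub> X \<otimes>\<^bsub>B\<^esub> \<iota> r s b = \<iota> p s (a \<otimes>\<^bsub>A\<^esub> \<pi> q r X \<otimes>\<^bsub>A\<^esub> b)"
    and pi_mult: "\<lbrakk>p \<in> J; q \<in> J; r \<in> J; s \<in> J; a \<in> carrier A; X \<in> carrier B; Y \<in> carrier B\<rbrakk>
      \<Longrightarrow> \<pi> p s (X \<otimes>\<^bsub>B\<^esub> \<iota> q r a \<otimes>\<^bsub>B\<^esub> Y) = \<pi> p q X \<otimes>\<^bsub>A\<^esub> a \<otimes>\<^bsub>A\<^esub> \<pi> r s Y"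
begin

sublocale A: assoc_algebra R A by (rule A_alg)

sublocale B: assoc_algebra R B by (rule B_alg)

lemma iota_closed [simp]: "\<lbrakk>p \<in> J; q \<in> J; a \<in> carrier A\<rbrakk> \<Longrightarrow> \<iota> p q a \<in> carrier B"
  by (rule mod_hom_closed[OF iota])

lemma pi_closed [simp]: "\<lbrakk>p \<in> J; q \<in> J; X \<in> carrier B\<rbrakk> \<Longrightarrow> \<pi> p q X \<in> carrier A"
  by (rule mod_hom_closed[OF pi])

text \<open>The basis consists of single-entry matrices whose entry is a basis element of
  \<open>A\<close>; a coordinate is a coordinate of an entry.\<close>

lemma dual_basis:
  assumes "dual_basis R A I e cf"
  shows "dual_basis R B ((J \<times> J) \<times> I) (\<lambda>((p, q), i). \<iota> p q (e i))
    (\<lambda>((p, q), i). \<lambda>X\<in>carrier B. cf i (\<pi> p q X))"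
proof -
  interpret D: dual_basis R A I e cf by fact
  show ?thesis
  proof (intro dual_basis.intro dual_basis_axioms.intro B.module_axioms, goal_cases)
    case 1
    then show ?case using J D.finite_I by simp
  next
    case (2 k)
    then show ?case by auto
  next
    case (3 k)
    then obtain p q i where k: "k = ((p, q), i)" "p \<in> J" "q \<in> J" "i \<in> I" by auto
    then have "compose (carrier B) (cf i) (\<pi> p q) \<in> mod_hom R B (self_algebra R)"
      by (intro mod_hom_compose[OF pi D.cf_hom] B.module_axioms)
    then show ?case using k by (simp add: compose_def)
  next
    case (4 k l)
    then obtain p q i r s j where "k = ((p, q), i)" "p \<in> J" "q \<in> J" "i \<in> I"
      "l = ((r, s), j)" "r \<in> J" "s \<in> J" "j \<in> I" by auto
    \<comment> \<open>Needed for basis elements supported on different entries, where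
      \<open>pi_iota\<close> gives zero.\<close>
    moreover have "cf i \<zero>\<^bsub>A\<^esub> = \<zero>\<^bsub>R\<^esub>" if "i \<in> I" for i
      using mod_hom_zero[OF A.module_axioms _ D.cf_hom[OF that]] self_algebra[OF A.R.is_cring]
      by (simp add: assoc_algebra_def)
    ultimately show ?case by (auto simp: pi_iota D.cf_e)
  next
    case (5 X)
    let ?t = "\<lambda>p q i. cf i (\<pi> p q X) \<odot>\<^bsub>B\<^esub> \<iota> p q (e i)"
    have t: "?t p q i \<in> carrier B" if "p \<in> J" "q \<in> J" "i \<in> I" for p q i
      using that 5 by simp
    have "(\<Oplus>\<^bsub>B\<^esub>k\<in>(J \<times> J) \<times> I. (case k of ((p, q), i) \<Rightarrow> ?t p q i))
        = (\<Oplus>\<^bsub>B\<^esub>j\<in>J \<times> J. \<Oplus>\<^bsub>B\<^esub>i\<in>I. (case (j, i) of ((p, q), i) \<Rightarrow> ?t p q i))"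
      using J D.finite_I 5 t by (intro B.M.finsum_Sigma) auto
    also have "\<dots> = (\<Oplus>\<^bsub>B\<^esub>j\<in>J \<times> J. case j of (p, q) \<Rightarrow> \<iota> p q (\<pi> p q X))"
    proof (rule B.M.finsum_cong')
      fix j assume "j \<in> J \<times> J"
      then obtain p q where j: "j = (p, q)" "p \<in> J" "q \<in> J" by auto
      have "\<iota> p q (\<pi> p q X) = (\<Oplus>\<^bsub>B\<^esub>i\<in>I. ?t p q i)"
        using j 5 by (intro D.hom_expand[OF B.module_axioms iota]) auto
      then show "(\<Oplus>\<^bsub>B\<^esub>i\<in>I. (case (j, i) of ((p, q), i) \<Rightarrow> ?t p q i)) = (case j of (p, q) \<Rightarrow> \<iota> p q (\<pi> p q X))"
        by (simp add: j)
    qed (use 5 in auto)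
    also have "\<dots> = X" using 5 by (rule sum_iota_pi)
    finally have *: "(\<Oplus>\<^bsub>B\<^esub>k\<in>(J \<times> J) \<times> I. (case k of ((p, q), i) \<Rightarrow> ?t p q i)) = X" .
    have "(\<Oplus>\<^bsub>B\<^esub>k\<in>(J \<times> J) \<times> I. (\<lambda>((p, q), i). \<lambda>X\<in>carrier B. cf i (\<pi> p q X)) k X
        \<odot>\<^bsub>B\<^esub> (\<lambda>((p, q), i). \<iota> p q (e i)) k)
      = (\<Oplus>\<^bsub>B\<^esub>k\<in>(J \<times> J) \<times> I. (case k of ((p, q), i) \<Rightarrow> ?t p q i))"
      using 5 t by (intro B.M.finsum_cong' refl) auto
    with * show ?case by (simp only:)
  qed
qed

text \<open>Inserting the identity, as a sum of projections to entries, on both sides of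
  \<open>T\<close> splits \<open>T\<close> into maps from one entry to another. Each of these comes
  from an endomorphism of \<open>A\<close>, which the sandwiches of \<open>A\<close> span, and by
  \<open>iota_mult\<close> a sandwich of \<open>A\<close> placed between two entries is a sandwich
  of \<open>B\<close>.\<close>

lemma spanned:
  assumes "sandwich_spanned R A"
  shows "sandwich_spanned R B"
  unfolding sandwich_spanned_def
proof (intro allI impI subsetI)
  fix N T assume N: "submodule N R (End_mod R B)"
    and sw: "\<forall>a\<in>carrier B. \<forall>b\<in>carrier B. sandwich B a b \<in> N" and T: "T \<in> mod_hom R B B"
  interpret EA: assoc_algebra R "End_mod R A" by (rule End_mod[OF A.module_axioms])
  interpret EB: assoc_algebra R "End_mod R B" by (rule End_mod[OF B.module_axioms])
  \<comment> \<open>The endomorphism reads entry \<open>(q, r)\<close> and writes entry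
    \<open>(p, s)\<close>, whereas the two factors of the corresponding sandwich sit at
    \<open>(p, q)\<close> and \<open>(r, s)\<close>; hence the order of the indices.\<close>
  let ?conj = "\<lambda>p s q r S. compose (carrier B) (\<iota> p s) (compose (carrier B) S (\<pi> q r))"
  have conj: "?conj p s q r S \<in> N"
    if pqrs: "p \<in> J" "q \<in> J" "r \<in> J" "s \<in> J" and S: "S \<in> mod_hom R A A" for p q r s S
  proof -
    let ?\<Phi> = "\<lambda>S\<in>mod_hom R A A. ?conj p s q r S"
    have "?\<Phi> (sandwich A a b) = sandwich B (\<iota> p q a) (\<iota> r s b)" if "a \<in> carrier A" "b \<in> carrier A" for a b
    proof -
      have "?conj p s q r (sandwich A a b) = sandwich B (\<iota> p q a) (\<iota> r s b)"
        unfolding compose_def sandwich_def using pqrs that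
        by (intro restrict_ext) (simp add: iota_mult)
      then show ?thesis using sandwich_hom[OF A_alg that] by simp
    qed
    then have "\<forall>a\<in>carrier A. \<forall>b\<in>carrier A. sandwich A a b \<in> {S \<in> carrier (End_mod R A). ?\<Phi> S \<in> N}"
      using sw pqrs sandwich_hom[OF A_alg] by simp
    moreover have "submodule {S \<in> carrier (End_mod R A). ?\<Phi> S \<in> N} R (End_mod R A)"
      by (rule submodule_preimage[OF EA.module_axioms EB.module_axioms
            End_mod_conj_hom[OF A.module_axioms B.module_axioms iota pi] N]) (use pqrs in auto)
    ultimately have "S \<in> {S \<in> carrier (End_mod R A). ?\<Phi> S \<in> N}"
      using assms S unfolding sandwich_spanned_def by blast
    then show ?thesis using S by simp
  qed
  \<comment> \<open>The projection of \<open>B\<close> onto the matrices supported on one entry. By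
    \<open>sum_iota_pi\<close> these projections add up to the identity.\<close>
  define P where "P = (\<lambda>(p, q). compose (carrier B) (\<iota> p q) (\<pi> p q))"
  have P: "P j \<in> carrier (End_mod R B)" if "j \<in> J \<times> J" for j
    using that by (auto simp: P_def intro!: mod_hom_compose[OF pi iota B.module_axioms])
  have JJ: "finite (J \<times> J)" using J by simp
  have "\<one>\<^bsub>End_mod R B\<^esub> = (\<Oplus>\<^bsub>End_mod R B\<^esub>j\<in>J \<times> J. P j)"
  proof (rule mod_hom_eqI)
    fix X assume X: "X \<in> carrier B"
    have sum: "(\<Oplus>\<^bsub>End_mod R B\<^esub>j\<in>J \<times> J. P j) \<in> mod_hom R B B"
      using P EB.M.finsum_closed[of P "J \<times> J"] by auto
    have "(\<Oplus>\<^bsub>End_mod R B\<^esub>j\<in>J \<times> J. P j) X = (\<lambda>S\<in>mod_hom R B B. S X) (\<Oplus>\<^bsub>End_mod R B\<^esub>j\<in>J \<times> J. P j)"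
      using sum by simp
    also have "\<dots> = (\<Oplus>\<^bsub>B\<^esub>j\<in>J \<times> J. (\<lambda>S\<in>mod_hom R B B. S X) (P j))"
      using P by (intro mod_hom_finsum[OF EB.module_axioms B.module_axioms
            End_mod_eval_hom[OF B.module_axioms X] JJ]) auto
    also have "\<dots> = (\<Oplus>\<^bsub>B\<^esub>j\<in>J \<times> J. case j of (p, q) \<Rightarrow> \<iota> p q (\<pi> p q X))"
      using P X by (intro B.M.finsum_cong' refl) (auto simp: P_def compose_def)
    also have "\<dots> = X" using X by (rule sum_iota_pi)
    finally show "\<one>\<^bsub>End_mod R B\<^esub> X = (\<Oplus>\<^bsub>End_mod R B\<^esub>j\<in>J \<times> J. P j) X" using X by simp
  qed (use P EB.M.finsum_closed[of P "J \<times> J"] EB.one_closed in auto)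
  note one = this
  have Tc: "T \<in> carrier (End_mod R B)" using T by simp
  have "T = (\<Oplus>\<^bsub>End_mod R B\<^esub>j\<in>J \<times> J. P j) \<otimes>\<^bsub>End_mod R B\<^esub> (T \<otimes>\<^bsub>End_mod R B\<^esub> (\<Oplus>\<^bsub>End_mod R B\<^esub>j\<in>J \<times> J. P j))"
    using Tc one EB.r_one[OF Tc] EB.l_one[OF Tc] by simp
  also have "T \<otimes>\<^bsub>End_mod R B\<^esub> (\<Oplus>\<^bsub>End_mod R B\<^esub>j\<in>J \<times> J. P j) = (\<Oplus>\<^bsub>End_mod R B\<^esub>k\<in>J \<times> J. T \<otimes>\<^bsub>End_mod R B\<^esub> P k)"
    using P by (intro EB.finsum_rdistr JJ Tc) auto
  also have "(\<Oplus>\<^bsub>End_mod R B\<^esub>j\<in>J \<times> J. P j) \<otimes>\<^bsub>End_mod R B\<^esub> \<dots>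
     = (\<Oplus>\<^bsub>End_mod R B\<^esub>j\<in>J \<times> J. P j \<otimes>\<^bsub>End_mod R B\<^esub> (\<Oplus>\<^bsub>End_mod R B\<^esub>k\<in>J \<times> J. T \<otimes>\<^bsub>End_mod R B\<^esub> P k))"
    using P Tc by (intro EB.finsum_ldistr JJ EB.M.finsum_closed) (auto intro!: EB.m_closed simp del: End_mod_simps)
  also have "\<dots> = (\<Oplus>\<^bsub>End_mod R B\<^esub>j\<in>J \<times> J. \<Oplus>\<^bsub>End_mod R B\<^esub>k\<in>J \<times> J. P j \<otimes>\<^bsub>End_mod R B\<^esub> (T \<otimes>\<^bsub>End_mod R B\<^esub> P k))"
    using P Tc by (intro EB.M.finsum_cong' refl EB.finsum_rdistr JJ)
      (auto intro!: EB.m_closed EB.M.finsum_closed simp del: End_mod_simps)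
  also have "\<dots> \<in> N"
  proof (intro EB.submodule_finsum[OF N JJ] funcsetI)
    fix j k assume "j \<in> J \<times> J" "k \<in> J \<times> J"
    then obtain p s q r where pq: "j = (p, s)" "k = (q, r)" "p \<in> J" "q \<in> J" "r \<in> J" "s \<in> J" by auto
    \<comment> \<open>Regrouping the composite isolates \<open>\<pi> p s\<close> after
      \<open>T\<close> after \<open>\<iota> q r\<close>, an endomorphism of
      \<open>A\<close>.\<close>
    have "P j \<otimes>\<^bsub>End_mod R B\<^esub> (T \<otimes>\<^bsub>End_mod R B\<^esub> P k)
        = ?conj p s q r (compose (carrier A) (\<pi> p s) (compose (carrier A) T (\<iota> q r)))"
      unfolding pq P_def End_mod_simps compose_def using pq mod_hom_closed[OF T]
      by (intro restrict_ext) simp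
    also have "\<dots> \<in> N"
      using pq T by (intro conj mod_hom_compose[OF _ pi] mod_hom_compose[OF iota] A.module_axioms) auto
    finally show "P j \<otimes>\<^bsub>End_mod R B\<^esub> (T \<otimes>\<^bsub>End_mod R B\<^esub> P k) \<in> N" .
  qed
  finally show "T \<in> N" .
qed

text \<open>The functional for two coordinates at the entries \<open>(p, q)\<close> and
  \<open>(r, s)\<close> is obtained by compressing an endomorphism of \<open>B\<close> to
  \<open>A\<close>, with input at \<open>(q, r)\<close> and output at \<open>(p, s)\<close>, and
  then applying the functional known for \<open>A\<close>. By \<open>pi_mult\<close> the compression
  of a sandwich is the sandwich of the two entries.\<close>

lemma natural_map_iso:
  assumes "dual_basis R A I e cf" "natural_map_iso R A"
  shows "natural_map_iso R B"
proof (rule natural_map_isoI[OF dual_basis[OF assms(1)] B_alg spanned])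
  interpret D: dual_basis R A I e cf by fact
  interpret EB: assoc_algebra R "End_mod R B" by (rule End_mod[OF B.module_axioms])
  show "sandwich_spanned R A" by (rule natural_map_iso_spanned[OF A_alg assms(2)])
  fix k l assume "k \<in> (J \<times> J) \<times> I" "l \<in> (J \<times> J) \<times> I"
  then obtain p q i r s j where kl: "k = ((p, q), i)" "p \<in> J" "q \<in> J" "i \<in> I"
      "l = ((r, s), j)" "r \<in> J" "s \<in> J" "j \<in> I" by auto
  obtain G where G: "G \<in> mod_hom R (End_mod R A) (self_algebra R)"
    and Gs: "\<And>a b. a \<in> carrier A \<Longrightarrow> b \<in> carrier A \<Longrightarrow> G (sandwich A a b) = cf i a \<otimes>\<^bsub>R\<^esub> cf j b"
    using natural_map_iso_functional[OF A_alg assms(2) D.cf_hom[OF kl(4)] D.cf_hom[OF kl(8)]] by auto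
  let ?conj = "\<lambda>S. compose (carrier A) (\<pi> p s) (compose (carrier A) S (\<iota> q r))"
  let ?\<Phi> = "\<lambda>S\<in>mod_hom R B B. ?conj S"
  have \<Phi>: "?\<Phi> \<in> mod_hom R (End_mod R B) (End_mod R A)"
    using kl by (intro End_mod_conj_hom[OF B.module_axioms A.module_axioms pi iota])
  have s: "?conj (sandwich B X Y) = sandwich A (\<pi> p q X) (\<pi> r s Y)" if "X \<in> carrier B" "Y \<in> carrier B" for X Y
    unfolding compose_def sandwich_def using kl that
    by (intro restrict_ext) (simp add: pi_mult)
  have "compose (carrier (End_mod R B)) G ?\<Phi> \<in> mod_hom R (End_mod R B) (self_algebra R)"
    by (rule mod_hom_compose[OF \<Phi> G EB.module_axioms])
  moreover have "compose (carrier (End_mod R B)) G ?\<Phi> (sandwich B X Y)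
      = cf i (\<pi> p q X) \<otimes>\<^bsub>R\<^esub> cf j (\<pi> r s Y)" if "X \<in> carrier B" "Y \<in> carrier B" for X Y
    using that kl s[OF that] sandwich_hom[OF B_alg that] Gs by (simp add: compose_def[of _ G])
  ultimately show "\<exists>G\<in>mod_hom R (End_mod R B) (self_algebra R). \<forall>a\<in>carrier B. \<forall>b\<in>carrier B.
      G (sandwich B a b) = (\<lambda>((p, q), i). \<lambda>X\<in>carrier B. cf i (\<pi> p q X)) k a
        \<otimes>\<^bsub>R\<^esub> (\<lambda>((p, q), i). \<lambda>X\<in>carrier B. cf i (\<pi> p q X)) l b"
    by (intro bexI[of _ "compose (carrier (End_mod R B)) G ?\<Phi>"]) (simp_all add: kl)
qed

text \<open>\<open>A\<close> embeds linearly into \<open>B\<close> through any diagonal entry, and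
  \<open>J\<close> is nonempty.\<close>

lemma faithful:
  assumes "faithful R A"
  shows "faithful R B"
  unfolding faithful_def
proof (intro ballI impI)
  fix r assume r: "r \<in> carrier R" and 0: "\<forall>x\<in>carrier B. r \<odot>\<^bsub>B\<^esub> x = \<zero>\<^bsub>B\<^esub>"
  obtain p where p: "p \<in> J" using J by auto
  have "r \<odot>\<^bsub>A\<^esub> a = \<zero>\<^bsub>A\<^esub>" if a: "a \<in> carrier A" for a
  proof -
    have "r \<odot>\<^bsub>A\<^esub> a = \<pi> p p (\<iota> p p (r \<odot>\<^bsub>A\<^esub> a))" using p a r by (simp add: pi_iota)
    also have "\<iota> p p (r \<odot>\<^bsub>A\<^esub> a) = r \<odot>\<^bsub>B\<^esub> \<iota> p p a" by (rule mod_hom_smult[OF iota[OF p p] r a])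
    also have "\<dots> = \<zero>\<^bsub>B\<^esub>" using 0 p a by simp
    also have "\<pi> p p \<zero>\<^bsub>B\<^esub> = \<zero>\<^bsub>A\<^esub>" by (rule mod_hom_zero[OF B.module_axioms A.module_axioms pi[OF p p]])
    finally show ?thesis .
  qed
  then show "r = \<zero>\<^bsub>R\<^esub>" using assms r by (auto simp: faithful_def)
qed

end

section \<open>Matrices over an algebra\<close>

lemma matrix_algebra_simps [simp]:
  "carrier (matrix_algebra k A) = {..<k} \<times> {..<k} \<rightarrow>\<^sub>E carrier A"
  "mult (matrix_algebra k A) = (\<lambda>X Y. \<lambda>(i, j)\<in>{..<k} \<times> {..<k}. \<Oplus>\<^bsub>A\<^esub>l\<in>{..<k}. X (i, l) \<otimes>\<^bsub>A\<^esub> Y (l, j))"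
  "one (matrix_algebra k A) = (\<lambda>(i, j)\<in>{..<k} \<times> {..<k}. if i = j then \<one>\<^bsub>A\<^esub> else \<zero>\<^bsub>A\<^esub>)"
  "zero (matrix_algebra k A) = (\<lambda>p\<in>{..<k} \<times> {..<k}. \<zero>\<^bsub>A\<^esub>)"
  "add (matrix_algebra k A) = (\<lambda>X Y. \<lambda>p\<in>{..<k} \<times> {..<k}. X p \<oplus>\<^bsub>A\<^esub> Y p)"
  "smult (matrix_algebra k A) = (\<lambda>r X. \<lambda>p\<in>{..<k} \<times> {..<k}. r \<odot>\<^bsub>A\<^esub> X p)"
  by (simp_all add: matrix_algebra_def)

lemma matrix_eqI:
  assumes "X \<in> carrier (matrix_algebra k A)" "Y \<in> carrier (matrix_algebra k A)"
    and "\<And>i j. \<lbrakk>i < k; j < k\<rbrakk> \<Longrightarrow> X (i, j) = Y (i, j)"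
  shows "X = Y"
  using assms by (auto intro!: PiE_ext[where k = "{..<k} \<times> {..<k}" and s = "\<lambda>_. carrier A"])

locale matrices = assoc_algebra R A for R :: "'r ring" and A :: "('r, 'a) module" (structure)
begin

lemma matrix_entry_closed:
  "X \<in> carrier (matrix_algebra k A) \<Longrightarrow> i < k \<Longrightarrow> j < k \<Longrightarrow> X (i, j) \<in> carrier A"
  by auto

lemma matrix_mult_closed:
  assumes "X \<in> carrier (matrix_algebra k A)" "Y \<in> carrier (matrix_algebra k A)"
  shows "X \<otimes>\<^bsub>matrix_algebra k A\<^esub> Y \<in> carrier (matrix_algebra k A)"
  using assms by (auto intro!: M.finsum_closed m_closed)

lemma matrix_mult_entry:
  "i < k \<Longrightarrow> j < k \<Longrightarrow>
    (X \<otimes>\<^bsub>matrix_algebra k A\<^esub> Y) (i, j) = (\<Oplus>l\<in>{..<k}. X (i, l) \<otimes> Y (l, j))"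
  by simp

lemma matrix_algebra: "assoc_algebra R (matrix_algebra k A)"
proof -
  let ?M = "matrix_algebra k A"
  note entry = matrix_entry_closed and eqI = matrix_eqI[where k = k and A = A]
  have add: "X \<oplus>\<^bsub>?M\<^esub> Y \<in> carrier ?M" if "X \<in> carrier ?M" "Y \<in> carrier ?M" for X Y
    using that by auto
  have smult: "r \<odot>\<^bsub>?M\<^esub> X \<in> carrier ?M" if "X \<in> carrier ?M" "r \<in> carrier R" for r X
    using that by auto
  have zero: "\<zero>\<^bsub>?M\<^esub> \<in> carrier ?M" and one: "\<one>\<^bsub>?M\<^esub> \<in> carrier ?M" by auto
  have addE: "(X \<oplus>\<^bsub>?M\<^esub> Y) (i, j) = X (i, j) \<oplus> Y (i, j)" if "i < k" "j < k" for X Y i j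
    using that by simp
  have smultE: "(r \<odot>\<^bsub>?M\<^esub> X) (i, j) = r \<odot> X (i, j)" if "i < k" "j < k" for X r i j
    using that by simp
  have zeroE: "\<zero>\<^bsub>?M\<^esub> (i, j) = \<zero>" if "i < k" "j < k" for i j using that by simp
  have oneE: "\<one>\<^bsub>?M\<^esub> (i, j) = (if i = j then \<one> else \<zero>)" if "i < k" "j < k" for i j using that by simp
  note [simp del] = matrix_algebra_simps
  note E = addE smultE zeroE oneE matrix_mult_entry entry
  have grp: "abelian_group ?M"
  proof (rule abelian_groupI)
    fix X assume X: "X \<in> carrier ?M"
    then have "(\<ominus>\<^bsub>R\<^esub> \<one>\<^bsub>R\<^esub>) \<odot>\<^bsub>?M\<^esub> X \<oplus>\<^bsub>?M\<^esub> X = \<zero>\<^bsub>?M\<^esub>"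
      by (intro eqI add smult zero) (simp_all add: E smult_l_minus M.l_neg)
    then show "\<exists>Y\<in>carrier ?M. Y \<oplus>\<^bsub>?M\<^esub> X = \<zero>\<^bsub>?M\<^esub>" using X smult by blast
  qed (auto simp: add zero intro!: eqI add zero simp: E M.a_ac)
  have mod: "module R ?M"
    by (intro moduleI is_cring grp)
      (auto intro!: eqI add smult simp: E smult_l_distr smult_r_distr smult_assoc1)
  have mon: "monoid ?M"
  proof (rule monoidI)
    fix X Y Z assume XYZ: "X \<in> carrier ?M" "Y \<in> carrier ?M" "Z \<in> carrier ?M"
    show "X \<otimes>\<^bsub>?M\<^esub> Y \<otimes>\<^bsub>?M\<^esub> Z = X \<otimes>\<^bsub>?M\<^esub> (Y \<otimes>\<^bsub>?M\<^esub> Z)"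
    proof (intro eqI matrix_mult_closed XYZ)
      fix i j assume ij: "i < k" "j < k"
      have "(X \<otimes>\<^bsub>?M\<^esub> Y \<otimes>\<^bsub>?M\<^esub> Z) (i, j) = (\<Oplus>l\<in>{..<k}. (\<Oplus>m\<in>{..<k}. X (i, m) \<otimes> Y (m, l)) \<otimes> Z (l, j))"
        using ij XYZ by (simp add: matrix_mult_entry)
          (intro M.finsum_cong' refl, auto simp: matrix_mult_entry entry intro!: M.finsum_closed)
      also have "\<dots> = (\<Oplus>l\<in>{..<k}. \<Oplus>m\<in>{..<k}. X (i, m) \<otimes> Y (m, l) \<otimes> Z (l, j))"
        using ij XYZ by (intro M.finsum_cong' refl finsum_ldistr) (auto simp: entry intro!: M.finsum_closed)
      also have "\<dots> = (\<Oplus>m\<in>{..<k}. \<Oplus>l\<in>{..<k}. X (i, m) \<otimes> Y (m, l) \<otimes> Z (l, j))"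
        using ij XYZ by (intro M.finsum_swap) (auto simp: entry)
      also have "\<dots> = (\<Oplus>m\<in>{..<k}. \<Oplus>l\<in>{..<k}. X (i, m) \<otimes> (Y (m, l) \<otimes> Z (l, j)))"
        using ij XYZ by (intro M.finsum_cong' refl) (auto simp: entry m_assoc intro!: M.finsum_closed)
      also have "\<dots> = (\<Oplus>m\<in>{..<k}. X (i, m) \<otimes> (\<Oplus>l\<in>{..<k}. Y (m, l) \<otimes> Z (l, j)))"
        using ij XYZ by (intro M.finsum_cong' refl finsum_rdistr[symmetric]) (auto simp: entry intro!: M.finsum_closed)
      also have "\<dots> = (X \<otimes>\<^bsub>?M\<^esub> (Y \<otimes>\<^bsub>?M\<^esub> Z)) (i, j)"
        using ij XYZ by (simp add: matrix_mult_entry)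
          (intro M.finsum_cong' refl, auto simp: matrix_mult_entry entry intro!: M.finsum_closed)
      finally show "(X \<otimes>\<^bsub>?M\<^esub> Y \<otimes>\<^bsub>?M\<^esub> Z) (i, j) = (X \<otimes>\<^bsub>?M\<^esub> (Y \<otimes>\<^bsub>?M\<^esub> Z)) (i, j)" .
    qed
  next
    fix X assume X: "X \<in> carrier ?M"
    show "\<one>\<^bsub>?M\<^esub> \<otimes>\<^bsub>?M\<^esub> X = X"
    proof (intro eqI matrix_mult_closed one X)
      fix i j assume ij: "i < k" "j < k"
      have "(\<Oplus>l\<in>{..<k}. \<one>\<^bsub>?M\<^esub> (i, l) \<otimes> X (l, j)) = \<one>\<^bsub>?M\<^esub> (i, i) \<otimes> X (i, j)"
        using ij X by (intro M.finsum_single) (auto simp: E)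
      then show "(\<one>\<^bsub>?M\<^esub> \<otimes>\<^bsub>?M\<^esub> X) (i, j) = X (i, j)" using ij X by (simp add: E)
    qed
    show "X \<otimes>\<^bsub>?M\<^esub> \<one>\<^bsub>?M\<^esub> = X"
    proof (intro eqI matrix_mult_closed one X)
      fix i j assume ij: "i < k" "j < k"
      have "(\<Oplus>l\<in>{..<k}. X (i, l) \<otimes> \<one>\<^bsub>?M\<^esub> (l, j)) = X (i, j) \<otimes> \<one>\<^bsub>?M\<^esub> (j, j)"
        using ij X by (intro M.finsum_single) (auto simp: E)
      then show "(X \<otimes>\<^bsub>?M\<^esub> \<one>\<^bsub>?M\<^esub>) (i, j) = X (i, j)" using ij X by (simp add: E)
    qed
  qed (auto simp: matrix_mult_closed one)
  show ?thesis
  proof (rule assoc_algebraI[OF mod mon])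
    fix X Y Z assume XYZ: "X \<in> carrier ?M" "Y \<in> carrier ?M" "Z \<in> carrier ?M"
    show "(X \<oplus>\<^bsub>?M\<^esub> Y) \<otimes>\<^bsub>?M\<^esub> Z = X \<otimes>\<^bsub>?M\<^esub> Z \<oplus>\<^bsub>?M\<^esub> Y \<otimes>\<^bsub>?M\<^esub> Z"
    proof (intro eqI add matrix_mult_closed XYZ)
      fix i j assume ij: "i < k" "j < k"
      have "(\<Oplus>l\<in>{..<k}. (X \<oplus>\<^bsub>?M\<^esub> Y) (i, l) \<otimes> Z (l, j))
          = (\<Oplus>l\<in>{..<k}. X (i, l) \<otimes> Z (l, j) \<oplus> Y (i, l) \<otimes> Z (l, j))"
        using ij XYZ by (intro M.finsum_cong' refl) (auto simp: addE entry l_distr)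
      also have "\<dots> = (\<Oplus>l\<in>{..<k}. X (i, l) \<otimes> Z (l, j)) \<oplus> (\<Oplus>l\<in>{..<k}. Y (i, l) \<otimes> Z (l, j))"
        using ij XYZ by (intro M.finsum_addf) (auto simp: entry)
      finally show "((X \<oplus>\<^bsub>?M\<^esub> Y) \<otimes>\<^bsub>?M\<^esub> Z) (i, j) = (X \<otimes>\<^bsub>?M\<^esub> Z \<oplus>\<^bsub>?M\<^esub> Y \<otimes>\<^bsub>?M\<^esub> Z) (i, j)"
        using ij by (simp add: addE matrix_mult_entry)
    qed
    show "Z \<otimes>\<^bsub>?M\<^esub> (X \<oplus>\<^bsub>?M\<^esub> Y) = Z \<otimes>\<^bsub>?M\<^esub> X \<oplus>\<^bsub>?M\<^esub> Z \<otimes>\<^bsub>?M\<^esub> Y"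
    proof (intro eqI add matrix_mult_closed XYZ)
      fix i j assume ij: "i < k" "j < k"
      have "(\<Oplus>l\<in>{..<k}. Z (i, l) \<otimes> (X \<oplus>\<^bsub>?M\<^esub> Y) (l, j))
          = (\<Oplus>l\<in>{..<k}. Z (i, l) \<otimes> X (l, j) \<oplus> Z (i, l) \<otimes> Y (l, j))"
        using ij XYZ by (intro M.finsum_cong' refl) (auto simp: addE entry r_distr)
      also have "\<dots> = (\<Oplus>l\<in>{..<k}. Z (i, l) \<otimes> X (l, j)) \<oplus> (\<Oplus>l\<in>{..<k}. Z (i, l) \<otimes> Y (l, j))"
        using ij XYZ by (intro M.finsum_addf) (auto simp: entry)
      finally show "(Z \<otimes>\<^bsub>?M\<^esub> (X \<oplus>\<^bsub>?M\<^esub> Y)) (i, j) = (Z \<otimes>\<^bsub>?M\<^esub> X \<oplus>\<^bsub>?M\<^esub> Z \<otimes>\<^bsub>?M\<^esub> Y) (i, j)"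
        using ij by (simp add: addE matrix_mult_entry)
    qed
  next
    fix r X Y assume r: "r \<in> carrier R" and XY: "X \<in> carrier ?M" "Y \<in> carrier ?M"
    show "(r \<odot>\<^bsub>?M\<^esub> X) \<otimes>\<^bsub>?M\<^esub> Y = r \<odot>\<^bsub>?M\<^esub> (X \<otimes>\<^bsub>?M\<^esub> Y)"
    proof (intro eqI smult matrix_mult_closed XY r)
      fix i j assume ij: "i < k" "j < k"
      have "(\<Oplus>l\<in>{..<k}. (r \<odot>\<^bsub>?M\<^esub> X) (i, l) \<otimes> Y (l, j)) = (\<Oplus>l\<in>{..<k}. r \<odot> (X (i, l) \<otimes> Y (l, j)))"
        using ij XY r by (intro M.finsum_cong' refl) (auto simp: smultE entry smult_mult_left)
      also have "\<dots> = r \<odot> (\<Oplus>l\<in>{..<k}. X (i, l) \<otimes> Y (l, j))"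
        using ij XY r by (intro finsum_smult_ldistr[symmetric]) (auto simp: entry)
      finally show "((r \<odot>\<^bsub>?M\<^esub> X) \<otimes>\<^bsub>?M\<^esub> Y) (i, j) = (r \<odot>\<^bsub>?M\<^esub> (X \<otimes>\<^bsub>?M\<^esub> Y)) (i, j)"
        using ij by (simp add: smultE matrix_mult_entry)
    qed
    show "X \<otimes>\<^bsub>?M\<^esub> (r \<odot>\<^bsub>?M\<^esub> Y) = r \<odot>\<^bsub>?M\<^esub> (X \<otimes>\<^bsub>?M\<^esub> Y)"
    proof (intro eqI smult matrix_mult_closed XY r)
      fix i j assume ij: "i < k" "j < k"
      have "(\<Oplus>l\<in>{..<k}. X (i, l) \<otimes> (r \<odot>\<^bsub>?M\<^esub> Y) (l, j)) = (\<Oplus>l\<in>{..<k}. r \<odot> (X (i, l) \<otimes> Y (l, j)))"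
        using ij XY r by (intro M.finsum_cong' refl) (auto simp: smultE entry smult_mult_right)
      also have "\<dots> = r \<odot> (\<Oplus>l\<in>{..<k}. X (i, l) \<otimes> Y (l, j))"
        using ij XY r by (intro finsum_smult_ldistr[symmetric]) (auto simp: entry)
      finally show "(X \<otimes>\<^bsub>?M\<^esub> (r \<odot>\<^bsub>?M\<^esub> Y)) (i, j) = (r \<odot>\<^bsub>?M\<^esub> (X \<otimes>\<^bsub>?M\<^esub> Y)) (i, j)"
        using ij by (simp add: smultE matrix_mult_entry)
    qed
  qed
qed

definition matrix_unit :: "nat \<Rightarrow> nat \<Rightarrow> nat \<Rightarrow> 'a \<Rightarrow> nat \<times> nat \<Rightarrow> 'a" where
  "matrix_unit k p q a = (\<lambda>(i, j)\<in>{..<k} \<times> {..<k}. if i = p \<and> j = q then a else \<zero>)"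

lemma matrix_unit_closed: "a \<in> carrier A \<Longrightarrow> matrix_unit k p q a \<in> carrier (matrix_algebra k A)"
  by (auto simp: matrix_unit_def)

lemma matrix_unit_entry:
  "i < k \<Longrightarrow> j < k \<Longrightarrow> matrix_unit k p q a (i, j) = (if i = p \<and> j = q then a else \<zero>)"
  by (simp add: matrix_unit_def)

lemma matrix_unit_mult_entry:
  assumes "a \<in> carrier A" "X \<in> carrier (matrix_algebra k A)" "i < k" "j < k" "p < k" "q < k"
  shows "(matrix_unit k p q a \<otimes>\<^bsub>matrix_algebra k A\<^esub> X) (i, j) = (if i = p then a \<otimes> X (q, j) else \<zero>)"
proof -
  note X = matrix_entry_closed[OF assms(2)]
  have "(\<Oplus>l\<in>{..<k}. matrix_unit k p q a (i, l) \<otimes> X (l, j)) = matrix_unit k p q a (i, q) \<otimes> X (q, j)"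
    using assms X by (intro M.finsum_single) (auto simp: matrix_unit_entry)
  then show ?thesis
    unfolding matrix_mult_entry[OF assms(3,4)] using assms X by (simp add: matrix_unit_entry)
qed

lemma mult_matrix_unit_entry:
  assumes "a \<in> carrier A" "X \<in> carrier (matrix_algebra k A)" "i < k" "j < k" "p < k" "q < k"
  shows "(X \<otimes>\<^bsub>matrix_algebra k A\<^esub> matrix_unit k p q a) (i, j) = (if j = q then X (i, p) \<otimes> a else \<zero>)"
proof -
  note X = matrix_entry_closed[OF assms(2)]
  have "(\<Oplus>l\<in>{..<k}. X (i, l) \<otimes> matrix_unit k p q a (l, j)) = X (i, p) \<otimes> matrix_unit k p q a (p, j)"
    using assms X by (intro M.finsum_single) (auto simp: matrix_unit_entry)
  then show ?thesis
    unfolding matrix_mult_entry[OF assms(3,4)] using assms X by (simp add: matrix_unit_entry)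
qed

lemma matrix_entry_hom:
  assumes "p < k" "q < k"
  shows "(\<lambda>X\<in>carrier (matrix_algebra k A). X (p, q)) \<in> mod_hom R (matrix_algebra k A) A"
proof -
  interpret MA: assoc_algebra R "matrix_algebra k A" by (rule matrix_algebra)
  show ?thesis using assms by (intro mod_hom_restrictI MA.module_axioms) auto
qed

lemma matrix_system:
  assumes "k \<ge> 1"
  shows "matrix_system R {..<k} A (matrix_algebra k A) (\<lambda>p q. \<lambda>a\<in>carrier A. matrix_unit k p q a)
    (\<lambda>p q. \<lambda>X\<in>carrier (matrix_algebra k A). X (p, q))"
proof -
  let ?M = "matrix_algebra k A"
  interpret MA: assoc_algebra R ?M by (rule matrix_algebra)
  note U = matrix_unit_closed
  have unit_hom: "(\<lambda>a\<in>carrier A. matrix_unit k p q a) \<in> mod_hom R A ?M" for p q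
    by (intro mod_hom_restrictI module_axioms U) (auto simp: matrix_unit_def intro!: restrict_ext)
  show ?thesis
  proof (rule matrix_system.intro, goal_cases)
    case 1 show ?case by (rule assoc_algebra_axioms)
  next
    case 2 show ?case by (rule matrix_algebra)
  next
    case 3 show ?case by simp
  next
    case 4 show ?case using assms by (auto simp: lessThan_empty_iff)
  next
    case (5 p q) show ?case by (rule unit_hom)
  next
    case (6 p q) then show ?case by (intro matrix_entry_hom) auto
  next
    case (7 p q r s a) then show ?case using U[of a k r s] by (auto simp: matrix_unit_entry)
  next
    case (8 X)
    let ?t = "\<lambda>p. case p of (p, q) \<Rightarrow> matrix_unit k p q (X (p, q))"
    have tc: "?t p \<in> carrier ?M" if "p \<in> {..<k} \<times> {..<k}" for p
      using that 8 by (auto simp del: matrix_algebra_simps intro: matrix_unit_closed matrix_entry_closed)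
    have "(\<Oplus>\<^bsub>?M\<^esub>p\<in>{..<k} \<times> {..<k}. ?t p) = X"
    proof (rule matrix_eqI[OF _ 8])
      show sc: "(\<Oplus>\<^bsub>?M\<^esub>p\<in>{..<k} \<times> {..<k}. ?t p) \<in> carrier ?M"
        using tc by (intro MA.M.finsum_closed) auto
      fix i j assume ij: "i < k" "j < k"
      \<comment> \<open>Taking an entry is linear, so it passes through the sum, in which only the
        term at \<open>(i, j)\<close> contributes.\<close>
      let ?ent = "\<lambda>X\<in>carrier ?M. X (i, j)"
      have "(\<Oplus>\<^bsub>?M\<^esub>p\<in>{..<k} \<times> {..<k}. ?t p) (i, j) = ?ent (\<Oplus>\<^bsub>?M\<^esub>p\<in>{..<k} \<times> {..<k}. ?t p)"
        using sc by simp
      also have "\<dots> = (\<Oplus>p\<in>{..<k} \<times> {..<k}. ?ent (?t p))"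
        using tc by (intro mod_hom_finsum[OF MA.module_axioms module_axioms matrix_entry_hom[OF ij]]) auto
      also have "\<dots> = ?ent (?t (i, j))"
        using ij tc 8 by (intro M.finsum_single)
          (auto simp: matrix_unit_entry U matrix_entry_closed simp del: matrix_algebra_simps split: if_splits)
      also have "\<dots> = X (i, j)" using ij 8 U matrix_entry_closed[OF 8 ij] by (simp add: matrix_unit_entry)
      finally show "(\<Oplus>\<^bsub>?M\<^esub>p\<in>{..<k} \<times> {..<k}. ?t p) (i, j) = X (i, j)" .
    qed
    moreover have "(\<Oplus>\<^bsub>?M\<^esub>j\<in>{..<k} \<times> {..<k}. case j of (p, q) \<Rightarrow>
        (\<lambda>a\<in>carrier A. matrix_unit k p q a) ((\<lambda>X\<in>carrier ?M. X (p, q)) X)) = (\<Oplus>\<^bsub>?M\<^esub>p\<in>{..<k} \<times> {..<k}. ?t p)"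
      using 8 tc by (intro MA.M.finsum_cong' refl) (auto simp: matrix_entry_closed simp del: matrix_algebra_simps)
    ultimately show ?case by simp
  next
    case (9 p q r s a b X)
    then have *: "a \<in> carrier A" "b \<in> carrier A" "p < k" "q < k" "r < k" "s < k" "X \<in> carrier ?M" by auto
    have "matrix_unit k p q a \<otimes>\<^bsub>?M\<^esub> X \<otimes>\<^bsub>?M\<^esub> matrix_unit k r s b = matrix_unit k p s (a \<otimes> X (q, r) \<otimes> b)"
    proof (rule matrix_eqI[where k = k and A = A])
      show "matrix_unit k p q a \<otimes>\<^bsub>?M\<^esub> X \<otimes>\<^bsub>?M\<^esub> matrix_unit k r s b \<in> carrier ?M"
        by (intro MA.m_closed U *)
      show "matrix_unit k p s (a \<otimes> X (q, r) \<otimes> b) \<in> carrier ?M"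
        by (intro U m_closed * matrix_entry_closed[OF *(7)])
      fix i j assume "i < k" "j < k"
      then show "(matrix_unit k p q a \<otimes>\<^bsub>?M\<^esub> X \<otimes>\<^bsub>?M\<^esub> matrix_unit k r s b) (i, j)
          = matrix_unit k p s (a \<otimes> X (q, r) \<otimes> b) (i, j)"
        using * MA.m_closed[OF U[OF *(1)] *(7)] matrix_entry_closed[OF *(7)]
        by (simp add: mult_matrix_unit_entry matrix_unit_mult_entry matrix_unit_entry
            del: matrix_algebra_simps)
    qed
    then show ?case using * matrix_entry_closed[OF *(7)] by (simp del: matrix_algebra_simps)
  next
    case (10 p q r s a X Y)
    then have *: "a \<in> carrier A" "p < k" "q < k" "r < k" "s < k" "X \<in> carrier ?M" "Y \<in> carrier ?M" by auto
    \<comment> \<open>This product vanishes outside column \<open>r\<close>, so a single term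
      survives when it is multiplied by \<open>Y\<close>.\<close>
    let ?XU = "X \<otimes>\<^bsub>?M\<^esub> matrix_unit k q r a"
    have XU: "?XU \<in> carrier ?M" by (intro MA.m_closed U *)
    have ent: "?XU (p, l) = (if l = r then X (p, q) \<otimes> a else \<zero>)" if "l < k" for l
      using that * by (intro mult_matrix_unit_entry)
    have "(\<Oplus>l\<in>{..<k}. ?XU (p, l) \<otimes> Y (l, s)) = ?XU (p, r) \<otimes> Y (r, s)"
      using * matrix_entry_closed[OF *(6)] matrix_entry_closed[OF *(7)]
      by (intro M.finsum_single) (auto simp: ent simp del: matrix_algebra_simps)
    then have "(?XU \<otimes>\<^bsub>?M\<^esub> Y) (p, s) = X (p, q) \<otimes> a \<otimes> Y (r, s)"
      unfolding matrix_mult_entry[OF *(2) *(5)] using * by (simp add: ent del: matrix_algebra_simps)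
    then show ?case using * MA.m_closed[OF XU *(7)] by (simp del: matrix_algebra_simps)
  qed
qed

end

section \<open>Transport of structure\<close>

text \<open>Used below for the constructors \<open>Scalar\<close> and \<open>Matrix\<close>, which
  carry the base ring and matrix algebras into the type of objects.\<close>

locale transported =
  fixes R :: "'r ring" and A :: "('r, 'a) module" and h :: "'a \<Rightarrow> 'c"
  assumes A_alg: "assoc_algebra R A" and inj: "inj_on h (carrier A)"
begin

sublocale A: assoc_algebra R A by (rule A_alg)

abbreviation "B \<equiv> transport h A"

lemma carrier_transport: "carrier B = h ` carrier A"
  by (simp add: transport_def Let_def)

lemma transport_ops:
  "\<one>\<^bsub>B\<^esub> = h \<one>\<^bsub>A\<^esub>" "\<zero>\<^bsub>B\<^esub> = h \<zero>\<^bsub>A\<^esub>"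
  "x \<in> carrier A \<Longrightarrow> y \<in> carrier A \<Longrightarrow> h x \<otimes>\<^bsub>B\<^esub> h y = h (x \<otimes>\<^bsub>A\<^esub> y)"
  "x \<in> carrier A \<Longrightarrow> y \<in> carrier A \<Longrightarrow> h x \<oplus>\<^bsub>B\<^esub> h y = h (x \<oplus>\<^bsub>A\<^esub> y)"
  "x \<in> carrier A \<Longrightarrow> r \<odot>\<^bsub>B\<^esub> h x = h (r \<odot>\<^bsub>A\<^esub> x)"
  using inj by (simp_all add: transport_def Let_def)

lemma transport_alg: "assoc_algebra R B"
proof -
  note simps = carrier_transport transport_ops
  have "abelian_group B"
  proof (rule abelian_groupI)
    show "\<exists>Y\<in>carrier B. Y \<oplus>\<^bsub>B\<^esub> X = \<zero>\<^bsub>B\<^esub>" if "X \<in> carrier B" for X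
    proof -
      obtain x where "x \<in> carrier A" "X = h x" using \<open>X \<in> _\<close> by (auto simp: simps)
      then show ?thesis by (intro bexI[of _ "h (\<ominus>\<^bsub>A\<^esub> x)"]) (auto simp: simps A.M.l_neg)
    qed
  qed (auto simp: simps A.M.a_ac)
  then have "module R B"
    by (intro moduleI A.R.is_cring) (auto simp: simps A.smult_l_distr A.smult_r_distr A.smult_assoc1)
  moreover have "monoid B"
    by (rule monoidI) (auto simp: simps A.m_assoc)
  ultimately show ?thesis
    by (rule assoc_algebraI)
      (auto simp: simps A.l_distr A.r_distr A.smult_mult_left A.smult_mult_right)
qed

sublocale B: assoc_algebra R "transport h A" by (rule transport_alg)

abbreviation "g \<equiv> \<lambda>x\<in>h ` carrier A. inv_into (carrier A) h x"

lemma h_closed [simp]: "x \<in> carrier A \<Longrightarrow> h x \<in> carrier B"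
  by (simp add: carrier_transport)

lemma g_h: "x \<in> carrier A \<Longrightarrow> g (h x) = x"
  using inj by simp

lemma h_iso: "restrict h (carrier A) \<in> mod_iso R A B"
proof -
  have "restrict h (carrier A) \<in> mod_hom R A B"
    by (rule mod_hom_restrictI[OF A.module_axioms]) (simp_all add: transport_ops)
  moreover have "bij_betw (restrict h (carrier A)) (carrier A) (carrier B)"
    using inj by (simp add: bij_betw_def carrier_transport)
  ultimately show ?thesis by (simp add: mod_iso_def)
qed

lemma g_iso: "g \<in> mod_iso R B A"
  unfolding mod_iso_def
proof safe
  show "g \<in> mod_hom R B A"
    by (rule mod_homI) (auto simp: carrier_transport transport_ops inj dest!: inj_onD[OF inj])
  show "bij_betw g (carrier B) (carrier A)"
    by (rule bij_betw_byWitness[of _ h]) (auto simp: carrier_transport inj)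
qed

text \<open>Being a matrix algebra over \<open>C\<close> is invariant under isomorphism. Bases,
  faithfulness and the natural map of the copy then follow from the results on matrix systems and
  need no transport of their own.\<close>

lemma transport_matrix_system:
  assumes "matrix_system R J C A \<iota> \<pi>"
  shows "matrix_system R J C B (\<lambda>p q. \<lambda>a\<in>carrier C. h (\<iota> p q a)) (\<lambda>p q. \<lambda>X\<in>carrier B. \<pi> p q (g X))"
proof -
  interpret S: matrix_system R J C A \<iota> \<pi> by fact
  have h: "restrict h (carrier A) \<in> mod_hom R A B" and g: "g \<in> mod_hom R B A"
    using h_iso g_iso by (auto simp: mod_iso_def)
  show ?thesis
  proof (rule matrix_system.intro, goal_cases)
    case 1 show ?case by (rule S.A_alg)
  next
    case 2 show ?case by (rule transport_alg)
  next
    case 3 show ?case by (rule S.J)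
  next
    case 4 show ?case by (rule S.J)
  next
    case (5 p q)
    have "compose (carrier C) (restrict h (carrier A)) (\<iota> p q) \<in> mod_hom R C B"
      using 5 by (intro mod_hom_compose[OF S.iota h] S.A.module_axioms)
    also have "compose (carrier C) (restrict h (carrier A)) (\<iota> p q) = (\<lambda>a\<in>carrier C. h (\<iota> p q a))"
      using 5 unfolding compose_def by (intro restrict_ext) simp
    finally show ?case .
  next
    case (6 p q)
    then have "compose (carrier B) (\<pi> p q) g \<in> mod_hom R B C"
      by (intro mod_hom_compose[OF g S.pi] B.module_axioms)
    then show ?case by (simp add: compose_def)
  next
    case (7 p q r s a)
    then show ?case using S.pi_iota by (simp add: g_h inj carrier_transport)
  next
    case (8 X)
    then obtain x where x: "x \<in> carrier A" "X = h x" by (auto simp: carrier_transport)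
    let ?s = "\<lambda>j. case j of (p, q) \<Rightarrow> \<iota> p q (\<pi> p q x)"
    have sc: "?s j \<in> carrier A" if "j \<in> J \<times> J" for j using that x by auto
    have fin: "finite (J \<times> J)" using S.J by simp
    have "X = restrict h (carrier A) (\<Oplus>\<^bsub>A\<^esub>j\<in>J \<times> J. ?s j)"
      using S.sum_iota_pi[OF x(1)] x by simp
    also have "\<dots> = (\<Oplus>\<^bsub>B\<^esub>j\<in>J \<times> J. restrict h (carrier A) (?s j))"
      using sc by (intro mod_hom_finsum[OF A.module_axioms B.module_axioms h fin]) auto
    also have "\<dots> = (\<Oplus>\<^bsub>B\<^esub>j\<in>J \<times> J. case j of (p, q) \<Rightarrow> (\<lambda>a\<in>carrier C. h (\<iota> p q a))
        ((\<lambda>X\<in>carrier B. \<pi> p q (g X)) X))"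
      using x by (intro B.M.finsum_cong' refl) (auto simp: inj carrier_transport)
    finally show ?case by simp
  next
    case (9 p q r s a b X)
    then obtain x where x: "x \<in> carrier A" "X = h x" by (auto simp: carrier_transport)
    then show ?case using 9 by (simp add: inj carrier_transport transport_ops S.iota_mult)
  next
    case (10 p q r s a X Y)
    then obtain x y where x: "x \<in> carrier A" "X = h x" "y \<in> carrier A" "Y = h y"
      by (auto simp: carrier_transport)
    then show ?case using 10 by (simp add: inj carrier_transport transport_ops S.pi_mult)
  qed
qed

end

section \<open>Bases\<close>

context dual_basis
begin

lemma cf_lincomb:
  assumes "i \<in> I" "c \<in> I \<rightarrow> carrier R"
  shows "cf i (\<Oplus>k\<in>I. c k \<odot> e k) = c i"
proof -
  interpret S: assoc_algebra R "self_algebra R" by (rule self_algebra) (rule R.is_cring)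
  have c: "c k \<in> carrier R" if "k \<in> I" for k using assms that by auto
  have "cf i (\<Oplus>k\<in>I. c k \<odot> e k) = (\<Oplus>\<^bsub>self_algebra R\<^esub>k\<in>I. cf i (c k \<odot> e k))"
    using c by (intro mod_hom_finsum[OF module_axioms S.module_axioms cf_hom[OF assms(1)] finite_I]) auto
  also have "\<dots> = cf i (c i \<odot> e i)"
    using c assms(1) by (intro S.M.finsum_single finite_I) (auto simp: cf_smult cf_e)
  also have "\<dots> = c i" using c assms(1) by (simp add: cf_smult cf_e)
  finally show ?thesis .
qed

lemma free_lift_iso: "free_lift R I M e \<in> mod_iso R (free_module R I) M"
proof -
  have e: "e \<in> I \<rightarrow> carrier M" by auto
  have eq: "free_lift R I M e f = (\<Oplus>i\<in>I. f i \<odot> e i)" if "f \<in> carrier (free_module R I)" for f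
    by (intro free_lift_eq module_axioms e that finite_I) auto
  have "bij_betw (free_lift R I M e) (carrier (free_module R I)) (carrier M)"
  \<comment> \<open>The inverse sends an element to its family of coordinates.\<close>
  proof (rule bij_betw_byWitness[of _ "\<lambda>x. \<lambda>i\<in>I. cf i x"])
    show "\<forall>f\<in>carrier (free_module R I). (\<lambda>i\<in>I. cf i (free_lift R I M e f)) = f"
    proof
      fix f assume f: "f \<in> carrier (free_module R I)"
      then have "(\<lambda>i\<in>I. cf i (free_lift R I M e f)) = (\<lambda>i\<in>I. f i)"
        unfolding eq[OF f] by (intro restrict_ext cf_lincomb) auto
      also have "\<dots> = f" using f by (auto simp: PiE_iff extensional_restrict)
      finally show "(\<lambda>i\<in>I. cf i (free_lift R I M e f)) = f" .
    qed
    have cfs: "(\<lambda>i\<in>I. cf i x) \<in> carrier (free_module R I)" if "x \<in> carrier M" for x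
      using that finite_I by auto
    show "(\<lambda>x. \<lambda>i\<in>I. cf i x) ` carrier M \<subseteq> carrier (free_module R I)"
      using cfs by blast
    show "\<forall>x\<in>carrier M. free_lift R I M e (\<lambda>i\<in>I. cf i x) = x"
    proof
      fix x assume x: "x \<in> carrier M"
      have "free_lift R I M e (\<lambda>i\<in>I. cf i x) = (\<Oplus>i\<in>I. cf i x \<odot> e i)"
        unfolding eq[OF cfs[OF x]] using x by (intro M.finsum_cong' refl) auto
      then show "free_lift R I M e (\<lambda>i\<in>I. cf i x) = x" using x by (simp add: expand)
    qed
    show "free_lift R I M e ` carrier (free_module R I) \<subseteq> carrier M"
      using mod_hom_closed[OF free_lift_hom[OF module_axioms e]] by blast
  qed
  then show ?thesis using free_lift_hom[OF module_axioms e] by (simp add: mod_iso_def)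
qed

text \<open>The images of the basis can be prescribed freely. This realises an arbitrary matrix by
  an endomorphism in \<open>End_mod_matrix_iso\<close>.\<close>

lemma extend:
  assumes "module R N" "v \<in> I \<rightarrow> carrier N"
  obtains T where "T \<in> mod_hom R M N" "\<And>i. i \<in> I \<Longrightarrow> T (e i) = v i"
proof -
  have F: "module R (free_module R I)" by (rule free_module) (rule R.is_cring)
  obtain g where g: "g \<in> mod_iso R M (free_module R I)"
    and gl: "\<And>f. f \<in> carrier (free_module R I) \<Longrightarrow> g (free_lift R I M e f) = f"
    using mod_iso_inv[OF free_lift_iso F module_axioms] by blast
  show ?thesis
  proof (rule that)
    show "compose (carrier M) (free_lift R I N v) g \<in> mod_hom R M N"
      using g by (intro mod_hom_compose[OF _ free_lift_hom] assms module_axioms) (simp add: mod_iso_def)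
    fix i assume i: "i \<in> I"
    have "e \<in> I \<rightarrow> carrier M" by auto
    then have "g (e i) = unit_vector R I i"
      using gl[OF unit_vector_closed[OF R.is_cring], of i] i
      by (simp add: free_lift_unit_vector[OF module_axioms])
    then show "compose (carrier M) (free_lift R I N v) g (e i) = v i"
      using i assms by (simp add: compose_def free_lift_unit_vector)
  qed
qed

lemma finitely_generated: "finitely_generated R M"
  unfolding finitely_generated_def
proof (intro exI conjI)
  show sub: "e ` I \<subseteq> carrier M" by auto
  show "finite (e ` I)" using finite_I by simp
  have gen: "submodule (generated_submodule R M (e ` I)) R M"
    by (rule generated_submodule_is_submodule[OF module_axioms sub])
  show "generated_submodule R M (e ` I) = carrier M"
  proof
    show "generated_submodule R M (e ` I) \<subseteq> carrier M" by (rule submoduleE(1)[OF gen])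
    show "carrier M \<subseteq> generated_submodule R M (e ` I)"
    proof
      fix x assume x: "x \<in> carrier M"
      have "(\<Oplus>i\<in>I. cf i x \<odot> e i) \<in> generated_submodule R M (e ` I)"
        using x generated_submodule_subset[of "e ` I" R M]
        by (intro submodule_finsum[OF gen finite_I] funcsetI submoduleE(4)[OF gen]) auto
      then show "x \<in> generated_submodule R M (e ` I)" using x by (simp add: expand)
    qed
  qed
qed

lemma reindex:
  assumes "bij_betw h J I"
  shows "dual_basis R M J (e \<circ> h) (cf \<circ> h)"
proof (intro dual_basis.intro dual_basis_axioms.intro module_axioms, goal_cases)
  case 1 show ?case using assms finite_I bij_betw_finite by blast
next
  case (2 j) then show ?case using assms by (auto dest: bij_betwE)
next
  case (3 j) then show ?case using assms cf_hom by (auto dest: bij_betwE)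
next
  case (4 i j)
  then have "h i = h j \<longleftrightarrow> i = j" "h i \<in> I" "h j \<in> I"
    using assms by (auto simp: bij_betw_def inj_on_def)
  then show ?case by (simp add: cf_e)
next
  case (5 x)
  have "(\<Oplus>i\<in>h ` J. cf i x \<odot> e i) = (\<Oplus>j\<in>J. cf (h j) x \<odot> e (h j))"
    using assms 5 by (intro M.finsum_reindex) (auto simp: bij_betw_def)
  then show ?case using assms 5 by (simp add: bij_betw_def expand)
qed

end

lemma free_of_rank_dual_basis:
  assumes "module R M" "free_of_rank R M n"
  obtains e cf where "dual_basis R M {..<n} e cf"
proof -
  interpret M: module R M by fact
  let ?I = "{..<n}"
  let ?F = "free_module R ?I"
  interpret F: module R ?F by (rule free_module[OF M.is_cring])
  note [simp del] = free_module_simps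
  obtain \<xi> where \<xi>: "\<xi> \<in> mod_iso R ?F M" using assms(2) by (auto simp: free_of_rank_def)
  then have hom: "\<xi> \<in> mod_hom R ?F M" by (simp add: mod_iso_def)
  obtain g where g: "g \<in> mod_iso R M ?F" "\<And>f. f \<in> carrier ?F \<Longrightarrow> g (\<xi> f) = f"
      "\<And>x. x \<in> carrier M \<Longrightarrow> \<xi> (g x) = x"
    using mod_iso_inv[OF \<xi> F.module_axioms M.module_axioms] by blast
  then have ghom: "g \<in> mod_hom R M ?F" by (simp add: mod_iso_def)
  define e where "e i = \<xi> (unit_vector R ?I i)" for i
  define cf where "cf i = (\<lambda>x\<in>carrier M. g x i)" for i
  have u: "unit_vector R ?I i \<in> carrier ?F" for i by (rule unit_vector_closed[OF M.is_cring])
  have e: "e \<in> ?I \<rightarrow> carrier M" using mod_hom_closed[OF hom u] by (auto simp: e_def)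
  have gc: "g x \<in> carrier ?F" if "x \<in> carrier M" for x using mod_hom_closed[OF ghom that] .
  have gi: "g x i \<in> carrier R" if "x \<in> carrier M" "i \<in> ?I" for x i
    using gc[OF that(1)] that(2) by (auto simp: free_module_simps)
  \<comment> \<open>The given isomorphism and the linear extension of the images of the unit vectors
    agree on unit vectors, hence everywhere. This turns bijectivity of \<open>\<xi>\<close> into the
    expansion formula.\<close>
  have "carrier ?F \<subseteq> {f \<in> carrier ?F. \<xi> f = free_lift R ?I M e f}"
    by (intro free_module_span[OF M.is_cring] submodule_equalizer[OF F.module_axioms M.module_axioms hom]
        free_lift_hom[OF M.module_axioms e])
      (auto simp: u free_lift_unit_vector[OF M.module_axioms e] e_def[symmetric])
  then have lift: "\<xi> f = free_lift R ?I M e f" if "f \<in> carrier ?F" for f using that by auto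
  have "dual_basis R M ?I e cf"
  proof (intro dual_basis.intro dual_basis_axioms.intro M.module_axioms, goal_cases)
    case 1 show ?case by simp
  next
    case (2 i) then show ?case using e by auto
  next
    case (3 i)
    then show ?case unfolding cf_def
      by (intro mod_hom_restrictI M.module_axioms)
        (auto simp: gi mod_hom_add[OF ghom] mod_hom_smult[OF ghom] free_module_simps(3,4))
  next
    case (4 i j)
    then show ?case using e g(2)[OF u] by (auto simp: cf_def e_def[symmetric] Pi_iff)
        (auto simp: e_def g(2)[OF u] unit_vector_def)
  next
    case (5 x)
    have "x = free_lift R ?I M e (g x)" using 5 lift gc g(3) by metis
    also have "\<dots> = (\<Oplus>\<^bsub>M\<^esub>i\<in>?I. g x i \<odot>\<^bsub>M\<^esub> e i)"
      by (intro free_lift_eq M.module_axioms e gc 5) auto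
    also have "\<dots> = (\<Oplus>\<^bsub>M\<^esub>i\<in>?I. cf i x \<odot>\<^bsub>M\<^esub> e i)"
      using 5 gi e by (intro M.M.finsum_cong' refl) (auto simp: cf_def)
    finally show ?case by simp
  qed
  then show ?thesis by (rule that)
qed

section \<open>Objects of the category\<close>

text \<open>The predicates \<open>free\<close> and \<open>projective\<close> ask for index sets
  inside the element type. Nested constant matrices provide infinitely many distinct elements of
  \<open>univ\<close>, even when \<open>'r\<close> and \<open>'b\<close> are finite.\<close>

primrec univ_of_nat :: "nat \<Rightarrow> ('r, 'b) univ" where
  "univ_of_nat 0 = Scalar undefined"
| "univ_of_nat (Suc n) = Matrix (\<lambda>_. univ_of_nat n)"

lemma inj_univ_of_nat: "inj univ_of_nat"
proof (rule injI)
  show "m = n" if "univ_of_nat m = (univ_of_nat n :: ('r, 'b) univ)" for m n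
    using that
  proof (induction m arbitrary: n)
    case 0
    then show ?case by (cases n) auto
  next
    case (Suc m)
    then show ?case by (cases n) (auto simp: fun_eq_iff)
  qed
qed

text \<open>A basis is reindexed by elements of the object type rather than by its own members, since it
  need not be injectively indexed when \<open>R\<close> is the zero ring.\<close>

lemma AzI:
  fixes A :: "('r, 'b) obj"
  assumes "assoc_algebra R A" "dual_basis R A I e cf" "faithful R A" "natural_map_iso R A"
  shows "A \<in> Az R"
proof -
  interpret D: dual_basis R A I e cf by fact
  have F: "module R (free_module R K)" for K by (rule free_module) (rule D.R.is_cring)
  obtain h where h: "bij_betw h {..<card I} I"
    using D.finite_I ex_bij_betw_nat_finite[of I] by (auto simp: atLeast0LessThan)
  let ?u = "univ_of_nat :: nat \<Rightarrow> ('r, 'b) univ"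
  let ?K = "?u ` {..<card I}"
  have "bij_betw (the_inv_into {..<card I} ?u) ?K {..<card I}"
    by (intro bij_betw_the_inv_into inj_on_imp_bij_betw inj_on_subset[OF inj_univ_of_nat]) simp
  then have "bij_betw (h \<circ> the_inv_into {..<card I} ?u) ?K I"
    using h by (rule bij_betw_trans)
  then interpret K: dual_basis R A ?K "e \<circ> (h \<circ> the_inv_into {..<card I} ?u)"
      "cf \<circ> (h \<circ> the_inv_into {..<card I} ?u)"
    by (rule D.reindex)
  note iso = K.free_lift_iso
  then have "free R A" by (auto simp: free_def)
  moreover have "projective R A"
    \<comment> \<open>A free module is a summand of a free module by way of the isomorphism and its
      inverse.\<close>
    using mod_iso_inv[OF iso F D.module_axioms] iso unfolding projective_def mod_iso_def by blast
  ultimately show ?thesis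
    using assms D.finitely_generated by (simp add: Az_def azumaya_def)
qed

section \<open>The base ring and matrix algebras as objects\<close>

lemma self_algebra_dual_basis:
  assumes "cring R"
  shows "dual_basis R (self_algebra R) {()} (\<lambda>_. \<one>\<^bsub>R\<^esub>) (\<lambda>_. \<lambda>x\<in>carrier R. x)"
proof -
  interpret S: assoc_algebra R "self_algebra R" by (rule self_algebra) fact
  have "(\<lambda>x\<in>carrier (self_algebra R). x) \<in> mod_hom R (self_algebra R) (self_algebra R)"
    by (rule mod_hom_restrictI[OF S.module_axioms]) auto
  then show ?thesis
    by (intro dual_basis.intro dual_basis_axioms.intro S.module_axioms) auto
qed

text \<open>A linear endomorphism of \<open>R\<close> is multiplication by its value at 1, hence a
  sandwich. Evaluation at 1 sends the sandwich of a and b to their product, which is the required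
  functional.\<close>

lemma self_algebra_natural_map_iso:
  assumes "cring R"
  shows "natural_map_iso R (self_algebra R)"
proof (rule natural_map_isoI[OF self_algebra_dual_basis self_algebra])
  interpret S: assoc_algebra R "self_algebra R" by (rule self_algebra) fact
  show "sandwich_spanned R (self_algebra R)"
    unfolding sandwich_spanned_def
  proof (intro allI impI subsetI)
    fix N T
    assume *: "\<forall>a\<in>carrier (self_algebra R). \<forall>b\<in>carrier (self_algebra R). sandwich (self_algebra R) a b \<in> N"
      and T: "T \<in> mod_hom R (self_algebra R) (self_algebra R)"
    have T1: "T \<one>\<^bsub>R\<^esub> \<in> carrier R" using mod_hom_closed[OF T] by simp
    have "T = sandwich (self_algebra R) (T \<one>\<^bsub>R\<^esub>) \<one>\<^bsub>R\<^esub>"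
    proof (rule mod_hom_eqI[OF T])
      show "sandwich (self_algebra R) (T \<one>\<^bsub>R\<^esub>) \<one>\<^bsub>R\<^esub> \<in> mod_hom R (self_algebra R) (self_algebra R)"
        using T1 by (intro sandwich_hom S.assoc_algebra_axioms) auto
      fix x assume "x \<in> carrier (self_algebra R)"
      then show "T x = sandwich (self_algebra R) (T \<one>\<^bsub>R\<^esub>) \<one>\<^bsub>R\<^esub> x"
        using mod_hom_smult[OF T, of x "\<one>\<^bsub>R\<^esub>"] T1 by (simp add: sandwich_def S.R.m_comm)
    qed
    then show "T \<in> N" using * T1 by (metis S.R.one_closed self_algebra_simps(1))
  qed
  fix k l :: unit
  have "(\<lambda>T\<in>mod_hom R (self_algebra R) (self_algebra R). T \<one>\<^bsub>R\<^esub>)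
      \<in> mod_hom R (End_mod R (self_algebra R)) (self_algebra R)"
    by (rule End_mod_eval_hom[OF S.module_axioms]) simp
  then show "\<exists>G\<in>mod_hom R (End_mod R (self_algebra R)) (self_algebra R).
      \<forall>a\<in>carrier (self_algebra R). \<forall>b\<in>carrier (self_algebra R). G (sandwich (self_algebra R) a b)
        = (\<lambda>x\<in>carrier R. x) a \<otimes>\<^bsub>R\<^esub> (\<lambda>x\<in>carrier R. x) b"
    by (rule bexI[rotated]) (use sandwich_hom[OF S.assoc_algebra_axioms] in \<open>simp add: sandwich_def\<close>)
qed (use assms in auto)

lemma self_algebra_faithful: "cring R \<Longrightarrow> faithful R (self_algebra R)"
  unfolding faithful_def by (metis cring.axioms(1) monoid.one_closed monoid.r_one ring.axioms(2)
      self_algebra_simps(1,4,6))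

text \<open>The \<open>1 \<times> 1\<close> matrices; with \<open>transport_matrix_system\<close> they make all results on matrix
  systems available for copies.\<close>

lemma trivial_matrix_system:
  assumes "assoc_algebra R A"
  shows "matrix_system R {()} A A (\<lambda>_ _. \<lambda>a\<in>carrier A. a) (\<lambda>_ _. \<lambda>a\<in>carrier A. a)"
proof -
  interpret A: assoc_algebra R A by fact
  have id: "(\<lambda>a\<in>carrier A. a) \<in> mod_hom R A A"
    by (rule mod_hom_restrictI[OF A.module_axioms]) auto
  show ?thesis
    by (intro matrix_system.intro assms id) auto
qed

lemma transported_base: "cring R \<Longrightarrow> transported R (self_algebra R) Scalar"
  by (intro transported.intro self_algebra) (simp_all add: inj_on_def)

lemma base_obj_system:
  assumes "cring R"
  shows "\<exists>\<iota> \<pi>. matrix_system R {()} (self_algebra R) (base_obj R) \<iota> \<pi>"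
proof -
  interpret transported R "self_algebra R" Scalar by (rule transported_base) fact
  show ?thesis unfolding base_obj_def
    using transport_matrix_system[OF trivial_matrix_system[OF self_algebra[OF assms]]] by blast
qed

text \<open>The index set is the one that \<open>matrix_system.dual_basis\<close> builds for
  one-by-one matrices over an algebra with a one-element basis. The basis is kept explicit because
  the matrix algebra over \<open>base_obj R\<close> takes its own basis from it.\<close>

lemma base_obj_Az:
  assumes "cring R"
  obtains e cf where "assoc_algebra R (base_obj R :: ('r, 'b) obj)" "faithful R (base_obj R :: ('r, 'b) obj)"
    "natural_map_iso R (base_obj R :: ('r, 'b) obj)"
    "dual_basis R (base_obj R :: ('r, 'b) obj) ((UNIV \<times> UNIV) \<times> UNIV :: ((unit \<times> unit) \<times> unit) set) e cf"
proof -
  obtain \<iota> \<pi> where "matrix_system R {()} (self_algebra R) (base_obj R :: ('r, 'b) obj) \<iota> \<pi>"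
    using base_obj_system[OF assms] by blast
  then interpret S: matrix_system R "{()}" "self_algebra R" "base_obj R :: ('r, 'b) obj" \<iota> \<pi> .
  note D = self_algebra_dual_basis[OF assms]
  show ?thesis
    using that S.B_alg S.faithful[OF self_algebra_faithful[OF assms]]
      S.natural_map_iso[OF D self_algebra_natural_map_iso[OF assms]] S.dual_basis[OF D]
    by (simp add: UNIV_unit)
qed

lemma transported_mat: 
  assumes "assoc_algebra R A"
  shows "transported R (matrix_algebra k A) Matrix"
proof -
  interpret A: matrices R A using assms by (simp add: matrices_def)
  show ?thesis by (intro transported.intro A.matrix_algebra) (simp add: inj_on_def)
qed

lemma mat_obj_Az:
  assumes "assoc_algebra R A" "dual_basis R A I e cf" "faithful R A" "natural_map_iso R A" "k \<ge> 1"
  shows "mat_obj k A \<in> Az R"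
proof -
  interpret A: matrices R A using assms(1) by (simp add: matrices_def)
  interpret T: transported R "matrix_algebra k A" Matrix by (rule transported_mat) fact
  obtain \<iota> \<pi> where "matrix_system R {..<k} A (mat_obj k A) \<iota> \<pi>"
    using T.transport_matrix_system[OF A.matrix_system[OF assms(5)]] unfolding mat_obj_def by blast
  then interpret S: matrix_system R "{..<k}" A "mat_obj k A" \<iota> \<pi> .
  show ?thesis
    by (rule AzI[OF S.B_alg S.dual_basis[OF assms(2)] S.faithful[OF assms(3)]
          S.natural_map_iso[OF assms(2,4)]])
qed

section \<open>Splitting the diagonal embedding\<close>

lemma alg_homI:
  assumes "f \<in> mod_hom R A B" "f \<one>\<^bsub>A\<^esub> = \<one>\<^bsub>B\<^esub>"
    and "\<And>x y. \<lbrakk>x \<in> carrier A; y \<in> carrier A\<rbrakk> \<Longrightarrow> f (x \<otimes>\<^bsub>A\<^esub> y) = f x \<otimes>\<^bsub>B\<^esub> f y"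
  shows "f \<in> alg_hom R A B"
  using assms by (auto simp: alg_hom_def mod_hom_def ring_hom_def)

lemma alg_homD:
  assumes "f \<in> alg_hom R A B"
  shows "f \<in> mod_hom R A B" "f \<one>\<^bsub>A\<^esub> = \<one>\<^bsub>B\<^esub>"
    "\<And>x y. \<lbrakk>x \<in> carrier A; y \<in> carrier A\<rbrakk> \<Longrightarrow> f (x \<otimes>\<^bsub>A\<^esub> y) = f x \<otimes>\<^bsub>B\<^esub> f y"
  using assms by (auto simp: alg_hom_def ring_hom_def)

lemma alg_hom_compose:
  assumes "assoc_algebra R A" "f \<in> alg_hom R A B" "g \<in> alg_hom R B C"
  shows "compose (carrier A) g f \<in> alg_hom R A C"
proof -
  interpret A: assoc_algebra R A by fact
  note f = alg_homD[OF assms(2)] and g = alg_homD[OF assms(3)]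
  show ?thesis
    using mod_hom_closed[OF f(1)]
    by (intro alg_homI mod_hom_compose[OF f(1) g(1)] A.module_axioms) (auto simp: compose_def f(2,3) g(2,3))
qed

lemma alg_iso_inv:
  assumes "assoc_algebra R A" "assoc_algebra R B" "f \<in> alg_hom R A B" "bij_betw f (carrier A) (carrier B)"
  obtains g where "g \<in> alg_hom R B A" "\<And>x. x \<in> carrier A \<Longrightarrow> g (f x) = x"
proof -
  interpret A: assoc_algebra R A by fact
  interpret B: assoc_algebra R B by fact
  note f = alg_homD[OF assms(3)]
  have "f \<in> mod_iso R A B" using f(1) assms(4) by (simp add: mod_iso_def)
  then obtain g where g: "g \<in> mod_iso R B A" and gf: "\<And>x. x \<in> carrier A \<Longrightarrow> g (f x) = x"
    and fg: "\<And>y. y \<in> carrier B \<Longrightarrow> f (g y) = y"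
    using mod_iso_inv[OF _ A.module_axioms B.module_axioms] by blast
  then have hom: "g \<in> mod_hom R B A" by (simp add: mod_iso_def)
  have "g \<in> alg_hom R B A"
  proof (rule alg_homI[OF hom])
    show "g \<one>\<^bsub>B\<^esub> = \<one>\<^bsub>A\<^esub>" using gf[of "\<one>\<^bsub>A\<^esub>"] f(2) by simp
    fix x y assume xy: "x \<in> carrier B" "y \<in> carrier B"
    then have "x \<otimes>\<^bsub>B\<^esub> y = f (g x \<otimes>\<^bsub>A\<^esub> g y)" by (simp add: f(3) fg mod_hom_closed[OF hom])
    then show "g (x \<otimes>\<^bsub>B\<^esub> y) = g x \<otimes>\<^bsub>A\<^esub> g y" using xy gf mod_hom_closed[OF hom] by simp
  qed
  then show ?thesis using gf by (rule that)
qed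

lemma (in transported) h_alg_hom: "restrict h (carrier A) \<in> alg_hom R A B"
  using h_iso by (intro alg_homI) (auto simp: mod_iso_def transport_ops)

text \<open>Both sides of the equation are linear in each variable. With the second factor a
  generator, an equalizer argument extends the equation to all \<open>x\<close>; then, with
  \<open>x\<close> arbitrary, a second one extends it to all \<open>y\<close>.\<close>

lemma mult_on_generators:
  assumes "assoc_algebra R A" "assoc_algebra R B" and f: "f \<in> mod_hom R A B"
    and S: "S \<subseteq> carrier A" and gen: "\<And>N. submodule N R A \<Longrightarrow> S \<subseteq> N \<Longrightarrow> carrier A \<subseteq> N"
    and mult: "\<And>x y. \<lbrakk>x \<in> S; y \<in> S\<rbrakk> \<Longrightarrow> f (x \<otimes>\<^bsub>A\<^esub> y) = f x \<otimes>\<^bsub>B\<^esub> f y"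
    and "x \<in> carrier A" "y \<in> carrier A"
  shows "f (x \<otimes>\<^bsub>A\<^esub> y) = f x \<otimes>\<^bsub>B\<^esub> f y"
proof -
  interpret A: assoc_algebra R A by fact
  interpret B: assoc_algebra R B by fact
  note fc = mod_hom_closed[OF f] and fa = mod_hom_add[OF f] and fs = mod_hom_smult[OF f]
  have right: "f (x \<otimes>\<^bsub>A\<^esub> y) = f x \<otimes>\<^bsub>B\<^esub> f y" if x: "x \<in> carrier A" and y: "y \<in> S" for x y
  proof -
    have y': "y \<in> carrier A" using y S by auto
    have 1: "(\<lambda>x\<in>carrier A. f (x \<otimes>\<^bsub>A\<^esub> y)) \<in> mod_hom R A B"
      using y' by (intro mod_hom_restrictI A.module_axioms) (auto simp: fc fa fs A.l_distr A.smult_mult_left)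
    have 2: "(\<lambda>x\<in>carrier A. f x \<otimes>\<^bsub>B\<^esub> f y) \<in> mod_hom R A B"
      using y' by (intro mod_hom_restrictI A.module_axioms) (auto simp: fc fa fs B.l_distr B.smult_mult_left)
    have "carrier A \<subseteq> {x \<in> carrier A. (\<lambda>x\<in>carrier A. f (x \<otimes>\<^bsub>A\<^esub> y)) x = (\<lambda>x\<in>carrier A. f x \<otimes>\<^bsub>B\<^esub> f y) x}"
      using S y mult by (intro gen submodule_equalizer[OF A.module_axioms B.module_axioms 1 2]) auto
    then show ?thesis using x by auto
  qed
  have 1: "(\<lambda>y\<in>carrier A. f (x \<otimes>\<^bsub>A\<^esub> y)) \<in> mod_hom R A B"
    using \<open>x \<in> carrier A\<close>
    by (intro mod_hom_restrictI A.module_axioms) (auto simp: fc fa fs A.r_distr A.smult_mult_right)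
  have 2: "(\<lambda>y\<in>carrier A. f x \<otimes>\<^bsub>B\<^esub> f y) \<in> mod_hom R A B"
    using \<open>x \<in> carrier A\<close>
    by (intro mod_hom_restrictI A.module_axioms) (auto simp: fc fa fs B.r_distr B.smult_mult_right)
  have "carrier A \<subseteq> {y \<in> carrier A. (\<lambda>y\<in>carrier A. f (x \<otimes>\<^bsub>A\<^esub> y)) y = (\<lambda>y\<in>carrier A. f x \<otimes>\<^bsub>B\<^esub> f y) y}"
    using S \<open>x \<in> carrier A\<close> right
    by (intro gen submodule_equalizer[OF A.module_axioms B.module_axioms 1 2]) auto
  then show ?thesis using \<open>y \<in> carrier A\<close> by auto
qed

text \<open>The left regular representation. Writing it through sandwiches exhibits it as the map
  sending a to the tensor of a and 1, so that maps known on sandwiches can be evaluated on its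
  image.\<close>

lemma left_mult_alg_hom:
  assumes "assoc_algebra R A"
  shows "(\<lambda>a\<in>carrier A. sandwich A a \<one>\<^bsub>A\<^esub>) \<in> alg_hom R A (End_mod R A)"
proof (rule alg_homI)
  interpret A: assoc_algebra R A by fact
  note b = sandwich_bilinear[OF assms]
  show "(\<lambda>a\<in>carrier A. sandwich A a \<one>\<^bsub>A\<^esub>) \<in> mod_hom R A (End_mod R A)"
    using b by (simp add: bilinear_map_def)
  show "(\<lambda>a\<in>carrier A. sandwich A a \<one>\<^bsub>A\<^esub>) \<one>\<^bsub>A\<^esub> = \<one>\<^bsub>End_mod R A\<^esub>"
    by (simp add: sandwich_def restrict_def fun_eq_iff)
  fix x y assume "x \<in> carrier A" "y \<in> carrier A"
  then show "(\<lambda>a\<in>carrier A. sandwich A a \<one>\<^bsub>A\<^esub>) (x \<otimes>\<^bsub>A\<^esub> y)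
      = (\<lambda>a\<in>carrier A. sandwich A a \<one>\<^bsub>A\<^esub>) x \<otimes>\<^bsub>End_mod R A\<^esub> (\<lambda>a\<in>carrier A. sandwich A a \<one>\<^bsub>A\<^esub>) y"
    by (simp add: sandwich_compose[OF assms])
qed

text \<open>Column j of the matrix of \<open>T\<close> holds the coordinates of the image of the
  basis element j; with this convention composition becomes the matrix product. The entries are
  wrapped by \<open>Scalar\<close> and the matrix by \<open>Matrix\<close> to land in the object
  type.\<close>

lemma End_mod_matrix_iso:
  fixes A :: "('r, 'a) module"
  assumes "dual_basis R A {..<n} e cf"
  obtains m where "m \<in> alg_hom R (End_mod R A) (mat_obj n (base_obj R :: ('r, 'b) obj))"
    and "bij_betw m (mod_hom R A A) (carrier (mat_obj n (base_obj R :: ('r, 'b) obj)))"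
proof -
  let ?B = "base_obj R :: ('r, 'b) obj" and ?E = "End_mod R A"
  interpret D: dual_basis R A "{..<n}" e cf by fact
  interpret E: assoc_algebra R ?E by (rule End_mod[OF D.module_axioms])
  interpret Sc: transported R "self_algebra R" "Scalar :: 'r \<Rightarrow> ('r, 'b) univ"
    by (rule transported_base) (rule D.R.is_cring)
  interpret B: matrices R ?B unfolding base_obj_def by (rule matrices.intro[OF Sc.transport_alg])
  interpret Mt: transported R "matrix_algebra n ?B" Matrix by (rule transported_mat[OF B.assoc_algebra_axioms])
  let ?M = "matrix_algebra n ?B"
  note ops = Sc.transport_ops[folded base_obj_def, simplified]
  have Bc: "carrier ?B = Scalar ` carrier R" using Sc.carrier_transport by (simp add: base_obj_def)
  have Schom: "restrict Scalar (carrier R) \<in> mod_hom R (self_algebra R) ?B"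
    using Sc.h_iso by (simp add: mod_iso_def base_obj_def)
  define m where "m = (\<lambda>T\<in>mod_hom R A A. \<lambda>(i, j)\<in>{..<n} \<times> {..<n}. (Scalar (cf i (T (e j))) :: ('r, 'b) univ))"
  have ent: "m T (i, j) = Scalar (cf i (T (e j)))" if "T \<in> mod_hom R A A" "i < n" "j < n" for T i j
    using that by (simp add: m_def)
  have cfc: "cf i (T (e j)) \<in> carrier R" if "T \<in> mod_hom R A A" "i < n" "j < n" for T i j
    using that mod_hom_closed[OF that(1)] by simp
  have mc: "m T \<in> carrier ?M" if "T \<in> mod_hom R A A" for T
    using that cfc[OF that] by (auto simp: m_def Bc)
  have mE: "m T \<oplus>\<^bsub>?M\<^esub> m S \<in> carrier ?M" "r \<odot>\<^bsub>?M\<^esub> m T \<in> carrier ?M" "m T \<otimes>\<^bsub>?M\<^esub> m S \<in> carrier ?M"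
    if "T \<in> mod_hom R A A" "S \<in> mod_hom R A A" "r \<in> carrier R" for T S r
    using that mc Mt.A.M.add.m_closed Mt.A.smult_closed Mt.A.m_closed by auto
  have hom: "m \<in> mod_hom R ?E ?M"
  proof (rule mod_homI)
    fix T S assume TS: "T \<in> carrier ?E" "S \<in> carrier ?E"
    show "m (T \<oplus>\<^bsub>?E\<^esub> S) = m T \<oplus>\<^bsub>?M\<^esub> m S"
    proof (rule matrix_eqI[OF mc])
      show "T \<oplus>\<^bsub>?E\<^esub> S \<in> mod_hom R A A" using E.M.add.m_closed[OF TS] by simp
      then show "m (T \<oplus>\<^bsub>?E\<^esub> S) (i, j) = (m T \<oplus>\<^bsub>?M\<^esub> m S) (i, j)" if "i < n" "j < n" for i j
        using that TS ent cfc mod_hom_closed[of _ R A A]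
        by (subst ent) (auto simp: D.cf_add ops)
      show "m T \<oplus>\<^bsub>?M\<^esub> m S \<in> carrier ?M" using TS by (intro mE(1)) auto
    qed
  next
    fix r T assume r: "r \<in> carrier R" and T: "T \<in> carrier ?E"
    show "m (r \<odot>\<^bsub>?E\<^esub> T) = r \<odot>\<^bsub>?M\<^esub> m T"
    proof (rule matrix_eqI[OF mc])
      show "r \<odot>\<^bsub>?E\<^esub> T \<in> mod_hom R A A" using E.smult_closed[OF r T] by simp
      then show "m (r \<odot>\<^bsub>?E\<^esub> T) (i, j) = (r \<odot>\<^bsub>?M\<^esub> m T) (i, j)" if "i < n" "j < n" for i j
        using that T r ent cfc mod_hom_closed[of _ R A A]
        by (subst ent) (auto simp: D.cf_smult ops)
      show "r \<odot>\<^bsub>?M\<^esub> m T \<in> carrier ?M" using T r by (intro mE(2)) auto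
    qed
  qed (auto simp: mc simp del: matrix_algebra_simps, auto simp: m_def)
  have alg: "m \<in> alg_hom R ?E ?M"
  proof (rule alg_homI[OF hom])
    show "m \<one>\<^bsub>?E\<^esub> = \<one>\<^bsub>?M\<^esub>"
    proof (rule matrix_eqI)
      show "m \<one>\<^bsub>?E\<^esub> \<in> carrier ?M" using mod_hom_closed[OF hom E.one_closed] .
      show "\<one>\<^bsub>?M\<^esub> \<in> carrier ?M" by (rule Mt.A.one_closed)
      show "m \<one>\<^bsub>?E\<^esub> (i, j) = \<one>\<^bsub>?M\<^esub> (i, j)" if "i < n" "j < n" for i j
        using that E.one_closed by (subst ent) (auto simp: D.cf_e ops)
    qed
    fix T S assume "T \<in> carrier ?E" "S \<in> carrier ?E"
    then have TS: "T \<in> mod_hom R A A" "S \<in> mod_hom R A A" by auto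
    show "m (T \<otimes>\<^bsub>?E\<^esub> S) = m T \<otimes>\<^bsub>?M\<^esub> m S"
    proof (rule matrix_eqI[OF mc])
      show c: "T \<otimes>\<^bsub>?E\<^esub> S \<in> mod_hom R A A" using E.m_closed TS by simp
      show "m T \<otimes>\<^bsub>?M\<^esub> m S \<in> carrier ?M" using TS by (intro mE(3)) auto
      fix i j assume ij: "i < n" "j < n"
      have Sj: "S (e j) \<in> carrier A" using ij mod_hom_closed[OF TS(2)] by simp
      \<comment> \<open>Applying this functional to \<open>S (e j)\<close>, expanded in the basis,
        gives the row by column sum; commutativity of \<open>R\<close> then puts the factors in
        matrix order.\<close>
      have cT: "compose (carrier A) (cf i) T \<in> mod_hom R A (self_algebra R)"
        using ij by (intro mod_hom_compose[OF TS(1) D.cf_hom] D.module_axioms) simp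
      have "cf i (T (S (e j))) = compose (carrier A) (cf i) T (S (e j))"
        using Sj by (simp add: compose_def)
      also have "\<dots> = (\<Oplus>\<^bsub>self_algebra R\<^esub>l\<in>{..<n}. cf l (S (e j)) \<odot>\<^bsub>self_algebra R\<^esub> compose (carrier A) (cf i) T (e l))"
        by (rule D.hom_expand[OF Sc.A.module_axioms cT Sj])
      also have "\<dots> = (\<Oplus>\<^bsub>self_algebra R\<^esub>l\<in>{..<n}. cf i (T (e l)) \<otimes>\<^bsub>R\<^esub> cf l (S (e j)))"
        using ij TS cfc by (intro Sc.A.M.finsum_cong' refl) (auto simp: compose_def D.R.m_comm)
      finally have eq: "cf i (T (S (e j))) = (\<Oplus>\<^bsub>self_algebra R\<^esub>l\<in>{..<n}. cf i (T (e l)) \<otimes>\<^bsub>R\<^esub> cf l (S (e j)))" .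
      have "Scalar (cf i (T (S (e j))))
          = restrict Scalar (carrier R) (\<Oplus>\<^bsub>self_algebra R\<^esub>l\<in>{..<n}. cf i (T (e l)) \<otimes>\<^bsub>R\<^esub> cf l (S (e j)))"
        unfolding eq[symmetric] using ij Sj mod_hom_closed[OF TS(1) Sj] by simp
      also have "\<dots> = (\<Oplus>\<^bsub>?B\<^esub>l\<in>{..<n}. restrict Scalar (carrier R) (cf i (T (e l)) \<otimes>\<^bsub>R\<^esub> cf l (S (e j))))"
        using ij cfc TS by (intro mod_hom_finsum[OF Sc.A.module_axioms B.module_axioms Schom]) auto
      also have "\<dots> = (\<Oplus>\<^bsub>?B\<^esub>l\<in>{..<n}. m T (i, l) \<otimes>\<^bsub>?B\<^esub> m S (l, j))"
        using ij cfc TS by (intro B.M.finsum_cong' refl) (auto simp: ent ops Bc)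
      also have "\<dots> = (m T \<otimes>\<^bsub>?M\<^esub> m S) (i, j)" using ij by simp
      finally show "m (T \<otimes>\<^bsub>?E\<^esub> S) (i, j) = (m T \<otimes>\<^bsub>?M\<^esub> m S) (i, j)"
        using ij c by (subst ent) (auto simp: compose_def)
    qed
  qed
  have inj: "inj_on m (mod_hom R A A)"
  proof (rule inj_onI)
    fix T S assume TS: "T \<in> mod_hom R A A" "S \<in> mod_hom R A A" and eq: "m T = m S"
    have Te: "T (e j) = S (e j)" if "j < n" for j
    proof -
      have "cf i (T (e j)) = cf i (S (e j))" if "i < n" for i
        using fun_cong[OF eq, of "(i, j)"] ent TS \<open>j < n\<close> that by simp
      then have "(\<Oplus>\<^bsub>A\<^esub>i\<in>{..<n}. cf i (T (e j)) \<odot>\<^bsub>A\<^esub> e i) = (\<Oplus>\<^bsub>A\<^esub>i\<in>{..<n}. cf i (S (e j)) \<odot>\<^bsub>A\<^esub> e i)"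
        using that TS cfc by (intro D.M.finsum_cong' refl) auto
      then show ?thesis
        using that D.expand[of "T (e j)"] D.expand[of "S (e j)"] mod_hom_closed[OF TS(1)] mod_hom_closed[OF TS(2)] by simp
    qed
    show "T = S"
    proof (rule mod_hom_eqI[OF TS])
      fix x assume x: "x \<in> carrier A"
      show "T x = S x"
        unfolding D.hom_expand[OF D.module_axioms TS(1) x] D.hom_expand[OF D.module_axioms TS(2) x]
        using Te x mod_hom_closed[OF TS(2)] by (intro D.M.finsum_cong' refl) auto
    qed
  qed
  have "carrier ?M \<subseteq> m ` mod_hom R A A"
  proof
    fix X assume X: "X \<in> carrier ?M"
    have "\<forall>p\<in>{..<n} \<times> {..<n}. \<exists>r\<in>carrier R. X p = Scalar r" using X by (auto simp: Bc PiE_iff)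
    then obtain c where c: "\<And>p. p \<in> {..<n} \<times> {..<n} \<Longrightarrow> c p \<in> carrier R \<and> X p = Scalar (c p)"
      by metis
    have vc: "(\<lambda>j. \<Oplus>\<^bsub>A\<^esub>i\<in>{..<n}. c (i, j) \<odot>\<^bsub>A\<^esub> e i) \<in> {..<n} \<rightarrow> carrier A"
      using c by (auto intro!: D.M.finsum_closed)
    \<comment> \<open>The image of each basis element is read off the corresponding column of
      \<open>X\<close>.\<close>
    obtain T where T: "T \<in> mod_hom R A A"
      and Te: "\<And>j. j \<in> {..<n} \<Longrightarrow> T (e j) = (\<Oplus>\<^bsub>A\<^esub>i\<in>{..<n}. c (i, j) \<odot>\<^bsub>A\<^esub> e i)"
      using D.extend[OF D.module_axioms vc] by metis
    have "m T = X"
    proof (rule matrix_eqI[OF mc[OF T] X])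
      fix i j assume ij: "i < n" "j < n"
      then have "cf i (T (e j)) = c (i, j)" using c by (simp add: Te D.cf_lincomb)
      then show "m T (i, j) = X (i, j)" using ij c T by (simp add: ent)
    qed
    then show "X \<in> m ` mod_hom R A A" using T by blast
  qed
  then have bij: "bij_betw m (mod_hom R A A) (carrier ?M)" using inj mc by (auto simp: bij_betw_def)
  show ?thesis
  proof (rule that)
    show "compose (carrier ?E) (restrict Matrix (carrier ?M)) m \<in> alg_hom R ?E (mat_obj n ?B)"
      unfolding mat_obj_def by (rule alg_hom_compose[OF E.assoc_algebra_axioms alg Mt.h_alg_hom])
    have "bij_betw (restrict Matrix (carrier ?M)) (carrier ?M) (carrier (mat_obj n ?B))"
      using Mt.h_iso by (simp add: mod_iso_def mat_obj_def)
    from bij_betw_trans[OF bij this]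
    show "bij_betw (compose (carrier ?E) (restrict Matrix (carrier ?M)) m) (mod_hom R A A) (carrier (mat_obj n ?B))"
      by (rule bij_betw_cong[THEN iffD1, rotated]) (simp add: compose_def)
  qed
qed

text \<open>\<open>\<psi>\<close> is \<open>A \<otimes> A\<^sup>o\<^sup>p \<rightarrow> A \<otimes> End(A)\<close>, \<open>a \<otimes> b \<mapsto> a \<otimes> (x \<mapsto> x b)\<close>, with \<open>End(A)\<close> written as
  matrices and \<open>A \<otimes> A\<^sup>o\<^sup>p\<close> identified with \<open>End(A)\<close>.\<close>

lemma End_mod_to_matrices:
  fixes A :: "('r, 'a) module"
  assumes A: "assoc_algebra R A" and iso: "natural_map_iso R A" and "dual_basis R A {..<n} e cf"
  obtains \<psi> where "\<psi> \<in> alg_hom R (End_mod R A) (matrix_algebra n A)"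
    and "\<And>a. a \<in> carrier A \<Longrightarrow> \<psi> (sandwich A a \<one>\<^bsub>A\<^esub>) = scalar_matrix n A a"
proof -
  let ?E = "End_mod R A" and ?M = "matrix_algebra n A"
  interpret A: matrices R A by (rule matrices.intro[OF A])
  interpret D: dual_basis R A "{..<n}" e cf by fact
  interpret E: assoc_algebra R ?E by (rule End_mod[OF A.module_axioms])
  interpret M: assoc_algebra R ?M by (rule A.matrix_algebra)
  \<comment> \<open>The matrix of right multiplication by \<open>b\<close> in the basis
    \<open>e\<close>, with every entry multiplied into \<open>a\<close>.\<close>
  define \<beta> where "\<beta> a b = (\<lambda>(i, j)\<in>{..<n} \<times> {..<n}. cf i (e j \<otimes>\<^bsub>A\<^esub> b) \<odot>\<^bsub>A\<^esub> a)" for a b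
  have \<beta>c: "\<beta> a b \<in> carrier ?M" if "a \<in> carrier A" "b \<in> carrier A" for a b
    using that by (auto simp: \<beta>_def)
  have \<beta>E: "\<beta> a b (i, j) = cf i (e j \<otimes>\<^bsub>A\<^esub> b) \<odot>\<^bsub>A\<^esub> a" if "i < n" "j < n" for a b i j
    using that by (simp add: \<beta>_def)
  have "bilinear_map R A A ?M \<beta>"
  proof (rule bilinear_mapI[OF A.module_axioms A.module_axioms \<beta>c], goal_cases)
    case (3 x x' y)
    then show ?case unfolding matrix_algebra_simps \<beta>_def
      by (intro restrict_ext) (auto simp: A.smult_r_distr)
  next
    case (4 x y y')
    then show ?case unfolding matrix_algebra_simps \<beta>_def
      by (intro restrict_ext) (auto simp: A.smult_l_distr D.cf_add A.r_distr)
  next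
    case (5 r x y)
    then show ?case unfolding matrix_algebra_simps \<beta>_def
      by (intro restrict_ext) (auto simp: A.R.m_comm simp flip: A.smult_assoc1)
  next
    case (6 r x y)
    then show ?case unfolding matrix_algebra_simps \<beta>_def
      by (intro restrict_ext) (auto simp: A.smult_mult_right D.cf_smult A.smult_assoc1)
  qed
  then obtain \<psi> where \<psi>: "\<psi> \<in> mod_hom R ?E ?M"
    and \<psi>s: "\<And>a b. a \<in> carrier A \<Longrightarrow> b \<in> carrier A \<Longrightarrow> \<psi> (sandwich A a b) = \<beta> a b"
    by (rule natural_map_iso_lift[OF A iso M.module_axioms]) (rule that)
  \<comment> \<open>Right multiplication by 1 has the identity matrix, so only the diagonal entries
    remain.\<close>
  have scalar: "\<psi> (sandwich A a \<one>\<^bsub>A\<^esub>) = scalar_matrix n A a" if "a \<in> carrier A" for a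
    using that unfolding \<psi>s[OF that A.one_closed] \<beta>_def scalar_matrix_def
    by (intro restrict_ext) (auto simp: D.cf_e)
  let ?S = "{sandwich A a b | a b. a \<in> carrier A \<and> b \<in> carrier A}"
  have S: "?S \<subseteq> carrier ?E" using sandwich_hom[OF A] by auto
  have gen: "carrier ?E \<subseteq> N" if "submodule N R ?E" "?S \<subseteq> N" for N
    using natural_map_iso_spanned[OF A iso] that unfolding sandwich_spanned_def by auto
  have gens: "\<psi> (X \<otimes>\<^bsub>?E\<^esub> Y) = \<psi> X \<otimes>\<^bsub>?M\<^esub> \<psi> Y" if XY: "X \<in> ?S" "Y \<in> ?S" for X Y
  proof -
    obtain a b a' b' where ab: "a \<in> carrier A" "b \<in> carrier A" "a' \<in> carrier A" "b' \<in> carrier A"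
      and X: "X = sandwich A a b" and Y: "Y = sandwich A a' b'" using XY by auto
    \<comment> \<open>Composing sandwiches reverses the right-hand factors. This suits right
      multiplications: multiplying by the product of b' and b means first by b', then by b, which is
      the order of composition encoded by the matrix product.\<close>
    have "\<psi> (X \<otimes>\<^bsub>?E\<^esub> Y) = \<beta> (a \<otimes>\<^bsub>A\<^esub> a') (b' \<otimes>\<^bsub>A\<^esub> b)"
      using ab by (simp add: X Y sandwich_compose[OF A] \<psi>s)
    also have "\<dots> = \<beta> a b \<otimes>\<^bsub>?M\<^esub> \<beta> a' b'"
    proof (rule matrix_eqI)
      show "\<beta> (a \<otimes>\<^bsub>A\<^esub> a') (b' \<otimes>\<^bsub>A\<^esub> b) \<in> carrier ?M" using ab by (intro \<beta>c) auto
      show "\<beta> a b \<otimes>\<^bsub>?M\<^esub> \<beta> a' b' \<in> carrier ?M" using ab by (intro M.m_closed \<beta>c)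
      fix i j assume ij: "i < n" "j < n"
      \<comment> \<open>Expanding \<open>e j\<close> times \<open>b'\<close> in the basis under this
        linear map produces the sum over the middle index of the matrix product.\<close>
      define f where "f = (\<lambda>y\<in>carrier A. cf i (y \<otimes>\<^bsub>A\<^esub> b) \<odot>\<^bsub>A\<^esub> (a \<otimes>\<^bsub>A\<^esub> a'))"
      have f: "f \<in> mod_hom R A A" unfolding f_def
        using ij ab by (intro mod_hom_restrictI A.module_axioms)
          (auto simp: A.l_distr A.smult_mult_left D.cf_add D.cf_smult A.smult_l_distr A.smult_assoc1)
      have ejb: "e j \<otimes>\<^bsub>A\<^esub> b' \<in> carrier A" using ij ab by simp
      have "\<beta> (a \<otimes>\<^bsub>A\<^esub> a') (b' \<otimes>\<^bsub>A\<^esub> b) (i, j) = f (e j \<otimes>\<^bsub>A\<^esub> b')"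
        using ij ab by (simp add: \<beta>E f_def A.m_assoc)
      also have "\<dots> = (\<Oplus>\<^bsub>A\<^esub>l\<in>{..<n}. cf l (e j \<otimes>\<^bsub>A\<^esub> b') \<odot>\<^bsub>A\<^esub> f (e l))"
        by (rule D.hom_expand[OF A.module_axioms f ejb])
      also have "\<dots> = (\<Oplus>\<^bsub>A\<^esub>l\<in>{..<n}. \<beta> a b (i, l) \<otimes>\<^bsub>A\<^esub> \<beta> a' b' (l, j))"
        using ij ab by (intro A.M.finsum_cong' refl)
          (auto simp: \<beta>E f_def A.smult_mult_left A.smult_mult_right)
      also have "\<dots> = (\<beta> a b \<otimes>\<^bsub>?M\<^esub> \<beta> a' b') (i, j)" using ij by simp
      finally show "\<beta> (a \<otimes>\<^bsub>A\<^esub> a') (b' \<otimes>\<^bsub>A\<^esub> b) (i, j) = (\<beta> a b \<otimes>\<^bsub>?M\<^esub> \<beta> a' b') (i, j)" .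
    qed
    also have "\<dots> = \<psi> X \<otimes>\<^bsub>?M\<^esub> \<psi> Y" using ab by (simp only: X Y \<psi>s)
    finally show ?thesis .
  qed
  \<comment> \<open>The lift \<open>\<psi>\<close> is known only as a linear map; it respects
    products of sandwiches, and these span End(A).\<close>
  have mult: "\<psi> (X \<otimes>\<^bsub>?E\<^esub> Y) = \<psi> X \<otimes>\<^bsub>?M\<^esub> \<psi> Y" if "X \<in> carrier ?E" "Y \<in> carrier ?E" for X Y
    by (rule mult_on_generators[OF E.assoc_algebra_axioms M.assoc_algebra_axioms \<psi> S _ _ that])
      (rule gen gens; assumption)+
  have "\<one>\<^bsub>?E\<^esub> = sandwich A \<one>\<^bsub>A\<^esub> \<one>\<^bsub>A\<^esub>"
    by (simp add: sandwich_def restrict_def fun_eq_iff)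
  then have "\<psi> \<one>\<^bsub>?E\<^esub> = scalar_matrix n A \<one>\<^bsub>A\<^esub>" using scalar[OF A.one_closed] by (simp only:)
  also have "\<dots> = \<one>\<^bsub>?M\<^esub>" by (simp add: scalar_matrix_def)
  finally have "\<psi> \<in> alg_hom R ?E ?M" using mult by (intro alg_homI \<psi>)
  then show ?thesis using scalar by (rule that)
qed

text \<open>End(A) does not live in the type of objects, so the isomorphic algebra
  \<open>mat_obj n (base_obj R)\<close> stands in for it. The isomorphism \<open>m\<close> ends the
  first factor and its inverse \<open>m'\<close> begins the second; they cancel in the composite,
  which leaves \<open>\<psi>\<close> on the left regular representation.\<close>

lemma diag_factors:
  fixes A :: "('r, 'b) obj"
  assumes A: "assoc_algebra R A" and iso: "natural_map_iso R A" and D: "dual_basis R A {..<n} e cf"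
  obtains \<phi> \<psi> where "\<phi> \<in> alg_hom R A (mat_obj n (base_obj R :: ('r, 'b) obj))"
    and "\<psi> \<in> alg_hom R (mat_obj n (base_obj R :: ('r, 'b) obj)) (mat_obj n A)"
    and "compose (carrier A) \<psi> \<phi> = diag n A"
proof -
  let ?B = "base_obj R :: ('r, 'b) obj" and ?E = "End_mod R A" and ?L = "\<lambda>a\<in>carrier A. sandwich A a \<one>\<^bsub>A\<^esub>"
  interpret A: matrices R A by (rule matrices.intro[OF A])
  interpret E: assoc_algebra R ?E by (rule End_mod[OF A.module_axioms])
  interpret Sc: transported R "self_algebra R" "Scalar :: 'r \<Rightarrow> ('r, 'b) univ"
    by (rule transported_base) (rule A.R.is_cring)
  have B: "assoc_algebra R ?B" unfolding base_obj_def by (rule Sc.transport_alg)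
  interpret MB: transported R "matrix_algebra n ?B" Matrix by (rule transported_mat[OF B])
  interpret MA: transported R "matrix_algebra n A" Matrix by (rule transported_mat[OF A])
  have MBa: "assoc_algebra R (mat_obj n ?B)" unfolding mat_obj_def by (rule MB.transport_alg)
  obtain m where m: "m \<in> alg_hom R ?E (mat_obj n ?B)"
    and bij: "bij_betw m (mod_hom R A A) (carrier (mat_obj n ?B))"
    by (rule End_mod_matrix_iso[OF D])
  obtain m' where m': "m' \<in> alg_hom R (mat_obj n ?B) ?E" and m'm: "\<And>T. T \<in> carrier ?E \<Longrightarrow> m' (m T) = T"
    using alg_iso_inv[OF E.assoc_algebra_axioms MBa m] bij by (metis End_mod_simps(1))
  obtain \<psi> where \<psi>: "\<psi> \<in> alg_hom R ?E (matrix_algebra n A)"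
    and \<psi>s: "\<And>a. a \<in> carrier A \<Longrightarrow> \<psi> (sandwich A a \<one>\<^bsub>A\<^esub>) = scalar_matrix n A a"
    by (rule End_mod_to_matrices[OF A iso D]) (rule that)
  have L: "?L \<in> alg_hom R A ?E" by (rule left_mult_alg_hom[OF A])
  let ?h = "restrict Matrix (carrier (matrix_algebra n A))"
  have h: "?h \<in> alg_hom R (matrix_algebra n A) (mat_obj n A)"
    unfolding mat_obj_def by (rule MA.h_alg_hom)
  show ?thesis
  proof (rule that)
    show "compose (carrier A) m ?L \<in> alg_hom R A (mat_obj n ?B)"
      by (rule alg_hom_compose[OF A L m])
    show "compose (carrier (mat_obj n ?B)) ?h (compose (carrier (mat_obj n ?B)) \<psi> m')
        \<in> alg_hom R (mat_obj n ?B) (mat_obj n A)"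
      by (rule alg_hom_compose[OF MBa alg_hom_compose[OF MBa m' \<psi>] h])
    show "compose (carrier A) (compose (carrier (mat_obj n ?B)) ?h (compose (carrier (mat_obj n ?B)) \<psi> m'))
        (compose (carrier A) m ?L) = diag n A"
    proof (rule extensionalityI[of _ "carrier A"])
      fix a assume a: "a \<in> carrier A"
      have s: "sandwich A a \<one>\<^bsub>A\<^esub> \<in> carrier ?E" using sandwich_hom[OF A a A.one_closed] by simp
      have "m (sandwich A a \<one>\<^bsub>A\<^esub>) \<in> carrier (mat_obj n ?B)"
        by (rule mod_hom_closed[OF alg_homD(1)[OF m] s])
      moreover have "scalar_matrix n A a \<in> carrier (matrix_algebra n A)"
        using mod_hom_closed[OF alg_homD(1)[OF \<psi>] s] \<psi>s[OF a] by (simp only:)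
      ultimately show "compose (carrier A) (compose (carrier (mat_obj n ?B)) ?h
          (compose (carrier (mat_obj n ?B)) \<psi> m')) (compose (carrier A) m ?L) a = diag n A a"
        using a m'm[OF s] \<psi>s[OF a] by (simp add: compose_def diag_def del: matrix_algebra_simps)
    qed (auto simp: diag_def)
  qed
qed

section \<open>The torsion bound\<close>

theorem theorem3p1p2:
  fixes R :: "'r ring"
    and A :: "('r, 'b) obj"
    and Fo :: "('r, 'b) obj \<Rightarrow> 'g monoid"
    and Fm :: "('r, 'b) obj \<Rightarrow> ('r, 'b) obj \<Rightarrow> (('r, 'b) univ \<Rightarrow> ('r, 'b) univ) \<Rightarrow> 'g \<Rightarrow> 'g"
    and n :: nat
  assumes "cring R"
    and "azumaya R A"
    and "free_of_rank R A n"
    and "D_functor R Fo Fm"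
  shows "torsion (n\<^sup>2) (Fo A)"
proof (cases "n = 0")
  \<comment> \<open>Norms exist for positive matrix sizes only, so rank 0 is separate; there the
    exponent is 0.\<close>
  case True
  then show ?thesis by (simp add: torsion_def)
next
  case False
  then have n: "n \<ge> 1" by simp
  interpret F: D_functor R Fo Fm by fact
  let ?B = "base_obj R :: ('r, 'b) obj"
  have A: "assoc_algebra R A" "faithful R A" "natural_map_iso R A"
    using assms(2) by (auto simp: azumaya_def)
  interpret A: assoc_algebra R A by (rule A(1))
  obtain e cf where D: "dual_basis R A {..<n} e cf"
    by (rule free_of_rank_dual_basis[OF A.module_axioms assms(3)])
  have AzA: "A \<in> Az R" by (rule AzI[OF A(1) D A(2,3)])
  have AzMA: "mat_obj n A \<in> Az R" by (rule mat_obj_Az[OF A(1) D A(2,3) n])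
  obtain e' cf' where B: "assoc_algebra R ?B" "faithful R ?B" "natural_map_iso R ?B"
    "dual_basis R ?B ((UNIV \<times> UNIV) \<times> UNIV :: ((unit \<times> unit) \<times> unit) set) e' cf'"
    by (rule base_obj_Az[OF assms(1)])
  have AzB: "?B \<in> Az R" by (rule AzI[OF B(1,4,2,3)])
  have AzMB: "mat_obj n ?B \<in> Az R" by (rule mat_obj_Az[OF B(1,4,2,3) n])
  obtain \<phi> \<psi> where \<phi>: "\<phi> \<in> alg_hom R A (mat_obj n ?B)" and \<psi>: "\<psi> \<in> alg_hom R (mat_obj n ?B) (mat_obj n A)"
    and diag: "compose (carrier A) \<psi> \<phi> = diag n A"
    by (rule diag_factors[OF A(1,3) D])
  interpret GA: comm_group "Fo A" by (rule F.Fo_group[OF AzA])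
  interpret GMA: comm_group "Fo (mat_obj n A)" by (rule F.Fo_group[OF AzMA])
  interpret GMB: comm_group "Fo (mat_obj n ?B)" by (rule F.Fo_group[OF AzMB])
  \<comment> \<open>Two norms enter in different roles: the one for \<open>A\<close> through its
    composition law, the one for the base ring through the torsion of its kernel.\<close>
  obtain \<rho> where \<rho>: "\<rho> \<in> hom (Fo (mat_obj n A)) (Fo A)"
    and \<rho>_diag: "\<And>x. x \<in> carrier (Fo A) \<Longrightarrow> \<rho> (Fm A (mat_obj n A) (diag n A) x) = x [^]\<^bsub>Fo A\<^esub> n"
    using F.matrix_norm[OF AzA n] by blast
  obtain \<sigma> where \<sigma>: "\<sigma> \<in> hom (Fo (mat_obj n ?B)) (Fo ?B)"
    and tors: "torsion n ((Fo (mat_obj n ?B))\<lparr>carrier := kernel (Fo (mat_obj n ?B)) (Fo ?B) \<sigma>\<rparr>)"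
    using F.matrix_norm[OF AzB n] by blast
  have pow_n: "y [^]\<^bsub>Fo (mat_obj n ?B)\<^esub> n = \<one>\<^bsub>Fo (mat_obj n ?B)\<^esub>" if y: "y \<in> carrier (Fo (mat_obj n ?B))" for y
  proof -
    have "\<sigma> y \<in> carrier (Fo ?B)" using \<sigma> y by (auto simp: hom_def)
    then have "\<sigma> y = \<one>\<^bsub>Fo ?B\<^esub>" using F.base_trivial by (auto simp: trivial_group_def)
    then have "y \<in> kernel (Fo (mat_obj n ?B)) (Fo ?B) \<sigma>" using y by (simp add: kernel_def)
    \<comment> \<open>The torsion hypothesis speaks of powers in the kernel as a group of its own;
      these agree with the powers in the ambient group.\<close>
    then show ?thesis using tors by (simp add: torsion_def flip: GMB.nat_pow_consistent)
  qed
  have F\<psi>: "Fm (mat_obj n ?B) (mat_obj n A) \<psi> \<in> hom (Fo (mat_obj n ?B)) (Fo (mat_obj n A))"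
    by (rule F.Fm_hom[OF AzMB AzMA \<psi>])
  interpret H\<psi>: group_hom "Fo (mat_obj n ?B)" "Fo (mat_obj n A)" "Fm (mat_obj n ?B) (mat_obj n A) \<psi>"
    by (intro group_hom.intro group_hom_axioms.intro GMB.is_group GMA.is_group F\<psi>)
  interpret H\<rho>: group_hom "Fo (mat_obj n A)" "Fo A" \<rho>
    by (intro group_hom.intro group_hom_axioms.intro GA.is_group GMA.is_group \<rho>)
  show ?thesis unfolding torsion_def
  proof
    fix x assume x: "x \<in> carrier (Fo A)"
    define y where "y = Fm A (mat_obj n ?B) \<phi> x"
    have y: "y \<in> carrier (Fo (mat_obj n ?B))"
      using F.Fm_hom[OF AzA AzMB \<phi>] x by (auto simp: y_def hom_def)
    let ?z = "Fm (mat_obj n ?B) (mat_obj n A) \<psi> y"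
    have z: "?z \<in> carrier (Fo (mat_obj n A))" using y by simp
    \<comment> \<open>Functoriality replaces the value of the functor at \<open>diag\<close> by its
      values at the two factors. This accounts for one exponent \<open>n\<close>; the other comes
      from the torsion of the group of the middle object.\<close>
    have "x [^]\<^bsub>Fo A\<^esub> n = \<rho> ?z"
      using F.Fm_comp[OF AzA AzMB AzMA \<phi> \<psi> x] \<rho>_diag[OF x] by (simp add: diag y_def)
    then have "(x [^]\<^bsub>Fo A\<^esub> n) [^]\<^bsub>Fo A\<^esub> n = \<rho> (?z [^]\<^bsub>Fo (mat_obj n A)\<^esub> n)"
      using z by (simp add: H\<rho>.hom_nat_pow)
    also have "?z [^]\<^bsub>Fo (mat_obj n A)\<^esub> n = \<one>\<^bsub>Fo (mat_obj n A)\<^esub>"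
      using y pow_n[OF y] H\<psi>.hom_nat_pow[OF y, of n] by simp
    finally show "x [^]\<^bsub>Fo A\<^esub> n\<^sup>2 = \<one>\<^bsub>Fo A\<^esub>"
      using x by (simp add: GA.nat_pow_pow power2_eq_square)
  qed
qed

end
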